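(* Consider the kinematics $\dot R=R\omega^\times$, $\dot p=v$, $\dot v=g+Ra$ (with $R\in SO(3)$, $p,v\in\mathbb R^3$ and constant gravity vector $g\in\mathbb R^3$) with landmark measurements $y_i=R^\top(p_i-p)$, $i=1,\dots,N$, together with the hybrid observer (not using $g$) with state $(\hat R,\eta,\hat p,\hat v,\hat g)\in SO(3)\times(\mathbb R^3)^4$ which flows, when $\tau\in[0,T_M]$, as $$\dot{\hat R}=\hat R(\omega+\hat R^\top\eta)^\times,\quad\dot\eta=0_{3\times1},\quad\dot{\hat p}=\eta^\times(\hat p-p_c)+\hat v,\quad\dot{\hat v}=\eta^\times\hat v+\hat g+\hat Ra,\quad\dot{\hat g}=\eta^\times\hat g,$$ and jumps, when $\tau=0$, as $$\hat R^+=\hat R,\quad\eta^+=k_R\sigma_R,\quad\hat p^+=\hat p+k_py,\quad\hat v^+=\hat v+k_vy,\quad\hat g^+=\hat g+k_gy,$$ where $k_R,k_p,k_v,k_g>0$ are scalars, $\sigma_R=\tfrac12\sum_{i=1}^Nk_i(p_i-p_c)^\times(p_i-\hat p-\hat Ry_i)$, $y=\sum_{i=1}^Nk_i(p_i-\hat p-\hat Ry_i)$, and the timer obeys $\dot\tau=-1$ for $\tau\in[0,T_M]$, $\tau^+\in[T_m,T_M]$ for $\tau=0$, $\tau(0)\in[0,T_M]$. Suppose that $0<T_m\le T_M<\infty$, that at least three of the $N\ge3$ landmarks $p_1,\dots,p_N\in\mathbb R^3$ are non-collinear, and that there exists a symmetric positive definite matrix $P\in\mathbb R^{9\times9}$ such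 that $$\Xi_P(\tau):=A_g^\top\Phi(\tau)^\top P\,\Phi(\tau)A_g-P<0\qquad\text{for all }\tau\in[T_m,T_M],$$ where $\Phi(\tau)=\exp(A\tau)$, $A_g=I_9-KC$, $K=[k_pI_3,\ k_vI_3,\ k_gI_3]^\top$, $$A=\begin{bmatrix}0_{3\times3}&I_3&0_{3\times3}\\0_{3\times3}&0_{3\times3}&I_3\\0_{3\times3}&0_{3\times3}&0_{3\times3}\end{bmatrix},\qquad C=[I_3\ \ 0_{3\times3}\ \ 0_{3\times3}],$$ and $<0$ means negative definite. Then, for any $0<\epsilon<1$, there exist constants $\eta^*,k_R^*>0$ such that, for any $0<k_R<k_R^*$, the closed set $$\bar{\mathcal A}=\{(\tilde R,\eta,\mathsf x,\tau)\in SO(3)\times\mathbb R^3\times\mathbb R^9\times[0,T_M]:\ \tilde R=I_3,\ \|\eta\|=0,\ \|\mathsf x\|=0\}$$ is exponentially stable for the closed-loop estimation-error system with state $x_1=(\tilde R,\eta,\mathsf x,\tau)$, for all initial conditions with $|\tilde R(0)|_I\le\epsilon\sqrt{\varsigma_M}$, $\|\eta(0)\|\le\eta^*$ and $\mathsf x(0)\in\mathbb R^9$; that is, there exist $\kappa,\lambda>0$ such that every maximal solution $x_1$ of the error system from such an initial condition is complete and satisfies $|x_1(t,j)|_{\bar{\mathcal A}}\le\kappa e^{-\lambda(t+j)}|x_1(0,0)|_{\bar{\mathcal A}}$ for all $(t,j)\in\operatorname{dom}x_1$.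
   Context: Notation. For $x\in\mathbb R^3$, $x^\times$ is the skew-symmetric $3\times3$ matrix with $x^\times y=x\times y$ for all $y$. For $B=[b_{ij}]\in\mathbb R^{3\times3}$, $\psi(B)=\tfrac12[b_{32}-b_{23},\,b_{13}-b_{31},\,b_{21}-b_{12}]^\top$. For $R\in SO(3)$, $|R|_I\in[0,1]$ is defined by $|R|_I^2=\tfrac14\operatorname{tr}(I_3-R)$. The signals $\omega,a$ (angular velocity and apparent acceleration in the body frame) are continuously measured. Landmarks. $p_1,\dots,p_N\in\mathbb R^3$ are fixed points; $k_1,\dots,k_N>0$ are scalars with $\sum_{i=1}^Nk_i=1$; $p_c=\sum_{i=1}^Nk_ip_i$; $M=\sum_{i=1}^Nk_i(p_i-p_c)(p_i-p_c)^\top$; $\bar M=\tfrac12(\operatorname{tr}(M)I_3-M)$ (positive definite); $\varsigma_M=\lambda_{\min}(\bar M)/\lambda_{\max}(\bar M)$. Timer. $\tau$ models measurement instants $t_j$ with $0\le t_1\le T_M$ and $T_m\le t_{j+1}-t_j\le T_M$. Errors. $\tilde R=R\hat R^\top$, $\tilde p=p-\tilde R\hat p-(I_3-\tilde R)p_c$, $\tilde v=v-\tilde R\hat v$, $\tilde g=g-\tilde R\hat g$, $\mathsf x=[\tilde p^\top,\tilde v^\top,\tilde g^\top]^\top\in\mathbb R^9$. The variables $R,p,v$ do not change at jumps. The closed-loop estimation-error system is the hybrid system $$\begin{cases}\dot{\tilde R}=\tilde R(-\eta)^\times,\quad \dot\eta=0_{3\times1},\quad \dot{\mathsf x}=A\mathsf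 x,\quad \dot\tau=-1, & \tau\in[0,T_M],\\ \tilde R^+=\tilde R,\quad \eta^+=k_R\,\psi(M\tilde R),\quad \mathsf x^+=(I_9-KC)\mathsf x,\quad \tau^+\in[T_m,T_M], & \tau\in\{0\}.\end{cases}$$ Hybrid systems. A hybrid time domain is a set $E\subset\mathbb R_{\ge0}\times\mathbb N$ which is a union of intervals $[t_j,t_{j+1}]\times\{j\}$ with $0=t_0\le t_1\le\cdots$ (finitely or infinitely many, the last one, if any, possibly of the form $[t_j,T)\times\{j\}$ with $T$ finite or $+\infty$). A solution is a function $x$ on a hybrid time domain $\operatorname{dom}x$, locally absolutely continuous in $t$ for each fixed $j$, satisfying the differential equation for almost all $t$ while staying in the flow set (here $\tau\in[0,T_M]$), and with $x^+=x(t,j+1)$ obtained from $x=x(t,j)$ in the jump set (here $\tau=0$) by the jump rule. It is maximal if it cannot be extended, and complete if its domain is unbounded. $x(0)$ denotes the value at $(t,j)=(0,0)$. Distance: $|x_1|_{\bar{\mathcal A}}=\big(|\tilde R|_I^2+\|\eta\|^2+\|\mathsf x\|^2\big)^{1/2}$. *)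

theory Defs
  imports "HOL-Analysis.Analysis"
begin

unbundle no cross3_syntax
unbundle set_product_syntax

section \<open>Hybrid systems\<close>

definition hybrid_time_domain :: "(real \<times> nat) set \<Rightarrow> bool" where
  "hybrid_time_domain E \<longleftrightarrow>
     (\<exists>t :: nat \<Rightarrow> real. t 0 = 0 \<and> (\<forall>j. t j \<le> t (Suc j)) \<and> E = (\<Union>j. {t j..t (Suc j)} \<times> {j})) \<or>
     (\<exists>(t :: nat \<Rightarrow> real) J I. t 0 = 0 \<and> (\<forall>j<J. t j \<le> t (Suc j)) \<and>
        ((\<exists>T\<ge>t J. I = {t J..T}) \<or> (\<exists>T>t J. I = {t J..<T}) \<or> I = {t J..}) \<and>
        E = (\<Union>j<J. {t j..t (Suc j)} \<times> {j}) \<union> I \<times> {J})"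

definition slice :: "(real \<times> nat) set \<Rightarrow> nat \<Rightarrow> real set" where
  "slice E j = {t. (t, j) \<in> E}"

definition abs_continuous_on_interval :: "real \<Rightarrow> real \<Rightarrow> (real \<Rightarrow> 'a::metric_space) \<Rightarrow> bool" where
  "abs_continuous_on_interval a b f \<longleftrightarrow>
     (\<forall>e>0. \<exists>d>0. \<forall>n (u :: nat \<Rightarrow> real) v.
        (\<forall>i<n. a \<le> u i \<and> u i \<le> v i \<and> v i \<le> b) \<and>
        (\<forall>i<n. \<forall>j<n. i \<noteq> j \<longrightarrow> {u i<..<v i} \<inter> {u j<..<v j} = {}) \<and>
        (\<Sum>i<n. v i - u i) < d
        \<longrightarrow> (\<Sum>i<n. dist (f (u i)) (f (v i))) < e)"

definition locally_abs_continuous_on :: "real set \<Rightarrow> (real \<Rightarrow> 'a::metric_space) \<Rightarrow> bool" where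
  "locally_abs_continuous_on I f \<longleftrightarrow> (\<forall>a b. {a..b} \<subseteq> I \<longrightarrow> abs_continuous_on_interval a b f)"

text \<open>A hybrid system consists of a flow set \<open>Cset\<close>, a flow map \<open>F\<close>, a jump set \<open>Dset\<close> and a
  set-valued jump map \<open>G\<close>.  Only the values \<open>x t j\<close> with \<open>(t, j) \<in> E\<close> matter.  As usual, membership
  in the flow set is required on the interior of each interval of flow (hence, for a closed flow
  set, on the whole interval unless it is a single point).\<close>

definition hybrid_solution ::
  "'a::real_normed_vector set \<Rightarrow> ('a \<Rightarrow> 'a) \<Rightarrow> 'a set \<Rightarrow> ('a \<Rightarrow> 'a set) \<Rightarrow>
   (real \<times> nat) set \<Rightarrow> (real \<Rightarrow> nat \<Rightarrow> 'a) \<Rightarrow> bool" where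
  "hybrid_solution Cset F Dset G E x \<longleftrightarrow>
     hybrid_time_domain E \<and>
     x 0 0 \<in> closure Cset \<union> Dset \<and>
     (\<forall>j. locally_abs_continuous_on (slice E j) (\<lambda>t. x t j) \<and>
          (\<forall>t \<in> interior (slice E j). x t j \<in> Cset) \<and>
          (AE t in lebesgue. t \<in> interior (slice E j) \<longrightarrow>
             ((\<lambda>s. x s j) has_vector_derivative F (x t j)) (at t))) \<and>
     (\<forall>t j. (t, j) \<in> E \<and> (t, Suc j) \<in> E \<longrightarrow> x t j \<in> Dset \<and> x t (Suc j) \<in> G (x t j))"

definition maximal_hybrid_solution ::
  "'a::real_normed_vector set \<Rightarrow> ('a \<Rightarrow> 'a) \<Rightarrow> 'a set \<Rightarrow> ('a \<Rightarrow> 'a set) \<Rightarrow>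
   (real \<times> nat) set \<Rightarrow> (real \<Rightarrow> nat \<Rightarrow> 'a) \<Rightarrow> bool" where
  "maximal_hybrid_solution Cset F Dset G E x \<longleftrightarrow>
     hybrid_solution Cset F Dset G E x \<and>
     (\<forall>E' x'. hybrid_solution Cset F Dset G E' x' \<and> E \<subseteq> E' \<and>
              (\<forall>(t, j) \<in> E. x' t j = x t j) \<longrightarrow> E' = E)"

definition complete_domain :: "(real \<times> nat) set \<Rightarrow> bool" where
  "complete_domain E \<longleftrightarrow> \<not> bounded ((\<lambda>(t, j). (t, real j)) ` E)"


section \<open>Matrices\<close>

definition skew :: "real^3 \<Rightarrow> real^3^3" where
  "skew x = matrix (cross3 x)"

definition psi :: "real^3^3 \<Rightarrow> real^3" where
  "psi B = (1/2) *\<^sub>R vector [B$3$2 - B$2$3, B$1$3 - B$3$1, B$2$1 - B$1$2]"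

definition rot_dist :: "real^3^3 \<Rightarrow> real" where
  "rot_dist R = sqrt (trace (mat 1 - R) / 4)"

definition outer :: "real^'n \<Rightarrow> real^'n \<Rightarrow> real^'n^'n" where
  "outer u w = (\<chi> i j. u$i * w$j)"

definition eigenvalues :: "real^'n^'n \<Rightarrow> real set" where
  "eigenvalues B = {c. \<exists>v. v \<noteq> 0 \<and> B *v v = c *\<^sub>R v}"

definition eig_min :: "real^'n^'n \<Rightarrow> real" where "eig_min B = Min (eigenvalues B)"
definition eig_max :: "real^'n^'n \<Rightarrow> real" where "eig_max B = Max (eigenvalues B)"

definition positive_definite :: "real^'n^'n \<Rightarrow> bool" where
  "positive_definite B \<longleftrightarrow> transpose B = B \<and> (\<forall>v. v \<noteq> 0 \<longrightarrow> v \<bullet> (B *v v) > 0)"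

definition negative_definite :: "real^'n^'n \<Rightarrow> bool" where
  "negative_definite B \<longleftrightarrow> transpose B = B \<and> (\<forall>v. v \<noteq> 0 \<longrightarrow> v \<bullet> (B *v v) < 0)"

text \<open>The function \<open>exp\<close> is not available on \<open>real^'n^'n\<close>, whose ring product is componentwise.\<close>

definition matrix_exp :: "real^'n^'n \<Rightarrow> real^'n^'n" where
  "matrix_exp B = (\<Sum>n. (1 / fact n) *\<^sub>R (((**) B ^^ n) (mat 1)))"


section \<open>Landmarks\<close>

definition centroid :: "nat \<Rightarrow> (nat \<Rightarrow> real) \<Rightarrow> (nat \<Rightarrow> real^3) \<Rightarrow> real^3" where
  "centroid N k p = (\<Sum>i=1..N. k i *\<^sub>R p i)"

definition landmark_matrix :: "nat \<Rightarrow> (nat \<Rightarrow> real) \<Rightarrow> (nat \<Rightarrow> real^3) \<Rightarrow> real^3^3" where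
  "landmark_matrix N k p =
     (\<Sum>i=1..N. k i *\<^sub>R outer (p i - centroid N k p) (p i - centroid N k p))"

definition bar_matrix :: "real^3^3 \<Rightarrow> real^3^3" where
  "bar_matrix M = (1/2) *\<^sub>R (trace M *\<^sub>R mat 1 - M)"

definition varsigma :: "real^3^3 \<Rightarrow> real" where
  "varsigma M = eig_min (bar_matrix M) / eig_max (bar_matrix M)"


section \<open>The closed-loop estimation-error system\<close>

text \<open>Nine-dimensional space is indexed by pairs: the first index selects the block (1: position,
  2: velocity, 3: gravity), the second one the coordinate inside the block.\<close>

type_synonym vec9 = "real^(3 \<times> 3)"
type_synonym mat9 = "real^(3 \<times> 3)^(3 \<times> 3)"

definition stack :: "real^3 \<Rightarrow> real^3 \<Rightarrow> real^3 \<Rightarrow> vec9" where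
  "stack a b c = (\<chi> r. (vector [a, b, c] :: real^3^3) $ fst r $ snd r)"

definition A_mat :: mat9 where
  "A_mat = (\<chi> r c. ((if (fst r, fst c) \<in> {(1, 2), (2, 3)} then mat 1 else 0) :: real^3^3) $ snd r $ snd c)"

definition C_mat :: "real^(3 \<times> 3)^3" where
  "C_mat = (\<chi> r c. ((if fst c = 1 then mat 1 else 0) :: real^3^3) $ r $ snd c)"

definition K_mat :: "real \<Rightarrow> real \<Rightarrow> real \<Rightarrow> real^3^(3 \<times> 3)" where
  "K_mat kp kv kg = (\<chi> r c. ((vector [kp, kv, kg] :: real^3) $ fst r) * (mat 1 :: real^3^3) $ snd r $ c)"

definition Ag_mat :: "real \<Rightarrow> real \<Rightarrow> real \<Rightarrow> mat9" where
  "Ag_mat kp kv kg = mat 1 - K_mat kp kv kg ** C_mat"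

definition Phi :: "real \<Rightarrow> mat9" where
  "Phi \<tau> = matrix_exp (\<tau> *\<^sub>R A_mat)"

definition Xi :: "real \<Rightarrow> real \<Rightarrow> real \<Rightarrow> mat9 \<Rightarrow> real \<Rightarrow> mat9" where
  "Xi kp kv kg P \<tau> =
     transpose (Ag_mat kp kv kg) ** transpose (Phi \<tau>) ** P ** Phi \<tau> ** Ag_mat kp kv kg - P"

text \<open>The error state is the tuple of rotation error, \<open>\<eta>\<close>, linear error and timer.\<close>

type_synonym err_state = "(real^3^3) \<times> (real^3) \<times> vec9 \<times> real"

definition err_flow_set :: "real \<Rightarrow> err_state set" where
  "err_flow_set TM = {(R, \<eta>, X, \<tau>). rotation_matrix R \<and> 0 \<le> \<tau> \<and> \<tau> \<le> TM}"

definition err_flow :: "err_state \<Rightarrow> err_state" where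
  "err_flow = (\<lambda>(R, \<eta>, X, \<tau>). (R ** skew (- \<eta>), 0, A_mat *v X, -1))"

definition err_jump_set :: "err_state set" where
  "err_jump_set = {(R, \<eta>, X, \<tau>). rotation_matrix R \<and> \<tau> = 0}"

definition err_jump ::
  "real^3^3 \<Rightarrow> real \<Rightarrow> real \<Rightarrow> real \<Rightarrow> real \<Rightarrow> real \<Rightarrow> real \<Rightarrow> err_state \<Rightarrow> err_state set" where
  "err_jump M kR kp kv kg Tm TM =
     (\<lambda>(R, \<eta>, X, \<tau>). {(R, kR *\<^sub>R psi (M ** R), Ag_mat kp kv kg *v X, \<tau>') | \<tau>'. Tm \<le> \<tau>' \<and> \<tau>' \<le> TM})"

definition target_set :: "real \<Rightarrow> err_state set" where
  "target_set TM = {(R, \<eta>, X, \<tau>). rotation_matrix R \<and> 0 \<le> \<tau> \<and> \<tau> \<le> TM \<and> R = mat 1 \<and> norm \<eta> = 0 \<and> norm X = 0}"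

definition target_dist :: "err_state \<Rightarrow> real" where
  "target_dist = (\<lambda>(R, \<eta>, X, \<tau>). sqrt ((rot_dist R)\<^sup>2 + (norm \<eta>)\<^sup>2 + (norm X)\<^sup>2))"


section \<open>Kinematics, observer and estimation errors\<close>

text \<open>The error system above does not involve the inputs \<open>\<omega>\<close>, \<open>a\<close> or the gravity vector.  The
  lemmas at the end of this theory show that its flow and jump maps are those induced by the
  kinematics and the observer.\<close>

type_synonym plant_state = "(real^3^3) \<times> (real^3) \<times> (real^3)"
type_synonym obs_state = "(real^3^3) \<times> (real^3) \<times> (real^3) \<times> (real^3) \<times> (real^3)"

definition plant_flow :: "real^3 \<Rightarrow> real^3 \<Rightarrow> real^3 \<Rightarrow> plant_state \<Rightarrow> plant_state" where
  "plant_flow g \<omega> a = (\<lambda>(R, q, v). (R ** skew \<omega>, v, g + R *v a))"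

definition landmark_meas :: "(nat \<Rightarrow> real^3) \<Rightarrow> plant_state \<Rightarrow> nat \<Rightarrow> real^3" where
  "landmark_meas p = (\<lambda>(R, q, v) i. transpose R *v (p i - q))"

definition obs_flow :: "real^3 \<Rightarrow> real^3 \<Rightarrow> real^3 \<Rightarrow> obs_state \<Rightarrow> obs_state" where
  "obs_flow pc \<omega> a = (\<lambda>(R, \<eta>, q, v, g).
     (R ** skew (\<omega> + transpose R *v \<eta>), 0, skew \<eta> *v (q - pc) + v,
      skew \<eta> *v v + g + R *v a, skew \<eta> *v g))"

definition obs_jump ::
  "nat \<Rightarrow> (nat \<Rightarrow> real) \<Rightarrow> (nat \<Rightarrow> real^3) \<Rightarrow> real \<Rightarrow> real \<Rightarrow> real \<Rightarrow> real \<Rightarrow>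
   (nat \<Rightarrow> real^3) \<Rightarrow> obs_state \<Rightarrow> obs_state" where
  "obs_jump N k p kR kp kv kg ym = (\<lambda>(R, \<eta>, q, v, g).
     let \<sigma>R = (1/2) *\<^sub>R (\<Sum>i=1..N. k i *\<^sub>R (skew (p i - centroid N k p) *v (p i - q - R *v ym i)));
         y = (\<Sum>i=1..N. k i *\<^sub>R (p i - q - R *v ym i))
     in (R, kR *\<^sub>R \<sigma>R, q + kp *\<^sub>R y, v + kv *\<^sub>R y, g + kg *\<^sub>R y))"

definition est_error :: "real^3 \<Rightarrow> real^3 \<Rightarrow> plant_state \<Rightarrow> obs_state \<Rightarrow> real \<Rightarrow> err_state" where
  "est_error pc g = (\<lambda>(R, q, v) (Rh, \<eta>, qh, vh, gh) \<tau>.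
     let Rt = R ** transpose Rh
     in (Rt, \<eta>, stack (q - Rt *v qh - (mat 1 - Rt) *v pc) (v - Rt *v vh) (g - Rt *v gh), \<tau>))"


section \<open>Consistency of the error system\<close>

lemma skew_mult: "skew x *v y = cross3 x y" for x y :: "real^3"
proof -
  have "linear (cross3 x)" by (simp add: linear_iff cross_add_right cross_mult_right)
  then show ?thesis unfolding skew_def by (metis matrix_vector_mul(2))
qed

lemma trace_deficit:
  fixes R :: "real^3^3"
  assumes "rotation_matrix R"
  shows "trace (mat 1 - R) \<ge> 0" and "trace (mat 1 - R) = 0 \<Longrightarrow> R = mat 1"
proof -
  have o: "transpose R ** R = mat 1" 
    using assms unfolding rotation_matrix_def orthogonal_matrix by simp
  have c: "(\<Sum>i\<in>UNIV. (R$i$j)\<^sup>2) = 1" for j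
    using arg_cong[OF o, of "\<lambda>B. B$j$j"]
    by (simp add: matrix_matrix_mult_def transpose_def mat_def power2_eq_square)
  have d: "(R$j$j)\<^sup>2 \<le> 1" for j
    using member_le_sum[of j UNIV "\<lambda>i. (R$i$j)\<^sup>2"] c[of j] by simp
  have d': "R$j$j \<le> 1" for j
    using d[of j] by (simp add: abs_square_le_1 abs_le_iff)
  have tr: "trace (mat 1 - R) = (\<Sum>i\<in>UNIV. 1 - R$i$i)"
    by (simp add: trace_def mat_def)
  show "trace (mat 1 - R) \<ge> 0" unfolding tr by (rule sum_nonneg) (simp add: d')
  assume z: "trace (mat 1 - R) = 0"
  have one: "R$j$j = 1" for j
    using z d' unfolding tr by (subst (asm) sum_nonneg_eq_0_iff) auto
  have off: "R$i$j = 0" if "i \<noteq> j" for i j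
  proof -
    have "(\<Sum>i\<in>UNIV - {j}. (R$i$j)\<^sup>2) = 0"
      using c[of j] one[of j] by (simp add: sum_diff1)
    then show ?thesis using that by (subst (asm) sum_nonneg_eq_0_iff) auto
  qed
  show "R = mat 1" by (simp add: vec_eq_iff mat_def one off)
qed

lemma target_set_eq: "target_set TM = {z \<in> err_flow_set TM. target_dist z = 0}"
proof -
  have "rot_dist R = 0 \<longleftrightarrow> R = mat 1" if "rotation_matrix R" for R
    using trace_deficit(2)[OF that] by (auto simp: rot_dist_def trace_def)
  then show ?thesis
    by (auto simp: target_set_def err_flow_set_def target_dist_def add_nonneg_eq_0_iff)
qed

lemma closed_target_set: "closed (target_set TM)"
proof -
  have "target_set TM = {mat 1} \<times> {0} \<times> {0} \<times> {0..TM}"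
    by (auto simp: target_set_def rotation_matrix_def orthogonal_matrix)
  then show ?thesis by (simp add: closed_Times)
qed

lemma skew_add: "skew (x + y) = skew x + skew y"
  and transpose_skew: "transpose (skew x) = - skew x"
  and skew_minus: "skew (- x) = - skew x"
  by (simp_all add: vec_eq_iff forall_3 skew_def matrix_def transpose_def cross3_def axis_def)

lemma skew_rotate:
  assumes "rotation_matrix R"
  shows "R ** skew (transpose R *v x) = skew x ** R"
proof -
  note transpose_matrix_vector [simp del]
  have "R ** transpose R = mat 1" using assms by (simp add: rotation_matrix_def orthogonal_matrix_def)
  then show ?thesis
  by (simp add: matrix_eq skew_mult flip: matrix_vector_mul_assoc)
    (simp add: cross_rotation_matrix[OF assms, symmetric] matrix_vector_mul_assoc)
qed

lemma sum_UNIV_pair: "(\<Sum>j\<in>UNIV. f j) = (\<Sum>a\<in>UNIV. \<Sum>b\<in>UNIV. f (a, b))"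
  for f :: "'a::finite \<times> 'b::finite \<Rightarrow> real"
  by (simp add: sum.cartesian_product)

lemma mm_add_left: "(B + C) ** A = B ** A + C ** A" for A B C :: "real^3^3"
  by (simp add: vec_eq_iff matrix_matrix_mult_def distrib_right sum.distrib)

lemma A_mat_stack: "A_mat *v stack a b c = stack b c 0"
  by (simp add: vec_eq_iff forall_3 split_paired_all A_mat_def stack_def matrix_vector_mult_def sum_UNIV_pair sum_3 mat_def)

lemma Ag_mat_stack:
  "Ag_mat kp kv kg *v stack a b c = stack (a - kp *\<^sub>R a) (b - kv *\<^sub>R a) (c - kg *\<^sub>R a)"
proof -
  have C: "C_mat *v stack a b c = a"
    by (simp add: vec_eq_iff forall_3 C_mat_def stack_def matrix_vector_mult_def sum_UNIV_pair sum_3 mat_def)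
  have K: "K_mat kp kv kg *v a = stack (kp *\<^sub>R a) (kv *\<^sub>R a) (kg *\<^sub>R a)"
    by (simp add: vec_eq_iff forall_3 split_paired_all K_mat_def stack_def matrix_vector_mult_def sum_3 mat_def)
  show ?thesis
    unfolding Ag_mat_def matrix_vector_mult_diff_rdistrib matrix_vector_mul_assoc[symmetric] C K
    by (simp add: vec_eq_iff split_paired_all forall_3 stack_def)
qed

lemma bounded_linear_stack: "bounded_linear (\<lambda>(a, b, c). stack a b c)"
  unfolding linear_conv_bounded_linear[symmetric]
  by (auto simp: linear_iff vec_eq_iff split_paired_all forall_3 stack_def)

lemma bilinear_mm: "bounded_bilinear ((**) :: real^3^3 \<Rightarrow> real^3^3 \<Rightarrow> real^3^3)"
  unfolding bilinear_conv_bounded_bilinear[symmetric] bilinear_def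
  by (auto simp: linear_iff matrix_add_ldistrib mm_add_left vec_eq_iff forall_3 matrix_matrix_mult_def sum_3 algebra_simps)

lemma bilinear_mv: "bounded_bilinear ((*v) :: real^3^3 \<Rightarrow> real^3 \<Rightarrow> real^3)"
  unfolding bilinear_conv_bounded_bilinear[symmetric] bilinear_def
  by (auto simp: linear_iff vec_eq_iff forall_3 matrix_vector_mult_def sum_3 algebra_simps)

lemma linear_tr: "bounded_linear (transpose :: real^3^3 \<Rightarrow> real^3^3)"
  unfolding linear_conv_bounded_linear[symmetric]
  by (auto simp: linear_iff vec_eq_iff transpose_def)

lemma err_flow_of_observer:
  assumes z: "(z has_vector_derivative plant_flow g \<omega> a (z t)) (at t within S)"
    and w: "(w has_vector_derivative obs_flow pc \<omega> a (w t)) (at t within S)"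
    and \<tau>: "(\<tau> has_vector_derivative -1) (at t within S)"
    and rot: "rotation_matrix (fst (z t))" "rotation_matrix (fst (w t))"
  shows "((\<lambda>s. est_error pc g (z s) (w s) (\<tau> s)) has_vector_derivative
           err_flow (est_error pc g (z t) (w t) (\<tau> t))) (at t within S)"
proof -
  note transpose_matrix_vector [simp del]
  define R q v where "R = (\<lambda>s. fst (z s))" and "q = (\<lambda>s. fst (snd (z s)))" and "v = (\<lambda>s. snd (snd (z s)))"
  define Rh \<eta> qh vh gh where "Rh = (\<lambda>s. fst (w s))" and "\<eta> = (\<lambda>s. fst (snd (w s)))"
    and "qh = (\<lambda>s. fst (snd (snd (w s))))" and "vh = (\<lambda>s. fst (snd (snd (snd (w s)))))"
    and "gh = (\<lambda>s. snd (snd (snd (snd (w s)))))"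
  have zeq: "z s = (R s, q s, v s)" for s by (simp add: R_def q_def v_def)
  have weq: "w s = (Rh s, \<eta> s, qh s, vh s, gh s)" for s
    by (simp add: Rh_def \<eta>_def qh_def vh_def gh_def)
  note f = bounded_linear.has_vector_derivative[OF bounded_linear_fst]
  note n = bounded_linear.has_vector_derivative[OF bounded_linear_snd]
  let ?d = "\<lambda>f f'. (f has_vector_derivative f') (at t within S)"
  have dR: "?d R (R t ** skew \<omega>)" and dq: "?d q (v t)" and dv: "?d v (g + R t *v a)"
    using f[OF z] f[OF n[OF z]] n[OF n[OF z]] by (simp_all add: zeq plant_flow_def)
  have dRh: "?d Rh (Rh t ** skew (\<omega> + transpose (Rh t) *v \<eta> t))" and d\<eta>: "?d \<eta> 0"
    and dqh: "?d qh (skew (\<eta> t) *v (qh t - pc) + vh t)"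
    and dvh: "?d vh (skew (\<eta> t) *v vh t + gh t + Rh t *v a)"
    and dgh: "?d gh (skew (\<eta> t) *v gh t)"
    using f[OF w] f[OF n[OF w]] f[OF n[OF n[OF w]]] f[OF n[OF n[OF n[OF w]]]] n[OF n[OF n[OF n[OF w]]]]
    by (simp_all add: weq obs_flow_def)
  have rR: "rotation_matrix (R t)" and rRh: "rotation_matrix (Rh t)" using rot by (simp_all add: zeq weq)
  define Rt where "Rt = (\<lambda>s. R s ** transpose (Rh s))"
  have RtR: "Rt t *v (Rh t *v x) = R t *v x" for x
    using rRh unfolding Rt_def matrix_vector_mul_assoc matrix_mul_assoc[symmetric]
    by (simp add: rotation_matrix_def orthogonal_matrix)
  have e: "Rh t ** skew (\<omega> + transpose (Rh t) *v \<eta> t) = Rh t ** skew \<omega> + skew (\<eta> t) ** Rh t"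
    by (simp add: skew_add matrix_add_ldistrib skew_rotate[OF rRh])
  have "?d Rt (R t ** transpose (Rh t ** skew \<omega> + skew (\<eta> t) ** Rh t) + (R t ** skew \<omega>) ** transpose (Rh t))"
    unfolding Rt_def
    by (rule bounded_bilinear.has_vector_derivative[OF bilinear_mm dR bounded_linear.has_vector_derivative[OF linear_tr dRh, unfolded e]])
  moreover have tadd: "transpose (X + Y) = transpose X + transpose Y" for X Y :: "real^3^3"
    by (simp add: vec_eq_iff transpose_def)
  have mneg: "X ** (- Y) = - (X ** Y)" "(- X) ** Y = - (X ** Y)" "X ** (Y - Z) = X ** Y - X ** Z"
    for X Y Z :: "real^3^3"
    by (simp_all add: vec_eq_iff matrix_matrix_mult_def sum_negf right_diff_distrib sum_subtractf)
  have "R t ** transpose (Rh t ** skew \<omega> + skew (\<eta> t) ** Rh t) + (R t ** skew \<omega>) ** transpose (Rh t)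
      = Rt t ** skew (- \<eta> t)"
    by (simp add: tadd matrix_transpose_mul transpose_skew skew_minus mneg matrix_add_ldistrib Rt_def matrix_mul_assoc)
  ultimately have dRt: "?d Rt (Rt t ** skew (- \<eta> t))" by simp
  note mv = bounded_bilinear.has_vector_derivative[OF bilinear_mv]
  have neg: "X *v (- y) = - (X *v y)" "(- X) *v y = - (X *v y)" for X :: "real^3^3" and y
    by (simp_all add: vec_eq_iff matrix_vector_mult_def sum_negf)
  have "?d (\<lambda>s. q s - Rt s *v qh s - (mat 1 - Rt s) *v pc) (v t - Rt t *v vh t)"
    by (rule has_vector_derivative_eq_rhs,
        (rule has_vector_derivative_diff mv dq dRt dqh has_vector_derivative_const)+)
       (simp add: skew_minus mneg neg matrix_vector_right_distrib matrix_vector_mult_diff_distrib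
          matrix_vector_mul_assoc)
  moreover have "?d (\<lambda>s. v s - Rt s *v vh s) (g - Rt t *v gh t)"
    by (rule has_vector_derivative_eq_rhs,
        (rule has_vector_derivative_diff mv dv dRt dvh has_vector_derivative_const)+)
       (simp add: skew_minus mneg neg matrix_vector_right_distrib RtR, simp add: matrix_vector_mul_assoc)
  moreover have "?d (\<lambda>s. g - Rt s *v gh s) 0"
    by (rule has_vector_derivative_eq_rhs,
        (rule has_vector_derivative_diff mv dRt dgh has_vector_derivative_const)+)
       (simp add: skew_minus mneg neg matrix_vector_mul_assoc)
  ultimately have "?d (\<lambda>s. stack (q s - Rt s *v qh s - (mat 1 - Rt s) *v pc) (v s - Rt s *v vh s) (g - Rt s *v gh s))
     (stack (v t - Rt t *v vh t) (g - Rt t *v gh t) 0)"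
    using bounded_linear.has_vector_derivative[OF bounded_linear_stack
        has_vector_derivative_Pair[OF _ has_vector_derivative_Pair]] by simp
  then show ?thesis
    unfolding est_error_def zeq weq Let_def
    by (simp add: err_flow_def A_mat_stack Rt_def)
       (intro has_vector_derivative_Pair dRt[unfolded Rt_def] d\<eta> \<tau>)
qed

lemma psi_outer_mult: "psi (outer u u ** R) = - (1/2) *\<^sub>R cross3 u (transpose R *v u)"
  by (simp add: psi_def outer_def cross3_def vec_eq_iff forall_3 matrix_matrix_mult_def sum_3
      matrix_vector_mult_def transpose_def algebra_simps)

lemma psi_linear: "psi (B + B') = psi B + psi B'" "psi (c *\<^sub>R B) = c *\<^sub>R psi B" "psi 0 = 0"
  by (simp_all add: psi_def vec_eq_iff forall_3 algebra_simps)

lemma psi_landmark: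
  "psi (landmark_matrix N k p ** R) = (\<Sum>i=1..N. k i *\<^sub>R (- (1/2) *\<^sub>R
     cross3 (p i - centroid N k p) (transpose R *v (p i - centroid N k p))))"
proof -
  have "psi (sum f A ** R) = (\<Sum>i\<in>A. psi (f i ** R))" for f and A :: "nat set"
    by (induction A rule: infinite_finite_induct)
       (simp_all add: psi_linear mm_add_left)
  moreover have "(c *\<^sub>R X) ** Y = c *\<^sub>R (X ** Y)" for c and X Y :: "real^3^3"
    by (simp add: vec_eq_iff matrix_matrix_mult_def sum_distrib_left mult.assoc)
  ultimately show ?thesis
    unfolding landmark_matrix_def psi_outer_mult[symmetric] by (simp add: psi_linear)
qed

lemma err_jump_of_observer:
  assumes k: "(\<Sum>i=1..N. k i) = 1"
    and rot: "rotation_matrix (fst z)" "rotation_matrix (fst w)" and \<tau>: "Tm \<le> \<tau>'" "\<tau>' \<le> TM"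
  shows "est_error (centroid N k p) g z (obs_jump N k p kR kp kv kg (landmark_meas p z) w) \<tau>'
           \<in> err_jump (landmark_matrix N k p) kR kp kv kg Tm TM (est_error (centroid N k p) g z w \<tau>)"
proof -
  note transpose_matrix_vector [simp del]
  obtain R q v where z: "z = (R, q, v)" by (metis prod_cases3)
  obtain Rh \<eta> qh vh gh where w: "w = (Rh, \<eta>, qh, vh, gh)" by (metis prod_cases5)
  define Rt where "Rt = R ** transpose Rh"
  define pc where "pc = centroid N k p"
  have rRt: "rotation_matrix Rt"
    using rot by (auto simp: z w Rt_def rotation_matrix_def orthogonal_matrix_mul
        orthogonal_matrix_transpose det_mul)
  then have RtT: "Rt *v (transpose Rt *v x) = x" for x
    by (simp add: matrix_vector_mul_assoc rotation_matrix_def orthogonal_matrix_def)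
  have meas: "Rh *v (landmark_meas p z i) = transpose Rt *v (p i - q)" for i
    by (simp add: z landmark_meas_def Rt_def matrix_transpose_mul matrix_vector_mul_assoc)
  have sp: "(\<Sum>i=1..N. k i *\<^sub>R p i) = pc" by (simp add: pc_def centroid_def)
  have s0: "(\<Sum>i=1..N. k i *\<^sub>R (p i - pc)) = 0"
    by (simp add: scaleR_diff_right sum_subtractf sp k del: One_nat_def flip: scaleR_sum_left)
  have mvs: "(\<Sum>i=1..N. k i *\<^sub>R (X *v f i)) = X *v (\<Sum>i=1..N. k i *\<^sub>R f i)" for X :: "real^3^3" and f
    by (simp add: linear_sum[OF matrix_vector_mul_linear] matrix_vector_mult_scaleR)
  have y: "(\<Sum>i=1..N. k i *\<^sub>R (p i - qh - Rh *v landmark_meas p z i)) = pc - qh - transpose Rt *v (pc - q)"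
    unfolding meas
    by (simp add: scaleR_diff_right sum_subtractf mvs sp k del: One_nat_def flip: scaleR_sum_left)
  define y where "y = pc - qh - transpose Rt *v (pc - q)"
  have Ry: "Rt *v y = q - Rt *v qh - (mat 1 - Rt) *v pc"
    unfolding y_def matrix_vector_mult_diff_distrib RtT
    by (simp add: matrix_vector_mult_diff_rdistrib)
  let ?c = "\<lambda>i. cross3 (p i - pc)"
  have c0: "(\<Sum>i=1..N. k i *\<^sub>R ?c i x) = 0" for x
  proof -
    have "(\<Sum>i=1..N. k i *\<^sub>R ?c i x) = cross3 (\<Sum>i=1..N. k i *\<^sub>R (p i - pc)) x"
      by (induction N) (simp_all add: cross_add_left cross_mult_left)
    then show ?thesis by (simp add: s0 del: One_nat_def)
  qed
  have "k i *\<^sub>R (skew (p i - pc) *v (p i - qh - Rh *v landmark_meas p z i))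
     = k i *\<^sub>R ?c i (pc - qh - transpose Rt *v (pc - q)) - k i *\<^sub>R ?c i (transpose Rt *v (p i - pc))" for i
  proof -
    have "p i - qh - transpose Rt *v (p i - q) =
       (p i - pc) + ((pc - qh - transpose Rt *v (pc - q)) - transpose Rt *v (p i - pc))"
      by (simp add: matrix_vector_mult_diff_distrib)
    then show ?thesis unfolding meas skew_mult
      by (simp only: cross_add_right) (simp add: Cross3.right_diff_distrib scaleR_diff_right)
  qed
  then have sig: "kR *\<^sub>R (1/2) *\<^sub>R (\<Sum>i=1..N. k i *\<^sub>R (skew (p i - pc) *v (p i - qh - Rh *v landmark_meas p z i)))
     = kR *\<^sub>R psi (landmark_matrix N k p ** Rt)"
    unfolding psi_landmark pc_def[symmetric]
    by (simp add: sum_subtractf c0 scaleR_sum_right sum_negf mult.commute del: One_nat_def)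
  show ?thesis
    unfolding z w est_error_def obs_jump_def err_jump_def Let_def case_prod_conv
      Rt_def[symmetric] pc_def[symmetric] Ag_mat_stack
    unfolding y[unfolded z] sig[unfolded z] y_def[symmetric]
    using \<tau> by (auto simp: Ry[symmetric] matrix_vector_right_distrib matrix_vector_mult_scaleR diff_diff_eq)
       (simp_all add: Ry algebra_simps)
qed

end

theory Submission
  imports Defs
begin

text \<open>Between jumps \<open>\<eta>\<close> is constant, so the rotation error moves along a one-parameter subgroup and
  \<open>V = tr (M (I - R)) / 4\<close> satisfies \<open>dV/dt = - \<psi>(M R) \<bullet> \<eta> / 2\<close>.  After a jump \<open>\<eta> = k\<^sub>R \<psi>(M R)\<close> at the
  sampled \<open>R\<close>, and \<open>\<psi>(M R)\<close> varies by at most a multiple of \<open>k\<^sub>R\<close> times its sampled norm, so for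
  small \<open>k\<^sub>R\<close> each interval of flow decreases \<open>V\<close> by a multiple of \<open>|\<psi>(M R)|\<^sup>2\<close>.  In quaternion
  coordinates \<open>(s, q)\<close> of \<open>R\<close>, with \<open>N\<close> the barred matrix of \<open>M\<close>, \<open>V = q \<bullet> N q\<close> and
  \<open>|\<psi>(M R)|\<^sup>2 \<ge> 4 s\<^sup>2 |N q|\<^sup>2\<close>; the sublevel set \<open>V \<le> d\<^sup>2 \<lambda>\<^sub>m\<^sub>i\<^sub>n(N)\<close> with \<open>d < 1\<close> is invariant and stays away
  from \<open>s = 0\<close>, whence geometric decay.  The linear error is autonomous, and by compactness the
  matrix inequality makes \<open>x \<bullet> P x\<close> contract uniformly over the sampling periods.  To pass from
  absolutely continuous solutions to the closed-form flow one multiplies by the inverse flow and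
  uses that absolutely continuous functions with a.e. vanishing derivative are constant.\<close>

section \<open>Absolutely continuous functions\<close>

text \<open>The factor \<open>sqrt (varsigma M)\<close> pays for trading \<open>rot_dist\<close>
  against \<open>V\<close>. With \<open>l\<close> and \<open>L\<close> the extreme eigenvalues of
  \<open>N\<close>, \<open>V\<close> lies between \<open>l\<close> and \<open>L\<close> times the
  squared distance; hence \<open>rot_dist R \<le> d * sqrt (l / L)\<close> puts \<open>R\<close>
  into the sublevel set, and every rotation in that set has distance at most \<open>d < 1\<close>,
  whereas half turns have distance 1. The number \<epsilon> itself cannot serve as \<open>d\<close>:
  on the first interval of flow \<eta>(0) is unrelated to the gradient and \<open>V\<close> may
  grow. The gap between \<epsilon> and \<open>d\<close> absorbs this growth and determines the bound
  on \<eta>(0). Two intervals contribute no contraction: the first, because the initial timer may be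
  smaller than \<open>Tm\<close>, and the one containing the current time, because it is cut off
  there. Both only enlarge the multiplicative constants. The matrix inequality describes a jump
  followed by a flow, so the quadratic form of the linear error is compared at the ends of
  successive intervals of flow.\<close>

lemma abs_continuousE:
  assumes "abs_continuous_on_interval a b f" "e > 0"
  obtains d where "d > 0" "\<And>n (u :: nat \<Rightarrow> real) v.
        (\<And>i. i < n \<Longrightarrow> a \<le> u i \<and> u i \<le> v i \<and> v i \<le> b) \<Longrightarrow>
        (\<And>i j. i < n \<Longrightarrow> j < n \<Longrightarrow> i \<noteq> j \<Longrightarrow> {u i<..<v i} \<inter> {u j<..<v j} = {}) \<Longrightarrow>
        (\<Sum>i<n. v i - u i) < d \<Longrightarrow> (\<Sum>i<n. dist (f (u i)) (f (v i))) < e"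
proof -
  from assms(1)[unfolded abs_continuous_on_interval_def, rule_format, OF assms(2)]
  obtain d where "d > 0" and d: "\<forall>n (u :: nat \<Rightarrow> real) v.
        (\<forall>i<n. a \<le> u i \<and> u i \<le> v i \<and> v i \<le> b) \<and>
        (\<forall>i<n. \<forall>j<n. i \<noteq> j \<longrightarrow> {u i<..<v i} \<inter> {u j<..<v j} = {}) \<and>
        (\<Sum>i<n. v i - u i) < d
        \<longrightarrow> (\<Sum>i<n. dist (f (u i)) (f (v i))) < e" by (elim exE conjE)
  show thesis by (rule that[OF \<open>d > 0\<close>], rule d[rule_format], intro conjI allI impI) simp_all
qed

text \<open>The same families of disjoint intervals that control \<open>f\<close> control
  \<open>h\<close>. The term \<open>t - s\<close> on the right also covers Lipschitz functions and
  sums with the identity, so most absolute continuity claims below reduce to this one.\<close>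

lemma abs_continuous_dominated:
  fixes f :: "real \<Rightarrow> 'a::metric_space" and h :: "real \<Rightarrow> 'b::metric_space"
  assumes f: "abs_continuous_on_interval a b f" and K: "K > 0"
    and h: "\<And>s t. s \<in> {a..b} \<Longrightarrow> t \<in> {a..b} \<Longrightarrow> s \<le> t \<Longrightarrow> dist (h s) (h t) \<le> K * (dist (f s) (f t) + (t - s))"
  shows "abs_continuous_on_interval a b h"
  unfolding abs_continuous_on_interval_def
proof (intro allI impI)
  fix e :: real assume e: "e > 0"
  then have "e / (2 * K) > 0" using K by simp
  then obtain d where d: "d > 0" and D: "\<And>n (u :: nat \<Rightarrow> real) v.
        (\<And>i. i < n \<Longrightarrow> a \<le> u i \<and> u i \<le> v i \<and> v i \<le> b) \<Longrightarrow>
        (\<And>i j. i < n \<Longrightarrow> j < n \<Longrightarrow> i \<noteq> j \<Longrightarrow> {u i<..<v i} \<inter> {u j<..<v j} = {}) \<Longrightarrow>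
        (\<Sum>i<n. v i - u i) < d \<Longrightarrow> (\<Sum>i<n. dist (f (u i)) (f (v i))) < e / (2 * K)"
    by (rule abs_continuousE[OF f]) blast
  show "\<exists>d>0. \<forall>n (u :: nat \<Rightarrow> real) v.
        (\<forall>i<n. a \<le> u i \<and> u i \<le> v i \<and> v i \<le> b) \<and>
        (\<forall>i<n. \<forall>j<n. i \<noteq> j \<longrightarrow> {u i<..<v i} \<inter> {u j<..<v j} = {}) \<and>
        (\<Sum>i<n. v i - u i) < d
        \<longrightarrow> (\<Sum>i<n. dist (h (u i)) (h (v i))) < e"
  proof (intro exI[of _ "min d (e / (2 * K))"] conjI allI impI; (elim conjE)?)
    \<comment> \<open>One half of the budget \<open>e / K\<close> goes to the variation of
      \<open>f\<close>, the other half to the total length of the intervals.\<close>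
    show "min d (e / (2 * K)) > 0" using d e K by simp
    fix n and u v :: "nat \<Rightarrow> real"
    assume 1: "\<forall>i<n. a \<le> u i \<and> u i \<le> v i \<and> v i \<le> b"
      and 2: "\<forall>i<n. \<forall>j<n. i \<noteq> j \<longrightarrow> {u i<..<v i} \<inter> {u j<..<v j} = {}"
      and 3: "(\<Sum>i<n. v i - u i) < min d (e / (2 * K))"
    have "(\<Sum>i<n. dist (h (u i)) (h (v i))) \<le> (\<Sum>i<n. K * (dist (f (u i)) (f (v i)) + (v i - u i)))"
      using 1 by (intro sum_mono h) auto
    also have "\<dots> = K * ((\<Sum>i<n. dist (f (u i)) (f (v i))) + (\<Sum>i<n. v i - u i))"
      by (simp add: sum_distrib_left[symmetric] sum.distrib)
    also have "\<dots> < K * (e / (2 * K) + e / (2 * K))"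
      using D[of n u v] 1 2 3 K by (intro mult_strict_left_mono add_strict_mono) auto
    also have "\<dots> = e" using K by (simp add: field_simps)
    finally show "(\<Sum>i<n. dist (h (u i)) (h (v i))) < e" .
  qed
qed

text \<open>Cousin's lemma: tags outside the exceptional null set contribute at most \<open>e (b - a)\<close>, and the
  intervals tagged by exceptional points lie in an open set of small measure, where absolute
  continuity applies.\<close>

lemma abs_continuous_zero_derivative_const:
  fixes f :: "real \<Rightarrow> 'a::real_normed_vector"
  assumes ab: "a \<le> b" and f: "abs_continuous_on_interval a b f"
    and der: "AE t in lebesgue. t \<in> {a<..<b} \<longrightarrow> (f has_vector_derivative 0) (at t)"
  shows "f b = f a"
proof -
  define N where "N = {t \<in> {a..b}. \<not> (f has_vector_derivative 0) (at t)}"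
  have "{t. \<not> (t \<in> {a<..<b} \<longrightarrow> (f has_vector_derivative 0) (at t))} \<in> null_sets lebesgue"
    using der by (simp add: completion.AE_iff_null_sets)
  \<comment> \<open>The hypothesis says nothing at \<open>a\<close> and \<open>b\<close>, which may
    be tags; they are added to the exceptional set.\<close>
  then have "negligible ({a, b} \<union> {t. \<not> (t \<in> {a<..<b} \<longrightarrow> (f has_vector_derivative 0) (at t))})"
    by (intro negligible_Un) (auto simp: negligible_iff_null_sets[symmetric])
  then have Nneg: "negligible N"
    by (rule negligible_subset) (auto simp: N_def)
  have "norm (f b - f a) \<le> e * (b - a) + e" if e: "e > 0" for e
  proof -
    obtain d where d: "d > 0" and D: "\<And>n (u :: nat \<Rightarrow> real) v.
        (\<And>i. i < n \<Longrightarrow> a \<le> u i \<and> u i \<le> v i \<and> v i \<le> b) \<Longrightarrow>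
        (\<And>i j. i < n \<Longrightarrow> j < n \<Longrightarrow> i \<noteq> j \<Longrightarrow> {u i<..<v i} \<inter> {u j<..<v j} = {}) \<Longrightarrow>
        (\<Sum>i<n. v i - u i) < d \<Longrightarrow> (\<Sum>i<n. dist (f (u i)) (f (v i))) < e"
      by (rule abs_continuousE[OF f e]) blast
    have Ns: "N \<in> sets lebesgue" using Nneg by (simp add: negligible_imp_sets)
    obtain U where U: "open U" "N \<subseteq> U" "U - N \<in> lmeasurable" "emeasure lebesgue (U - N) < ennreal d"
      using sets_lebesgue_outer_open[OF Ns d] .
    have "U = N \<union> (U - N)" using U by auto
    moreover have "N \<in> lmeasurable" using Nneg by (simp add: negligible_imp_measurable)
    ultimately have Um: "U \<in> lmeasurable" using U(3) by (metis fmeasurable.Un)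
    have "measure lebesgue U = measure lebesgue (U - N)"
      using Nneg by (metis Um fmeasurableD measure_Diff_null_set negligible_iff_null_sets)
    moreover have "measure lebesgue (U - N) < d"
      using U(3,4) d by (simp add: emeasure_eq_measure2 ennreal_less_iff)
    ultimately have Ud: "measure lebesgue U < d" by simp
    have "\<exists>r>0. \<forall>y. \<bar>y - x\<bar> < r \<longrightarrow> norm (f y - f x) \<le> e * \<bar>y - x\<bar>" if "x \<in> {a..b} - N" for x
    proof -
      have "(f has_derivative (\<lambda>h. 0)) (at x)"
        using that by (auto simp: N_def has_vector_derivative_def)
      then have "\<forall>e>0. \<exists>d>0. \<forall>y. norm (y - x) < d \<longrightarrow> norm (f y - f x - 0) \<le> e * norm (y - x)"
        unfolding has_derivative_at_alt by simp
      then show ?thesis using e by simp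
    qed
    then obtain r where r: "\<And>x. x \<in> {a..b} - N \<Longrightarrow> r x > 0"
      "\<And>x y. x \<in> {a..b} - N \<Longrightarrow> \<bar>y - x\<bar> < r x \<Longrightarrow> norm (f y - f x) \<le> e * \<bar>y - x\<bar>"
      by metis
    define g where "g = (\<lambda>x. if x \<in> N then U else if x \<in> {a..b} then ball x (r x) else UNIV)"
    have "gauge g" unfolding g_def gauge_def using U r by auto
    then obtain p where p: "p tagged_division_of {a..b}" "g fine p"
      by (rule fine_division_exists_real)
    have fin: "finite p" using p(1) by (rule tagged_division_of_finite)
    have box: "\<exists>u v. K = {u..v} \<and> u \<le> x \<and> x \<le> v \<and> a \<le> u \<and> v \<le> b \<and> K \<subseteq> g x" if "(x, K) \<in> p" for x K
    proof -
      have "x \<in> K" "K \<subseteq> {a..b}"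
        using tagged_division_ofD(2,3)[OF p(1) that] by auto
      moreover obtain u v where K: "K = cbox u v"
        using tagged_division_ofD(4)[OF p(1) \<open>(x, K) \<in> p\<close>] by blast
      moreover have "K \<subseteq> g x" using p(2) that by (auto simp: fine_def)
      ultimately show ?thesis by (intro exI[of _ u] exI[of _ v]) auto
    qed
    define Bad where "Bad = {(x, K) \<in> p. x \<in> N}"
    define Good where "Good = {(x, K) \<in> p. x \<notin> N}"
    have split: "p = Bad \<union> Good" "Bad \<inter> Good = {}" "finite Bad" "finite Good"
      using fin by (auto simp: Bad_def Good_def intro: finite_subset[of _ p])
    let ?D = "\<lambda>(x, K). f (Sup K) - f (Inf K)"
    have sumf: "f b - f a = sum ?D Bad + sum ?D Good"
      using additive_tagged_division_1[OF ab p(1), of f] sum.union_disjoint[OF split(3,4,2), of ?D]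
      unfolding split(1)[symmetric] by simp
    have good: "norm (sum ?D Good) \<le> e * (b - a)"
    proof -
      have "norm (sum ?D Good) \<le> (\<Sum>(x, K)\<in>Good. e * (Sup K - Inf K))"
      proof (rule sum_norm_le, safe)
        fix x K assume "(x, K) \<in> Good"
        then have xK: "(x, K) \<in> p" "x \<notin> N" by (auto simp: Good_def)
        from box[OF xK(1)] obtain u v where K: "K = {u..v}" "u \<le> x" "x \<le> v" "a \<le> u" "v \<le> b" "K \<subseteq> g x" by blast
        have x: "x \<in> {a..b} - N" using K xK by auto
        have "K \<subseteq> ball x (r x)" using K(6) x by (auto simp: g_def)
        moreover have "u \<in> K" "v \<in> K" using K by auto
        ultimately have "\<bar>u - x\<bar> < r x" "\<bar>v - x\<bar> < r x" by (auto simp: dist_real_def)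
        then have "norm (f u - f x) \<le> e * \<bar>u - x\<bar>" "norm (f v - f x) \<le> e * \<bar>v - x\<bar>"
          using r(2)[OF x] by auto
        \<comment> \<open>The derivative estimate is centred at the tag, so the increment is split
          there; the two bounds add up to \<open>e * (v - u)\<close>.\<close>
        moreover have "norm (f v - f u) \<le> norm (f v - f x) + norm (f u - f x)"
          using norm_triangle_ineq4[of "f v - f x" "f u - f x"] by simp
        ultimately have "norm (f v - f u) \<le> e * (v - x) + e * (x - u)" using K by auto
        then show "norm (f (Sup K) - f (Inf K)) \<le> e * (Sup K - Inf K)"
          using K by (simp add: algebra_simps)
      qed
      also have "\<dots> \<le> (\<Sum>(x, K)\<in>p. e * (Sup K - Inf K))"
      proof (rule sum_mono2[OF fin])
        show "Good \<subseteq> p" using split by auto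
        fix z assume "z \<in> p - Good"
        then show "0 \<le> (case z of (x, K) \<Rightarrow> e * (Sup K - Inf K))"
          using box[of "fst z" "snd z"] e by (cases z) auto
      qed
      also have "\<dots> = e * (\<Sum>(x, K)\<in>p. Sup K - Inf K)"
        by (simp add: sum_distrib_left case_prod_unfold)
      also have "\<dots> = e * (b - a)"
        using additive_tagged_division_1[OF ab p(1), of "\<lambda>x. x"] by simp
      finally show ?thesis .
    qed
    have bad: "norm (sum ?D Bad) \<le> e"
    proof -
      \<comment> \<open>Absolute continuity is stated for indexed families, so the intervals tagged
        in \<open>N\<close> are enumerated. Being disjoint inside and contained in \<open>U\<close>,
        they have total length below \<open>d\<close>.\<close>
      obtain h where h: "bij_betw h {..<card Bad} Bad"
        using ex_bij_betw_nat_finite[OF split(3)] by (auto simp: atLeast0LessThan)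
      define u where "u = (\<lambda>i. Inf (snd (h i)))"
      define v where "v = (\<lambda>i. Sup (snd (h i)))"
      have hB: "h i \<in> Bad" if "i < card Bad" for i using h that by (auto simp: bij_betw_def)
      have uv: "snd (h i) = {u i..v i} \<and> a \<le> u i \<and> u i \<le> v i \<and> v i \<le> b \<and> {u i..v i} \<subseteq> U" if "i < card Bad" for i
      proof -
        obtain x K where xK: "h i = (x, K)" "(x, K) \<in> p" "x \<in> N"
          using hB[OF \<open>i < card Bad\<close>] by (auto simp: Bad_def)
        from box[OF xK(2)] obtain s t where K: "K = {s..t}" "s \<le> x" "x \<le> t" "a \<le> s" "t \<le> b" "K \<subseteq> g x" by blast
        then show ?thesis using xK(1,3) by (auto simp: u_def v_def g_def)
      qed
      have disj: "{u i<..<v i} \<inter> {u j<..<v j} = {}" if ij: "i < card Bad" "j < card Bad" "i \<noteq> j" for i j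
      proof -
        have ne: "h i \<noteq> h j" using h ij by (auto simp: bij_betw_def inj_on_def)
        have "h i \<in> p" "h j \<in> p" using hB ij split by auto
        then have "interior (snd (h i)) \<inter> interior (snd (h j)) = {}"
          using tagged_division_ofD(5)[OF p(1), of "fst (h i)" "snd (h i)" "fst (h j)" "snd (h j)"] ne by simp
        then show ?thesis using uv ij by simp
      qed
      have "(\<Sum>i<card Bad. v i - u i) = (\<Sum>i<card Bad. measure lebesgue {u i<..<v i})"
        using uv by (intro sum.cong) auto
      also have "\<dots> = measure lebesgue (\<Union>i<card Bad. {u i<..<v i})"
        using disj by (intro measure_UNION'[symmetric]) (auto simp: pairwise_def disjnt_def)
      also have "\<dots> \<le> measure lebesgue U"
        by (rule measure_mono_fmeasurable[OF _ _ Um]) (use uv in \<open>force simp: subset_eq\<close>, simp)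
      finally have "(\<Sum>i<card Bad. v i - u i) < d" using Ud by simp
      then have lt: "(\<Sum>i<card Bad. dist (f (u i)) (f (v i))) < e"
        using uv disj by (intro D) auto
      have "sum ?D Bad = (\<Sum>i<card Bad. f (v i) - f (u i))"
        using sum.reindex_bij_betw[OF h, of ?D] by (simp add: u_def v_def case_prod_unfold)
      also have "norm \<dots> \<le> (\<Sum>i<card Bad. dist (f (u i)) (f (v i)))"
        by (rule sum_norm_le) (simp add: dist_norm norm_minus_commute)
      finally show ?thesis using lt by simp
    qed
    show ?thesis unfolding sumf using good bad norm_triangle_ineq[of "sum ?D Bad" "sum ?D Good"] by simp
  qed
  then have le: "norm (f b - f a) \<le> e * (b - a + 1)" if "e > 0" for e
    using that by (simp add: distrib_left)
  have "norm (f b - f a) \<le> 0"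
  proof (rule field_le_epsilon)
    fix e :: real assume "e > 0"
    then show "norm (f b - f a) \<le> 0 + e" using le[of "e / (b - a + 1)"] ab by simp
  qed
  then show ?thesis by simp
qed

section \<open>Closure properties of absolute continuity\<close>

lemma abs_continuous_subinterval:
  assumes f: "abs_continuous_on_interval a b f" and "a \<le> c" "d \<le> b"
  shows "abs_continuous_on_interval c d f"
  unfolding abs_continuous_on_interval_def
proof (intro allI impI)
  fix e :: real assume "e > 0"
  from abs_continuousE[OF f this] obtain r where "r > 0" and r: "\<And>n (u :: nat \<Rightarrow> real) v.
        (\<And>i. i < n \<Longrightarrow> a \<le> u i \<and> u i \<le> v i \<and> v i \<le> b) \<Longrightarrow>
        (\<And>i j. i < n \<Longrightarrow> j < n \<Longrightarrow> i \<noteq> j \<Longrightarrow> {u i<..<v i} \<inter> {u j<..<v j} = {}) \<Longrightarrow>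
        (\<Sum>i<n. v i - u i) < r \<Longrightarrow> (\<Sum>i<n. dist (f (u i)) (f (v i))) < e" by blast
  show "\<exists>r>0. \<forall>n (u :: nat \<Rightarrow> real) v.
        (\<forall>i<n. c \<le> u i \<and> u i \<le> v i \<and> v i \<le> d) \<and>
        (\<forall>i<n. \<forall>j<n. i \<noteq> j \<longrightarrow> {u i<..<v i} \<inter> {u j<..<v j} = {}) \<and>
        (\<Sum>i<n. v i - u i) < r
        \<longrightarrow> (\<Sum>i<n. dist (f (u i)) (f (v i))) < e"
  proof (intro exI[of _ r] conjI allI impI; (elim conjE)?)
    show "r > 0" by fact
    fix n and u v :: "nat \<Rightarrow> real"
    assume 1: "\<forall>i<n. c \<le> u i \<and> u i \<le> v i \<and> v i \<le> d"
      and 2: "\<forall>i<n. \<forall>j<n. i \<noteq> j \<longrightarrow> {u i<..<v i} \<inter> {u j<..<v j} = {}"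
      and 3: "(\<Sum>i<n. v i - u i) < r"
    show "(\<Sum>i<n. dist (f (u i)) (f (v i))) < e"
    proof (rule r[OF _ _ 3])
      show "a \<le> u i \<and> u i \<le> v i \<and> v i \<le> b" if "i < n" for i
        using 1 that assms(2,3) by (meson order_trans)
    qed (use 2 in blast)
  qed
qed

lemma abs_continuous_imp_continuous:
  assumes f: "abs_continuous_on_interval a b f"
  shows "continuous_on {a..b} f"
  unfolding continuous_on_iff
proof (intro ballI allI impI)
  fix s and e :: real assume s: "s \<in> {a..b}" and e: "e > 0"
  from abs_continuousE[OF f e] obtain r where "r > 0" and r: "\<And>n (u :: nat \<Rightarrow> real) v.
        (\<And>i. i < n \<Longrightarrow> a \<le> u i \<and> u i \<le> v i \<and> v i \<le> b) \<Longrightarrow>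
        (\<And>i j. i < n \<Longrightarrow> j < n \<Longrightarrow> i \<noteq> j \<Longrightarrow> {u i<..<v i} \<inter> {u j<..<v j} = {}) \<Longrightarrow>
        (\<Sum>i<n. v i - u i) < r \<Longrightarrow> (\<Sum>i<n. dist (f (u i)) (f (v i))) < e" by blast
  show "\<exists>d>0. \<forall>t\<in>{a..b}. dist t s < d \<longrightarrow> dist (f t) (f s) < e"
  proof (intro exI[of _ r] conjI ballI impI)
    show "r > 0" by fact
    fix t assume t: "t \<in> {a..b}" "dist t s < r"
    have "(\<Sum>i<1::nat. dist (f (min s t)) (f (max s t))) < e"
      by (rule r) (use s t in \<open>auto simp: dist_real_def min_def max_def\<close>)
    then show "dist (f t) (f s) < e" by (auto simp: min_def max_def dist_commute split: if_splits)
  qed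
qed

lemma abs_continuous_Pair:
  assumes f: "abs_continuous_on_interval a b f" and g: "abs_continuous_on_interval a b g"
  shows "abs_continuous_on_interval a b (\<lambda>t. (f t, g t))"
  unfolding abs_continuous_on_interval_def
proof (intro allI impI)
  fix e :: real assume "e > 0"
  then have e: "e / 2 > 0" by simp
  from abs_continuousE[OF f e] obtain r where "r > 0" and r: "\<And>n (u :: nat \<Rightarrow> real) v.
        (\<And>i. i < n \<Longrightarrow> a \<le> u i \<and> u i \<le> v i \<and> v i \<le> b) \<Longrightarrow>
        (\<And>i j. i < n \<Longrightarrow> j < n \<Longrightarrow> i \<noteq> j \<Longrightarrow> {u i<..<v i} \<inter> {u j<..<v j} = {}) \<Longrightarrow>
        (\<Sum>i<n. v i - u i) < r \<Longrightarrow> (\<Sum>i<n. dist (f (u i)) (f (v i))) < e / 2" by blast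
  from abs_continuousE[OF g e] obtain q where "q > 0" and q: "\<And>n (u :: nat \<Rightarrow> real) v.
        (\<And>i. i < n \<Longrightarrow> a \<le> u i \<and> u i \<le> v i \<and> v i \<le> b) \<Longrightarrow>
        (\<And>i j. i < n \<Longrightarrow> j < n \<Longrightarrow> i \<noteq> j \<Longrightarrow> {u i<..<v i} \<inter> {u j<..<v j} = {}) \<Longrightarrow>
        (\<Sum>i<n. v i - u i) < q \<Longrightarrow> (\<Sum>i<n. dist (g (u i)) (g (v i))) < e / 2" by blast
  show "\<exists>d>0. \<forall>n (u :: nat \<Rightarrow> real) v.
        (\<forall>i<n. a \<le> u i \<and> u i \<le> v i \<and> v i \<le> b) \<and>
        (\<forall>i<n. \<forall>j<n. i \<noteq> j \<longrightarrow> {u i<..<v i} \<inter> {u j<..<v j} = {}) \<and>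
        (\<Sum>i<n. v i - u i) < d
        \<longrightarrow> (\<Sum>i<n. dist (f (u i), g (u i)) (f (v i), g (v i))) < e"
  proof (intro exI[of _ "min r q"] conjI allI impI; (elim conjE)?)
    show "min r q > 0" using \<open>r > 0\<close> \<open>q > 0\<close> by simp
    fix n and u v :: "nat \<Rightarrow> real"
    assume 1: "\<forall>i<n. a \<le> u i \<and> u i \<le> v i \<and> v i \<le> b"
      and 2: "\<forall>i<n. \<forall>j<n. i \<noteq> j \<longrightarrow> {u i<..<v i} \<inter> {u j<..<v j} = {}"
      and 3: "(\<Sum>i<n. v i - u i) < min r q"
    have "dist (x1, x2) (y1, y2) \<le> dist x1 y1 + dist x2 y2"
      for x1 y1 :: 'a and x2 y2 :: 'b by (simp add: dist_Pair_Pair sqrt_sum_squares_le_sum)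
    then have "(\<Sum>i<n. dist (f (u i), g (u i)) (f (v i), g (v i)))
      \<le> (\<Sum>i<n. dist (f (u i)) (f (v i))) + (\<Sum>i<n. dist (g (u i)) (g (v i)))"
      by (subst sum.distrib[symmetric]) (rule sum_mono)
    also have "\<dots> < e / 2 + e / 2"
      by (intro add_strict_mono r q) (use 1 2 3 in auto)
    finally show "(\<Sum>i<n. dist (f (u i), g (u i)) (f (v i), g (v i))) < e" by simp
  qed
qed

lemma abs_continuous_lipschitz:
  fixes f :: "real \<Rightarrow> 'a::metric_space"
  assumes K: "\<And>s t. s \<in> {a..b} \<Longrightarrow> t \<in> {a..b} \<Longrightarrow> s \<le> t \<Longrightarrow> dist (f s) (f t) \<le> K * (t - s)"
  shows "abs_continuous_on_interval a b f"
proof (rule abs_continuous_dominated[where f = "\<lambda>_. 0 :: real" and K = "\<bar>K\<bar> + 1"])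
  show "abs_continuous_on_interval a b (\<lambda>_. 0 :: real)"
    by (auto simp: abs_continuous_on_interval_def intro!: exI[of _ 1])
  show "dist (f s) (f t) \<le> (\<bar>K\<bar> + 1) * (dist 0 (0 :: real) + (t - s))"
    if "s \<in> {a..b}" "t \<in> {a..b}" "s \<le> t" for s t
  proof -
    have "K * (t - s) \<le> (\<bar>K\<bar> + 1) * (t - s)" using that by (intro mult_right_mono) auto
    then show ?thesis using K[OF that] by simp
  qed
qed simp

lemma abs_continuous_C1:
  fixes g :: "real \<Rightarrow> 'a::real_normed_vector"
  assumes der: "\<And>t. (g has_vector_derivative g' t) (at t)" and cont: "continuous_on UNIV g'"
  shows "abs_continuous_on_interval a b g"
proof -
  have "bounded (g' ` {a..b})"
    by (intro compact_imp_bounded compact_continuous_image continuous_on_subset[OF cont]) auto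
  then obtain B where B: "\<And>t. t \<in> {a..b} \<Longrightarrow> norm (g' t) \<le> B" by (fastforce simp: bounded_iff)
  show ?thesis
  proof (rule abs_continuous_lipschitz)
    fix s t assume st: "s \<in> {a..b}" "t \<in> {a..b}" "s \<le> t"
    have "norm (g t - g s) \<le> B * norm (t - s)"
    proof (rule differentiable_bound[where S = "{a..b}" and f' = "\<lambda>x h. h *\<^sub>R g' x"])
      show "(g has_derivative (\<lambda>h. h *\<^sub>R g' x)) (at x within {a..b})" if "x \<in> {a..b}" for x
        using der[of x] by (simp add: has_vector_derivative_def has_derivative_at_withinI)
      show "onorm (\<lambda>h. h *\<^sub>R g' x) \<le> B" if "x \<in> {a..b}" for x
        using B[OF that] by (intro onorm_le) (simp add: mult.commute[of B] mult_left_mono)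
    qed (use st in auto)
    then show "dist (g s) (g t) \<le> B * (t - s)" using st by (simp add: dist_norm norm_minus_commute)
  qed
qed

text \<open>Splitting the increment as in the product rule bounds it by the increment of the pair
  \<open>(f, g)\<close>, both factors being bounded on the compact interval. It applies to the
  product of a solution with the inverse flow.\<close>

lemma abs_continuous_bilinear:
  fixes f :: "real \<Rightarrow> 'a::real_normed_vector" and g :: "real \<Rightarrow> 'b::real_normed_vector"
    and h :: "'a \<Rightarrow> 'b \<Rightarrow> 'c::real_normed_vector"
  assumes h: "bounded_bilinear h"
    and f: "abs_continuous_on_interval a b f" and g: "abs_continuous_on_interval a b g"
  shows "abs_continuous_on_interval a b (\<lambda>t. h (f t) (g t))"
proof -
  have "\<exists>B>0. \<forall>t\<in>{a..b}. norm (k t) \<le> B" if "abs_continuous_on_interval a b k"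
    for k :: "real \<Rightarrow> 'd::real_normed_vector"
  proof -
    have "bounded (k ` {a..b})"
      by (intro compact_imp_bounded compact_continuous_image abs_continuous_imp_continuous that) auto
    then show ?thesis by (auto simp: bounded_pos)
  qed
  from this[OF f] this[OF g] obtain Bf Bg where B: "Bf > 0" "Bg > 0"
    "\<And>t. t \<in> {a..b} \<Longrightarrow> norm (f t) \<le> Bf" "\<And>t. t \<in> {a..b} \<Longrightarrow> norm (g t) \<le> Bg" by blast
  from bounded_bilinear.pos_bounded[OF h] obtain K
    where K0: "0 < K \<and> (\<forall>x y. norm (h x y) \<le> norm x * norm y * K)" by (rule exE)
  have K: "K > 0" "norm (h x y) \<le> norm x * norm y * K" for x y
    using conjunct1[OF K0] conjunct2[OF K0, rule_format] by this
  show ?thesis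
  proof (rule abs_continuous_dominated[OF abs_continuous_Pair[OF f g], where K = "K * (Bf + Bg)"])
    show "0 < K * (Bf + Bg)" using K B by simp
    fix s t assume st: "s \<in> {a..b}" "t \<in> {a..b}" "s \<le> t"
    have "h (f s) (g s) - h (f t) (g t) = h (f s - f t) (g s) + h (f t) (g s - g t)"
      by (simp add: bounded_bilinear.diff_left[OF h] bounded_bilinear.diff_right[OF h])
    then have "dist (h (f s) (g s)) (h (f t) (g t)) \<le> norm (f s - f t) * norm (g s) * K + norm (f t) * norm (g s - g t) * K"
      unfolding dist_norm by (simp only:) (rule order_trans[OF norm_triangle_ineq add_mono[OF K(2) K(2)]])
    also have "\<dots> \<le> dist (f s, g s) (f t, g t) * Bg * K + Bf * dist (f s, g s) (f t, g t) * K"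
      using B(3,4) st K(1) dist_fst_le[of "(f s, g s)" "(f t, g t)"] dist_snd_le[of "(f s, g s)" "(f t, g t)"] B(1)
      by (intro add_mono mult_right_mono mult_mono) (auto simp: dist_norm)
    also have "\<dots> = K * (Bf + Bg) * dist (f s, g s) (f t, g t)" by (simp add: algebra_simps)
    also have "\<dots> \<le> K * (Bf + Bg) * (dist (f s, g s) (f t, g t) + (t - s))"
      using K(1) B(1,2) st by (intro mult_left_mono) auto
    finally show "dist (h (f s) (g s)) (h (f t) (g t)) \<le> K * (Bf + Bg) * (dist (f s, g s) (f t, g t) + (t - s))" .
  qed
qed

section \<open>Rotations and quaternions\<close>

lemma skew_nth [simp]:
  "skew x $ 1 $ 1 = 0" "skew x $ 1 $ 2 = - x$3" "skew x $ 1 $ 3 = x$2"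
  "skew x $ 2 $ 1 = x$3" "skew x $ 2 $ 2 = 0" "skew x $ 2 $ 3 = - x$1"
  "skew x $ 3 $ 1 = - x$2" "skew x $ 3 $ 2 = x$1" "skew x $ 3 $ 3 = 0"
  by (simp_all add: skew_def matrix_def cross3_def axis_def)

lemma psi_nth:
  "psi B $ 1 = (B$3$2 - B$2$3) / 2" "psi B $ 2 = (B$1$3 - B$3$1) / 2" "psi B $ 3 = (B$2$1 - B$1$2) / 2"
  by (simp_all add: psi_def)

lemma matrix_mult_nth3:
  fixes A :: "real^3^'n" and B :: "real^'m^3"
  shows "(A ** B) $ i $ j = A$i$1 * B$1$j + A$i$2 * B$2$j + A$i$3 * B$3$j"
  by (simp add: matrix_matrix_mult_def sum_3)

lemma rotation_matrix_eqs:
  fixes R :: "real^3^3"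
  assumes "rotation_matrix R"
  shows "R$1$i * R$1$j + R$2$i * R$2$j + R$3$i * R$3$j = (if i = j then 1 else 0)"
    "R$i$1 * R$j$1 + R$i$2 * R$j$2 + R$i$3 * R$j$3 = (if i = j then 1 else 0)"
proof -
  have "transpose R ** R = mat 1" "R ** transpose R = mat 1"
    using assms by (simp_all add: rotation_matrix_def orthogonal_matrix_def)
  then have "(transpose R ** R) $ i $ j = (if i = j then 1 else 0)"
    "(R ** transpose R) $ i $ j = (if i = j then 1 else 0)"
    by (simp_all add: mat_def)
  then show "R$1$i * R$1$j + R$2$i * R$2$j + R$3$i * R$3$j = (if i = j then 1 else 0)"
    "R$i$1 * R$j$1 + R$i$2 * R$j$2 + R$i$3 * R$j$3 = (if i = j then 1 else 0)"
    by (simp_all add: matrix_mult_nth3 transpose_def)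
qed

text \<open>A rotation commutes with cross products; applied to pairs of basis vectors this says
  that \<open>R\<close> is its own cofactor matrix. Here the determinant 1 enters: an orthogonal
  matrix of determinant -1 would give the opposite sign.\<close>

lemma rotation_matrix_cofactors:
  fixes R :: "real^3^3"
  assumes "rotation_matrix R"
  shows "R$1$1 = R$2$2 * R$3$3 - R$2$3 * R$3$2" "R$1$2 = R$2$3 * R$3$1 - R$2$1 * R$3$3"
    "R$1$3 = R$2$1 * R$3$2 - R$2$2 * R$3$1" "R$2$1 = R$3$2 * R$1$3 - R$3$3 * R$1$2"
    "R$2$2 = R$3$3 * R$1$1 - R$3$1 * R$1$3" "R$2$3 = R$3$1 * R$1$2 - R$3$2 * R$1$1"
    "R$3$1 = R$1$2 * R$2$3 - R$1$3 * R$2$2" "R$3$2 = R$1$3 * R$2$1 - R$1$1 * R$2$3"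
    "R$3$3 = R$1$1 * R$2$2 - R$1$2 * R$2$1"
proof -
  let ?e = "\<lambda>i::3. axis i (1::real) :: real^3"
  have c: "cross3 (R *v ?e i) (R *v ?e j) = R *v cross3 (?e i) (?e j)" for i j
    by (rule cross_rotation_matrix[OF assms])
  have x: "cross3 (?e 2) (?e 3) = ?e 1" "cross3 (?e 3) (?e 1) = ?e 2" "cross3 (?e 1) (?e 2) = ?e 3"
    by (simp_all add: vec_eq_iff forall_3 cross3_def axis_def)
  have a: "(R *v ?e i) $ j = R $ j $ i" for i j
    by (simp add: matrix_vector_mult_basis column_def)
  show "R$1$1 = R$2$2 * R$3$3 - R$2$3 * R$3$2" "R$1$2 = R$2$3 * R$3$1 - R$2$1 * R$3$3"
    "R$1$3 = R$2$1 * R$3$2 - R$2$2 * R$3$1" "R$2$1 = R$3$2 * R$1$3 - R$3$3 * R$1$2"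
    "R$2$2 = R$3$3 * R$1$1 - R$3$1 * R$1$3" "R$2$3 = R$3$1 * R$1$2 - R$3$2 * R$1$1"
    "R$3$1 = R$1$2 * R$2$3 - R$1$3 * R$2$2" "R$3$2 = R$1$3 * R$2$1 - R$1$1 * R$2$3"
    "R$3$3 = R$1$1 * R$2$2 - R$1$2 * R$2$1"
    using c[of 2 3] c[of 3 1] c[of 1 2] unfolding x vec_eq_iff forall_3
    by (simp_all add: cross3_simps(1) cross3_def a algebra_simps)
qed

text \<open>The Euler-Rodrigues formula for the quaternion with scalar part \<open>s\<close> and
  vector part \<open>q\<close>. No normalisation is built in; the matrix is a rotation when the
  quaternion has norm 1.\<close>

definition quat_rot :: "real \<Rightarrow> real^3 \<Rightarrow> real^3^3" where
  "quat_rot s q = mat 1 + (2 * s) *\<^sub>R skew q + 2 *\<^sub>R (skew q ** skew q)"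

text \<open>The entries \<open>Q\<close> below are four times the products of quaternion coordinates.  Orthogonality and
  the cofactor identities say that this symmetric matrix has rank one; its trace is 4, so one of
  its rows, suitably scaled, is the quaternion.\<close>

lemma rotation_matrix_quaternion:
  fixes R :: "real^3^3"
  assumes "rotation_matrix R"
  obtains s q where "s\<^sup>2 + (norm q)\<^sup>2 = 1" "R = quat_rot s q"
proof -
  note goal = that
  define a b c d e f g h i where A: "a = R$1$1" "b = R$1$2" "c = R$1$3" "d = R$2$1" "e = R$2$2" "f = R$2$3"
    "g = R$3$1" "h = R$3$2" "i = R$3$3"
  note eqs = rotation_matrix_eqs(1)[OF assms, of 1 1] rotation_matrix_eqs(1)[OF assms, of 2 2]
    rotation_matrix_eqs(1)[OF assms, of 3 3] rotation_matrix_eqs(1)[OF assms, of 1 2]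
    rotation_matrix_eqs(1)[OF assms, of 1 3] rotation_matrix_eqs(1)[OF assms, of 2 3]
    rotation_matrix_eqs(2)[OF assms, of 1 1] rotation_matrix_eqs(2)[OF assms, of 2 2]
    rotation_matrix_eqs(2)[OF assms, of 3 3] rotation_matrix_eqs(2)[OF assms, of 1 2]
    rotation_matrix_eqs(2)[OF assms, of 1 3] rotation_matrix_eqs(2)[OF assms, of 2 3]
    rotation_matrix_cofactors[OF assms]
  note E = eqs[folded A, simplified, simplified algebra_simps]
  define Q00 Q01 Q02 Q03 Q11 Q22 Q33 Q12 Q13 Q23 where
    Q: "Q00 = 1 + a + e + i" "Q01 = h - f" "Q02 = c - g" "Q03 = d - b"
    "Q11 = 1 + a - e - i" "Q22 = 1 - a + e - i" "Q33 = 1 - a - e + i"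
    "Q12 = b + d" "Q13 = c + g" "Q23 = f + h"
  have m: "Q00 * Q11 = Q01 * Q01" "Q00 * Q12 = Q01 * Q02" "Q00 * Q13 = Q01 * Q03"
    "Q00 * Q22 = Q02 * Q02" "Q00 * Q23 = Q02 * Q03" "Q00 * Q33 = Q03 * Q03"
    "Q11 * Q02 = Q12 * Q01" "Q11 * Q03 = Q13 * Q01" "Q11 * Q22 = Q12 * Q12" "Q11 * Q23 = Q12 * Q13"
    "Q11 * Q33 = Q13 * Q13" "Q22 * Q01 = Q12 * Q02" "Q22 * Q03 = Q23 * Q02" "Q22 * Q13 = Q12 * Q23"
    "Q22 * Q33 = Q23 * Q23" "Q33 * Q01 = Q13 * Q03" "Q33 * Q02 = Q23 * Q03" "Q33 * Q12 = Q13 * Q23"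
    unfolding Q by (simp_all (no_asm) only: algebra_simps) (insert E, linarith+)
  have tr: "Q00 + Q11 + Q22 + Q33 = 4" by (simp add: Q)
  have key: thesis if ss: "4 * s * s = Q00" "4 * s * x = Q01" "4 * s * y = Q02" "4 * s * z = Q03"
    "4 * x * x = Q11" "4 * y * y = Q22" "4 * z * z = Q33" "4 * x * y = Q12" "4 * x * z = Q13" "4 * y * z = Q23"
    for s x y z
  proof (rule goal[of s "vector [x, y, z]"])
    show "s\<^sup>2 + (norm (vector [x, y, z] :: real^3))\<^sup>2 = 1"
      using ss tr unfolding power2_norm_eq_inner by (simp add: inner_vec_def sum_3 power2_eq_square)
    show "R = quat_rot s (vector [x, y, z])"
      unfolding vec_eq_iff forall_3 quat_rot_def
      using ss by (simp add: mat_def matrix_mult_nth3 A[symmetric] Q algebra_simps)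
  qed
  have sq: "\<exists>r. 4 * r * r = Q" if "Q > 0" for Q :: real
    using that by (intro exI[of _ "sqrt Q / 2"]) simp
  have div: "4 * r * (u / (4 * r)) = u" "4 * (u / (4 * r)) * r = u" if "4 * r * r = P" "P > 0" for r u P :: real
    using that by auto
  \<comment> \<open>This treats the entries outside the pivot row: with pivot
    \<open>P = 4 * r * r\<close> the product equals \<open>u * w / P\<close>, which is the entry
    \<open>t\<close> by the rank-one relations \<open>m\<close>.\<close>
  have pr: "4 * (u / (4 * r)) * (w / (4 * r)) = t" if "4 * r * r = P" "P > 0" "P * t = u * w" for r u w t P :: real
  proof -
    have "4 * (u / (4 * r)) * (w / (4 * r)) = (u * w) / (4 * r * r)" using that by (simp add: field_simps)
    then show ?thesis using that by (metis nonzero_mult_div_cancel_left less_irrefl)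
  qed
  consider "Q00 > 0" | "Q11 > 0" | "Q22 > 0" | "Q33 > 0" using tr by linarith
  then show thesis
  proof cases
    case 1
    then obtain r where r: "4 * r * r = Q00" using sq by blast
    show ?thesis
      by (rule key[of r "Q01 / (4 * r)" "Q02 / (4 * r)" "Q03 / (4 * r)"])
        (rule r div[OF r 1] | (rule pr[OF r 1], insert m, simp add: mult.commute))+
  next
    case 2
    then obtain r where r: "4 * r * r = Q11" using sq by blast
    show ?thesis
      by (rule key[of "Q01 / (4 * r)" r "Q12 / (4 * r)" "Q13 / (4 * r)"])
        (rule r div[OF r 2] | (rule pr[OF r 2], insert m, simp add: mult.commute))+
  next
    case 3
    then obtain r where r: "4 * r * r = Q22" using sq by blast
    show ?thesis
      by (rule key[of "Q02 / (4 * r)" "Q12 / (4 * r)" r "Q23 / (4 * r)"])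
        (rule r div[OF r 3] | (rule pr[OF r 3], insert m, simp add: mult.commute))+
  next
    case 4
    then obtain r where r: "4 * r * r = Q33" using sq by blast
    show ?thesis
      by (rule key[of "Q03 / (4 * r)" "Q13 / (4 * r)" "Q23 / (4 * r)" r])
        (rule r div[OF r 4] | (rule pr[OF r 4], insert m, simp add: mult.commute))+
  qed
qed

lemma quat_rot_nth:
  "quat_rot s q $ 1 $ 1 = 1 - 2 * (q$2 * q$2 + q$3 * q$3)"
  "quat_rot s q $ 2 $ 2 = 1 - 2 * (q$1 * q$1 + q$3 * q$3)"
  "quat_rot s q $ 3 $ 3 = 1 - 2 * (q$1 * q$1 + q$2 * q$2)"
  "quat_rot s q $ 1 $ 2 = 2 * (q$1 * q$2 - s * q$3)" "quat_rot s q $ 2 $ 1 = 2 * (q$1 * q$2 + s * q$3)"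
  "quat_rot s q $ 1 $ 3 = 2 * (q$1 * q$3 + s * q$2)" "quat_rot s q $ 3 $ 1 = 2 * (q$1 * q$3 - s * q$2)"
  "quat_rot s q $ 2 $ 3 = 2 * (q$2 * q$3 - s * q$1)" "quat_rot s q $ 3 $ 2 = 2 * (q$2 * q$3 + s * q$1)"
  by (simp_all add: quat_rot_def mat_def matrix_mult_nth3 algebra_simps)

lemma norm_vec3_sq: "(norm (q :: real^3))\<^sup>2 = q$1 * q$1 + q$2 * q$2 + q$3 * q$3"
  unfolding power2_norm_eq_inner by (simp add: inner_vec_def sum_3)

lemma norm_mat3_sq:
  "(norm (B :: real^3^3))\<^sup>2 = B$1$1 * B$1$1 + B$1$2 * B$1$2 + B$1$3 * B$1$3 + B$2$1 * B$2$1 + B$2$2 * B$2$2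
     + B$2$3 * B$2$3 + B$3$1 * B$3$1 + B$3$2 * B$3$2 + B$3$3 * B$3$3"
  unfolding power2_norm_eq_inner by (simp add: inner_vec_def sum_3)

lemma rotation_matrix_quat_rot:
  assumes "s\<^sup>2 + (norm q)\<^sup>2 = 1"
  shows "rotation_matrix (quat_rot s q)"
proof -
  have n: "s * s + q$1 * q$1 + q$2 * q$2 + q$3 * q$3 = 1"
    using assms by (simp add: norm_vec3_sq power2_eq_square[of s])
  have "transpose (quat_rot s q) ** quat_rot s q = mat 1"
    unfolding vec_eq_iff forall_3 matrix_mult_nth3
    using n by (simp add: transpose_def mat_def quat_rot_nth, intro conjI; algebra)
  moreover have "det (quat_rot s q) = 1"
    unfolding det_3 quat_rot_nth using n by algebra
  ultimately show ?thesis by (simp add: rotation_matrix_def orthogonal_matrix)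
qed

text \<open>For a unit quaternion \<open>norm q\<close> is the absolute sine of half the rotation
  angle, so distance 1 means \<open>s = 0\<close>, a half turn.\<close>

lemma rot_dist_quat_rot: "(rot_dist (quat_rot s q))\<^sup>2 = (norm q)\<^sup>2"
proof -
  have "trace (mat 1 - quat_rot s q) / 4 = (norm q)\<^sup>2"
    by (simp add: trace_def sum_3 mat_def quat_rot_nth norm_vec3_sq)
  then show ?thesis by (simp add: rot_dist_def)
qed

text \<open>The distance is defined by a trace and has no evident triangle inequality; this identity
  transfers it to the Euclidean norm of matrices, which rotations preserve.\<close>

lemma norm_rotation_deviation:
  assumes "rotation_matrix R"
  shows "(norm (mat 1 - R))\<^sup>2 = 8 * (rot_dist R)\<^sup>2"
proof -
  obtain s q where sq: "s\<^sup>2 + (norm q)\<^sup>2 = 1" "R = quat_rot s q"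
    using rotation_matrix_quaternion[OF assms] .
  have n: "s * s + q$1 * q$1 + q$2 * q$2 + q$3 * q$3 = 1"
    using sq by (simp add: norm_vec3_sq power2_eq_square[of s])
  show ?thesis unfolding sq(2) rot_dist_quat_rot norm_mat3_sq norm_vec3_sq
    using n by (simp add: mat_def quat_rot_nth) algebra
qed

lemma norm_rotation_mult:
  fixes B :: "real^3^3"
  assumes "rotation_matrix R"
  shows "norm (R ** B) = norm B"
proof -
  have "(norm (R ** B))\<^sup>2 = (norm B)\<^sup>2"
  proof -
    have c: "(norm C)\<^sup>2 = (\<Sum>j\<in>UNIV. (norm (column j C))\<^sup>2)" for C :: "real^3^3"
      unfolding norm_mat3_sq by (simp add: sum_3 norm_vec3_sq column_def)
    have "column j (R ** B) = R *v column j B" for j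
      by (simp add: vec_eq_iff column_def matrix_matrix_mult_def matrix_vector_mult_def)
    moreover have "norm (R *v x) = norm x" for x
      using assms orthogonal_transformation_matrix[of "(*v) R"]
      by (simp add: rotation_matrix_def orthogonal_transformation)
    ultimately show ?thesis unfolding c by simp
  qed
  then show ?thesis by simp
qed

text \<open>The exponential of \<open>s\<close> times \<open>skew w\<close>: rotation by the angle
  \<open>s * norm w\<close> about the axis \<open>sgn w\<close>. Since \<open>sgn 0 = 0\<close>, the
  value for \<open>w = 0\<close> is the identity without a case distinction.\<close>

definition rodrigues :: "real \<Rightarrow> real^3 \<Rightarrow> real^3^3" where
  "rodrigues s w = mat 1 + sin (s * norm w) *\<^sub>R skew (sgn w)
     + (1 - cos (s * norm w)) *\<^sub>R (skew (sgn w) ** skew (sgn w))"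

lemma rodrigues_zero [simp]: "rodrigues 0 w = mat 1"
  by (simp add: rodrigues_def)

lemma skew_scaleR: "skew (c *\<^sub>R x) = c *\<^sub>R skew x"
  by (simp add: vec_eq_iff forall_3)

lemma scaleR_matrix_mult: "(c *\<^sub>R A) ** B = c *\<^sub>R (A ** B)" "A ** (c *\<^sub>R B) = c *\<^sub>R (A ** B)"
  for A :: "real^'n^'m" and B :: "real^'k^'n"
  by (simp_all add: vec_eq_iff matrix_matrix_mult_def sum_distrib_left mult_ac)

lemma matrix_mult_uminus: "(- A) ** B = - (A ** B)" "A ** (- B) = - (A ** B)" for A :: "real^'n^'m" and B :: "real^'k^'n"
  by (simp_all add: vec_eq_iff matrix_matrix_mult_def sum_negf)

text \<open>Half-angle formulas. In this form the rotation property and the distance to the identity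
  follow from the quaternion identities.\<close>

lemma rodrigues_eq_quat_rot:
  "rodrigues s w = quat_rot (cos (s * norm w / 2)) (sin (s * norm w / 2) *\<^sub>R sgn w)"
proof -
  have "sin (s * norm w) = 2 * sin (s * norm w / 2) * cos (s * norm w / 2)"
    using sin_double[of "s * norm w / 2"] by simp
  moreover have "1 - cos (s * norm w) = 2 * (sin (s * norm w / 2))\<^sup>2"
    using cos_double_sin[of "s * norm w / 2"] by simp
  ultimately show ?thesis
    by (simp add: rodrigues_def quat_rot_def skew_scaleR scaleR_matrix_mult power2_eq_square mult_ac)
qed

lemma rotation_matrix_rodrigues: "rotation_matrix (rodrigues s w)"
proof (cases "w = 0")
  case True
  then show ?thesis by (simp add: rodrigues_def rotation_matrix_def orthogonal_matrix)
next
  case False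
  then show ?thesis unfolding rodrigues_eq_quat_rot
    by (intro rotation_matrix_quat_rot) (simp add: norm_sgn)
qed

text \<open>The Cayley-Hamilton relation of a skew matrix. Because of it the span of
  \<open>skew q\<close> and its square is closed under multiplication by \<open>skew q\<close>,
  which gives the exponential its closed form.\<close>

lemma skew_cubed: "skew q ** (skew q ** skew q) = - (norm q)\<^sup>2 *\<^sub>R skew q"
  unfolding vec_eq_iff forall_3 matrix_mult_nth3 norm_vec3_sq by (simp add: algebra_simps)

lemma skew_sgn_cubed: "skew (sgn w) ** (skew (sgn w) ** skew (sgn w)) = - skew (sgn w)"
proof -
  have "skew 0 = 0" by (simp add: vec_eq_iff forall_3)
  then show ?thesis by (cases "w = 0") (simp_all add: skew_cubed norm_sgn)
qed

lemma has_vector_derivative_rodrigues: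
  "((\<lambda>s. rodrigues s w) has_vector_derivative skew w ** rodrigues s w) (at s within S)"
    and rodrigues_commute: "skew w ** rodrigues s w = rodrigues s w ** skew w"
proof -
  let ?u = "skew (sgn w)" and ?n = "norm w"
  have w: "skew w = ?n *\<^sub>R ?u" 
  proof -
    have "?n *\<^sub>R sgn w = w" by (cases "w = 0") (simp_all add: sgn_div_norm)
    then show ?thesis by (metis skew_scaleR)
  qed
  have eq: "skew w ** rodrigues s w = (?n * cos (s * ?n)) *\<^sub>R ?u + (?n * sin (s * ?n)) *\<^sub>R (?u ** ?u)"
    unfolding w rodrigues_def matrix_add_ldistrib scaleR_matrix_mult skew_sgn_cubed matrix_mul_rid
    by (simp add: algebra_simps)
  have "((\<lambda>s. sin (s * ?n)) has_vector_derivative cos (s * ?n) * ?n) (at s within S)"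
    "((\<lambda>s. 1 - cos (s * ?n)) has_vector_derivative sin (s * ?n) * ?n) (at s within S)"
    unfolding has_real_derivative_iff_has_vector_derivative[symmetric]
    by (auto intro!: derivative_eq_intros)
  then show "((\<lambda>s. rodrigues s w) has_vector_derivative skew w ** rodrigues s w) (at s within S)"
    unfolding eq unfolding rodrigues_def
    by (auto intro!: derivative_eq_intros simp: mult.commute)
  show "skew w ** rodrigues s w = rodrigues s w ** skew w"
    unfolding eq unfolding w rodrigues_def mm_add_left scaleR_matrix_mult matrix_mul_assoc[symmetric]
      skew_sgn_cubed matrix_mul_lid
    by (simp add: algebra_simps)
qed

lemma has_vector_derivative_rodrigues_uminus:
  "((\<lambda>s. rodrigues (- s) w) has_vector_derivative - (skew w ** rodrigues (- s) w)) (at s)"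
  using vector_diff_chain_at[of uminus "- 1" s "\<lambda>s. rodrigues s w", OF _ has_vector_derivative_rodrigues]
  by (simp add: o_def has_vector_derivative_minus has_vector_derivative_id)

lemma rodrigues_minus: "rodrigues (- s) w = transpose (rodrigues s w)"
proof -
  have "transpose (A + B) = transpose A + transpose B" "transpose (c *\<^sub>R A) = c *\<^sub>R transpose A" for A B :: "real^3^3" and c
    by (simp_all add: vec_eq_iff transpose_def)
  then show ?thesis
    by (simp add: rodrigues_def matrix_transpose_mul transpose_skew)
     (simp add: skew_minus[symmetric] vec_eq_iff forall_3 matrix_mult_nth3)
qed

lemma rodrigues_cancel: "rodrigues (- s) w ** rodrigues s w = mat 1" "rodrigues s w ** rodrigues (- s) w = mat 1"
  using rotation_matrix_rodrigues[of s w] unfolding rodrigues_minus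
  by (auto simp: rotation_matrix_def orthogonal_matrix_def)

lemma rotation_matrix_mult:
  fixes A B :: "real^'n^'n"
  shows "rotation_matrix A \<Longrightarrow> rotation_matrix B \<Longrightarrow> rotation_matrix (A ** B)"
  unfolding rotation_matrix_def using orthogonal_matrix_mul[of A B] by (simp add: det_mul)

lemma norm_rodrigues_deviation: "norm (mat 1 - rodrigues s w) \<le> 2 * \<bar>s\<bar> * norm w"
proof -
  have "(norm (mat 1 - rodrigues s w))\<^sup>2 = 8 * (norm (sin (s * norm w / 2) *\<^sub>R sgn w))\<^sup>2"
    unfolding norm_rotation_deviation[OF rotation_matrix_rodrigues]
    unfolding rodrigues_eq_quat_rot rot_dist_quat_rot ..
  also have "\<dots> \<le> 8 * (\<bar>s\<bar> * norm w / 2)\<^sup>2"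
  proof -
    have "\<bar>sin (s * norm w / 2)\<bar> * norm (sgn w) \<le> \<bar>s * norm w / 2\<bar> * 1"
      by (intro mult_mono abs_sin_x_le_abs_x) (auto simp: norm_sgn)
    then show ?thesis by (intro mult_left_mono power_mono) (auto simp: abs_mult)
  qed
  also have "\<dots> \<le> (2 * \<bar>s\<bar> * norm w)\<^sup>2" by (simp add: power_mult_distrib power_divide)
  finally show ?thesis by (rule power2_le_imp_le) simp
qed

lemma rot_dist_nonneg: "rotation_matrix R \<Longrightarrow> 0 \<le> rot_dist R"
  using trace_deficit(1) by (auto simp: rot_dist_def)

lemma rot_dist_eq_norm:
  assumes "rotation_matrix R"
  shows "rot_dist R = norm (mat 1 - R) / sqrt 8"
proof -
  have "(rot_dist R)\<^sup>2 = (norm (mat 1 - R) / sqrt 8)\<^sup>2"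
    using norm_rotation_deviation[OF assms] by (simp add: power_divide)
  then show ?thesis using rot_dist_nonneg[OF assms] by simp
qed

text \<open>Left multiplication by \<open>R\<close> preserves the norm, so the displacement is that
  of \<open>rodrigues\<close> from the identity. It is needed on the first interval of flow, where
  \<open>w\<close> is the arbitrary initial \<eta> and no energy estimate is available.\<close>

lemma rot_dist_mult_rodrigues:
  assumes "rotation_matrix R"
  shows "rot_dist (R ** rodrigues s w) \<le> rot_dist R + \<bar>s\<bar> * norm w"
proof -
  have "mat 1 - R ** rodrigues s w = (mat 1 - R) + R ** (mat 1 - rodrigues s w)"
    by (simp add: vec_eq_iff forall_3 matrix_mult_nth3 algebra_simps mat_def)
  then have "norm (mat 1 - R ** rodrigues s w) \<le> norm (mat 1 - R) + norm (mat 1 - rodrigues s w)"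
    by (metis norm_rotation_mult[OF assms] norm_triangle_ineq)
  also have "\<dots> \<le> norm (mat 1 - R) + 2 * (\<bar>s\<bar> * norm w)"
    using norm_rodrigues_deviation[of s w] by simp
  also have "2 * (\<bar>s\<bar> * norm w) \<le> sqrt 8 * (\<bar>s\<bar> * norm w)"
    by (intro mult_right_mono real_le_rsqrt) auto
  finally have "norm (mat 1 - R ** rodrigues s w) / sqrt 8 \<le> norm (mat 1 - R) / sqrt 8 + \<bar>s\<bar> * norm w"
    by (simp add: field_simps)
  then show ?thesis
    using assms by (simp add: rot_dist_eq_norm rotation_matrix_mult rotation_matrix_rodrigues)
qed

section \<open>The map \<open>psi\<close> and the attitude energy\<close>

lemma norm_psi_le: "norm (psi B) \<le> norm B"
proof -
  have *: "((x - y) / 2) * ((x - y) / 2) \<le> x * x + y * y" for x y :: real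
  proof -
    have "x * x + y * y - ((x - y) / 2) * ((x - y) / 2) = ((x + y) * (x + y) + 2 * (x * x) + 2 * (y * y)) / 4"
      by (simp add: field_simps)
    moreover have "0 \<le> ((x + y) * (x + y) + 2 * (x * x) + 2 * (y * y)) / 4"
      by (intro divide_nonneg_pos add_nonneg_nonneg) auto
    ultimately show ?thesis by linarith
  qed
  have "(norm (psi B))\<^sup>2 \<le> (norm B)\<^sup>2"
    unfolding norm_vec3_sq norm_mat3_sq psi_nth
    using *[of "B$3$2" "B$2$3"] *[of "B$1$3" "B$3$1"] *[of "B$2$1" "B$1$2"]
      zero_le_square[of "B$1$1"] zero_le_square[of "B$2$2"] zero_le_square[of "B$3$3"] by linarith
  then show ?thesis by (rule power2_le_imp_le) simp
qed

text \<open>The vector \<open>psi B\<close> represents the antisymmetric part of \<open>B\<close>,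
  the only part that pairs with a skew matrix in the trace. This makes \<open>psi (M ** R)\<close>
  the gradient of the energy, up to a factor.\<close>

lemma trace_mult_skew: "trace (B ** skew x) = - 2 * (psi B \<bullet> x)"
  by (simp add: trace_def sum_3 matrix_mult_nth3 inner_vec_def psi_nth algebra_simps add_divide_distrib diff_divide_distrib)

text \<open>For symmetric \<open>M\<close> the vector \<open>psi (M ** skew q)\<close> is
  \<open>bar_matrix M *v q\<close>, which gives the first term. In the square of
  \<open>skew q\<close>, the multiple of the identity gives a symmetric product with
  \<open>M\<close>; the remaining dyad of \<open>q\<close> gives the cross product.\<close>

lemma psi_mult_quat_rot:
  assumes "transpose M = M"
  shows "psi (M ** quat_rot s q) = (2 * s) *\<^sub>R (bar_matrix M *v q) - 2 *\<^sub>R cross3 q (bar_matrix M *v q)"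
proof -
  have sym: "M$2$1 = M$1$2" "M$3$1 = M$1$3" "M$3$2 = M$2$3"
    using assms by (metis (no_types) transpose_def vec_lambda_beta)+
  show ?thesis
    unfolding vec_eq_iff forall_3
    by (simp add: psi_nth matrix_mult_nth3 quat_rot_nth bar_matrix_def matrix_vector_mult_def sum_3
      trace_def mat_def cross3_def sym algebra_simps add_divide_distrib diff_divide_distrib)
qed

definition rot_energy :: "real^3^3 \<Rightarrow> real^3^3 \<Rightarrow> real" where
  "rot_energy M R = trace (M ** (mat 1 - R)) / 4"

lemma rot_energy_quat_rot:
  assumes "transpose M = M"
  shows "rot_energy M (quat_rot s q) = q \<bullet> (bar_matrix M *v q)"
proof -
  have sym: "M$2$1 = M$1$2" "M$3$1 = M$1$3" "M$3$2 = M$2$3"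
    using assms by (metis (no_types) transpose_def vec_lambda_beta)+
  show ?thesis
    by (simp add: rot_energy_def matrix_mult_nth3 quat_rot_nth bar_matrix_def matrix_vector_mult_def sum_3
      trace_def mat_def inner_vec_def sym algebra_simps add_divide_distrib diff_divide_distrib)
qed

section \<open>Symmetric matrices and the attitude energy\<close>

lemma dot_matrix_vector_symmetric:
  fixes B :: "real^'n^'n"
  assumes "transpose B = B"
  shows "v \<bullet> (B *v w) = w \<bullet> (B *v v)"
  by (metis assms dot_lmul_matrix inner_commute transpose_matrix_vector)

text \<open>A zero of a nonnegative form is a minimum, so the gradient \<open>2 * B u\<close>
  vanishes there. Explicitly, moving from \<open>u\<close> in the direction \<open>B u\<close> would
  make the form negative to first order.\<close>

lemma psd_form_zero_imp_kernel:
  fixes B :: "real^'n^'n"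
  assumes sym: "transpose B = B" and psd: "\<And>v. 0 \<le> v \<bullet> (B *v v)" and u: "u \<bullet> (B *v u) = 0"
  shows "B *v u = 0"
proof -
  define w where "w = B *v u"
  define a c where "a = w \<bullet> w" and "c = w \<bullet> (B *v w)"
  have c: "c \<ge> 0" unfolding c_def by (rule psd)
  have "0 \<le> 2 * t * a + t * t * c" for t
  proof -
    have "(u + t *\<^sub>R w) \<bullet> (B *v (u + t *\<^sub>R w)) = 2 * t * a + t * t * c"
      using u dot_matrix_vector_symmetric[OF sym, of u w]
      by (simp add: matrix_vector_right_distrib matrix_vector_mult_scaleR inner_add_left inner_add_right
          a_def c_def w_def distrib_left mult_ac)
    then show ?thesis using psd[of "u + t *\<^sub>R w"] by simp
  qed
  note quadratic = this
  \<comment> \<open>The step \<open>t = - r\<close> turns the quadratic into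
    \<open>- r\<^sup>2 * (c + 2)\<close>; the added 1 keeps the denominator positive when
    \<open>c = 0\<close>.\<close>
  define r where "r = a / (c + 1)"
  have a: "a = r * (c + 1)" using c by (simp add: r_def)
  have "r\<^sup>2 * (c + 2) \<le> 0"
    using quadratic[of "- r"] unfolding a by (simp add: algebra_simps power2_eq_square)
  then have "a = 0" using c unfolding a by (simp add: mult_le_0_iff)
  then show ?thesis by (simp add: a_def w_def)
qed

text \<open>A minimiser \<open>u\<close> of the form on the unit sphere, with value
  \<open>m\<close>, is a zero of the nonnegative form of \<open>B - m I\<close>, hence an
  eigenvector.\<close>

lemma symmetric_min_eigenvalue:
  fixes B :: "real^'n^'n"
  assumes sym: "transpose B = B"
  obtains m where "m \<in> eigenvalues B" "\<And>v. m * (norm v)\<^sup>2 \<le> v \<bullet> (B *v v)"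
proof -
  let ?q = "\<lambda>v :: real^'n. v \<bullet> (B *v v)"
  obtain b :: "real^'n" where "b \<in> Basis" using nonempty_Basis by blast
  then have ne: "sphere (0::real^'n) 1 \<noteq> {}" by (auto simp: intro!: exI[of _ b])
  have "continuous_on (sphere 0 1) ?q"
    by (intro continuous_intros matrix_vector_mult_linear_continuous_on)
  then obtain u where u: "norm u = 1" "\<And>v. norm v = 1 \<Longrightarrow> ?q u \<le> ?q v"
    using continuous_attains_inf[OF compact_sphere ne, of ?q] by auto
  define m where "m = ?q u"
  have m: "m * (norm v)\<^sup>2 \<le> ?q v" for v
  proof (cases "v = 0")
    case False
    have "m \<le> ?q (sgn v)" unfolding m_def using False by (intro u) (simp add: norm_sgn)
    also have "\<dots> = ?q v / (norm v)\<^sup>2"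
      by (simp add: sgn_div_norm matrix_vector_mult_scaleR power2_eq_square divide_simps)
    finally show ?thesis using False by (simp add: field_simps)
  qed simp
  let ?B = "B - m *\<^sub>R mat 1"
  have Bv: "?B *v v = B *v v - m *\<^sub>R v" for v
    by (simp add: matrix_vector_mult_diff_rdistrib scaleR_matrix_vector_assoc[symmetric])
  have "?B *v u = 0"
  proof (rule psd_form_zero_imp_kernel)
    show "transpose ?B = ?B"
      using sym by (simp add: vec_eq_iff transpose_def mat_def)
    show "0 \<le> v \<bullet> (?B *v v)" for v
      using m[of v] unfolding Bv by (simp add: inner_diff_right power2_norm_eq_inner)
    show "u \<bullet> (?B *v u) = 0"
      unfolding Bv using u(1) by (simp add: inner_diff_right m_def power2_norm_eq_inner[symmetric])
  qed
  then have "m \<in> eigenvalues B"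
    using u(1) unfolding Bv eigenvalues_def by (auto intro!: exI[of _ u])
  then show thesis using m by (rule that)
qed

lemma eigenvalues_uminus: "eigenvalues (- B) = uminus ` eigenvalues B"
proof -
  have n: "(- B) *v v = - (B *v v)" for v by (simp add: vec_eq_iff matrix_vector_mult_def sum_negf)
  have "c \<in> eigenvalues (- B) \<longleftrightarrow> - c \<in> eigenvalues B" for c
    unfolding eigenvalues_def n by (simp add: neg_equal_iff_equal[of "B *v _", symmetric] del: neg_equal_iff_equal)
  then show ?thesis by (force simp: image_iff)
qed

lemma symmetric_max_eigenvalue:
  fixes B :: "real^'n^'n"
  assumes sym: "transpose B = B"
  obtains m where "m \<in> eigenvalues B" "\<And>v. v \<bullet> (B *v v) \<le> m * (norm v)\<^sup>2"
proof -
  have "transpose (- B) = - B" using sym by (simp add: vec_eq_iff transpose_def)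
  then obtain m where m: "m \<in> eigenvalues (- B)" "\<And>v. m * (norm v)\<^sup>2 \<le> v \<bullet> ((- B) *v v)"
    by (rule symmetric_min_eigenvalue) blast
  have n: "(- B) *v v = - (B *v v)" for v by (simp add: vec_eq_iff matrix_vector_mult_def sum_negf)
  show thesis
  proof (rule that[of "- m"])
    show "- m \<in> eigenvalues B" using m(1) by (auto simp: eigenvalues_uminus)
    show "v \<bullet> (B *v v) \<le> - m * (norm v)\<^sup>2" for v using m(2)[of v] unfolding n by simp
  qed
qed

text \<open>Eigenvectors of distinct eigenvalues are orthogonal, hence independent. Finiteness gives
  \<open>eig_min\<close> and \<open>eig_max\<close>, defined by \<open>Min\<close> and
  \<open>Max\<close>, their intended meaning.\<close>

lemma finite_eigenvalues_symmetric:
  fixes B :: "real^'n^'n"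
  assumes sym: "transpose B = B"
  shows "finite (eigenvalues B)"
proof -
  define f where "f = (\<lambda>c. SOME v. v \<noteq> 0 \<and> B *v v = c *\<^sub>R v)"
  have f: "f c \<noteq> 0 \<and> B *v f c = c *\<^sub>R f c" if "c \<in> eigenvalues B" for c
    using that unfolding f_def eigenvalues_def mem_Collect_eq by (rule someI_ex)
  have orth: "f c \<bullet> f d = 0" if "c \<in> eigenvalues B" "d \<in> eigenvalues B" "c \<noteq> d" for c d
  proof -
    have "d * (f c \<bullet> f d) = c * (f c \<bullet> f d)"
      using dot_matrix_vector_symmetric[OF sym, of "f c" "f d"] f that by (simp add: inner_commute)
    then show ?thesis using that by simp
  qed
  have "independent (f ` eigenvalues B)"
  proof (rule pairwise_orthogonal_independent)
    show "pairwise orthogonal (f ` eigenvalues B)"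
      unfolding pairwise_def orthogonal_def using orth by auto
    show "0 \<notin> f ` eigenvalues B" using f by force
  qed
  then have "finite (f ` eigenvalues B)" by (rule independent_imp_finite)
  moreover have "inj_on f (eigenvalues B)"
    using orth f by (metis inj_onI inner_eq_zero_iff)
  ultimately show ?thesis by (rule finite_imageD)
qed

text \<open>The variational eigenvalue \<open>m\<close> need not be identified with
  \<open>eig_min\<close>: membership in the spectrum already gives \<open>eig_min B \<le> m\<close>,
  and this is the direction that the bound requires.\<close>

lemma eig_bounds:
  fixes B :: "real^'n^'n"
  assumes sym: "transpose B = B"
  shows "eig_min B * (norm v)\<^sup>2 \<le> v \<bullet> (B *v v)" "v \<bullet> (B *v v) \<le> eig_max B * (norm v)\<^sup>2"
proof -
  note fin = finite_eigenvalues_symmetric[OF sym]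
  obtain m where m: "m \<in> eigenvalues B" "m * (norm v)\<^sup>2 \<le> v \<bullet> (B *v v)"
    using symmetric_min_eigenvalue[OF sym] by metis
  have "eig_min B \<le> m" unfolding eig_min_def using fin m(1) by (rule Min_le)
  then show "eig_min B * (norm v)\<^sup>2 \<le> v \<bullet> (B *v v)"
    using m(2) by (meson mult_right_mono order_trans zero_le_power2)
  obtain m where m: "m \<in> eigenvalues B" "v \<bullet> (B *v v) \<le> m * (norm v)\<^sup>2"
    using symmetric_max_eigenvalue[OF sym] by metis
  have "m \<le> eig_max B" unfolding eig_max_def using fin m(1) by (rule Max_ge)
  then show "v \<bullet> (B *v v) \<le> eig_max B * (norm v)\<^sup>2"
    using m(2) by (meson mult_right_mono order_trans zero_le_power2)
qed

lemma eig_min_pos: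
  fixes B :: "real^'n^'n"
  assumes "positive_definite B"
  shows "eig_min B > 0" "eig_min B \<le> eig_max B"
proof -
  have sym: "transpose B = B" using assms by (simp add: positive_definite_def)
  note fin = finite_eigenvalues_symmetric[OF sym]
  have ne: "eigenvalues B \<noteq> {}" using symmetric_min_eigenvalue[OF sym] by auto
  have "eig_min B \<in> eigenvalues B" unfolding eig_min_def using fin ne by (rule Min_in)
  then obtain v where v: "v \<noteq> 0" "B *v v = eig_min B *\<^sub>R v" by (auto simp: eigenvalues_def)
  have "0 < v \<bullet> (B *v v)" using assms v(1) unfolding positive_definite_def by blast
  then show "eig_min B > 0" 
    using v(1) by (auto simp: v(2) intro: zero_less_mult_pos2[of _ "v \<bullet> v"])
  show "eig_min B \<le> eig_max B" unfolding eig_min_def eig_max_def using fin ne by simp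
qed

section \<open>Landmark geometry and bounds in quaternion coordinates\<close>

lemma transpose_landmark_matrix: "transpose (landmark_matrix N k p) = landmark_matrix N k p"
  by (simp add: vec_eq_iff transpose_def landmark_matrix_def outer_def mult.commute)

text \<open>The form is linear in \<open>M\<close>, and for a single dyad it is Lagrange's identity
  for the cross product.\<close>

lemma bar_landmark_form:
  "v \<bullet> (bar_matrix (landmark_matrix N k p) *v v)
     = (\<Sum>i=1..N. k i * ((norm (cross3 (p i - centroid N k p) v))\<^sup>2 / 2))"
proof -
  have lin: "linear (\<lambda>M. v \<bullet> (bar_matrix M *v v))"
    by (simp add: linear_iff bar_matrix_def trace_def mat_def matrix_vector_mult_def inner_vec_def sum_3
        algebra_simps add_divide_distrib diff_divide_distrib)
  have o: "v \<bullet> (bar_matrix (outer d d) *v v) = (norm (cross3 d v))\<^sup>2 / 2" for d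
    unfolding norm_vec3_sq
    by (simp add: bar_matrix_def trace_def mat_def matrix_vector_mult_def inner_vec_def sum_3 outer_def cross3_def
        algebra_simps add_divide_distrib diff_divide_distrib)
  show ?thesis
    unfolding landmark_matrix_def linear_sum[OF lin] linear_scale[OF lin] by (simp add: o)
qed

text \<open>If the form vanishes at \<open>v\<close>, every summand does, so all
  \<open>p i - centroid N k p\<close> are multiples of \<open>v\<close>. Then all landmarks lie on
  one line.\<close>

lemma bar_landmark_positive_definite:
  assumes nc: "\<exists>i\<in>{1..N}. \<exists>j\<in>{1..N}. \<exists>l\<in>{1..N}. \<not> collinear {p i, p j, p l}"
    and k: "\<forall>i\<in>{1..N}. k i > 0"
  shows "positive_definite (bar_matrix (landmark_matrix N k p))"
  unfolding positive_definite_def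
proof (intro conjI allI impI)
  have "transpose (bar_matrix M) = bar_matrix M" if "transpose M = M" for M
    using that by (simp add: bar_matrix_def vec_eq_iff transpose_def mat_def)
  then show "transpose (bar_matrix (landmark_matrix N k p)) = bar_matrix (landmark_matrix N k p)"
    using transpose_landmark_matrix .
  fix v :: "real^3" assume v: "v \<noteq> 0"
  let ?d = "\<lambda>i. p i - centroid N k p"
  have nn: "0 \<le> k i * ((norm (cross3 (?d i) v))\<^sup>2 / 2)" if "i \<in> {1..N}" for i
    using k that by (simp add: less_imp_le)
  show "v \<bullet> (bar_matrix (landmark_matrix N k p) *v v) > 0"
  proof (rule ccontr)
    assume "\<not> ?thesis"
    then have "(\<Sum>i=1..N. k i * ((norm (cross3 (?d i) v))\<^sup>2 / 2)) \<le> 0"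
      unfolding bar_landmark_form by simp
    moreover have "(\<Sum>i=1..N. k i * ((norm (cross3 (?d i) v))\<^sup>2 / 2)) \<ge> 0"
      by (rule sum_nonneg) (rule nn)
    ultimately have s0: "(\<Sum>i=1..N. k i * ((norm (cross3 (?d i) v))\<^sup>2 / 2)) = 0" by linarith
    have z: "cross3 (?d i) v = 0" if i: "i \<in> {1..N}" for i
    proof -
      have "k i * ((norm (cross3 (?d i) v))\<^sup>2 / 2) = 0"
        by (rule sum_nonneg_0[OF finite_atLeastAtMost nn s0 i])
      then show ?thesis using k i by fastforce
    qed
    have "\<exists>c. ?d i = c *\<^sub>R v" if "i \<in> {1..N}" for i
    proof -
      have "collinear {0, v, ?d i}"
        using z[OF that] unfolding cross_eq_0 by (simp add: insert_commute)
      then show ?thesis using v unfolding collinear_lemma by (auto intro: exI[of _ 0])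
    qed
    then obtain c where c: "\<And>i. i \<in> {1..N} \<Longrightarrow> ?d i = c i *\<^sub>R v" by metis
    have d: "\<exists>e. p i - p j = e *\<^sub>R v" if "i \<in> {1..N}" "j \<in> {1..N}" for i j
    proof
      have "p i - p j = ?d i - ?d j" by simp
      also have "\<dots> = (c i - c j) *\<^sub>R v" using c that by (simp add: scaleR_diff_left)
      finally show "p i - p j = (c i - c j) *\<^sub>R v" .
    qed
    have "collinear {p i, p j, p l}" if "i \<in> {1..N}" "j \<in> {1..N}" "l \<in> {1..N}" for i j l
      unfolding collinear_def by (rule exI[of _ v]) (use d that in blast)
    then show False using nc by blast
  qed
qed

lemma rot_energy_bounds:
  assumes M: "transpose M = M" "positive_definite (bar_matrix M)" and R: "rotation_matrix R"
  shows "eig_min (bar_matrix M) * (rot_dist R)\<^sup>2 \<le> rot_energy M R"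
    "rot_energy M R \<le> eig_max (bar_matrix M) * (rot_dist R)\<^sup>2"
proof -
  obtain s q where sq: "s\<^sup>2 + (norm q)\<^sup>2 = 1" "R = quat_rot s q"
    using rotation_matrix_quaternion[OF R] .
  have sym: "transpose (bar_matrix M) = bar_matrix M" using M by (simp add: positive_definite_def)
  show "eig_min (bar_matrix M) * (rot_dist R)\<^sup>2 \<le> rot_energy M R"
    "rot_energy M R \<le> eig_max (bar_matrix M) * (rot_dist R)\<^sup>2"
    unfolding sq(2) rot_dist_quat_rot rot_energy_quat_rot[OF M(1)] using eig_bounds[OF sym] by auto
qed

text \<open>The two summands of \<open>psi (M R)\<close> in quaternion coordinates are orthogonal, and the first one
  vanishes only for rotations by a half turn.\<close>

lemma norm_psi_lower:
  assumes M: "transpose M = M" "positive_definite (bar_matrix M)" and R: "rotation_matrix R"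
  shows "4 * (1 - (rot_dist R)\<^sup>2) * (eig_min (bar_matrix M))\<^sup>2 * (rot_dist R)\<^sup>2 \<le> (norm (psi (M ** R)))\<^sup>2"
proof -
  obtain s q where sq: "s\<^sup>2 + (norm q)\<^sup>2 = 1" "R = quat_rot s q"
    using rotation_matrix_quaternion[OF R] .
  let ?B = "bar_matrix M" and ?l = "eig_min (bar_matrix M)"
  have sym: "transpose ?B = ?B" using M by (simp add: positive_definite_def)
  have l: "?l * norm q \<le> norm (?B *v q)"
  proof (cases "q = 0")
    case False
    have "?l * (norm q)\<^sup>2 \<le> norm q * norm (?B *v q)"
      using eig_bounds(1)[OF sym, of q] norm_cauchy_schwarz[of q "?B *v q"] by linarith
    then have "norm q * (?l * norm q) \<le> norm q * norm (?B *v q)" by (simp add: power2_eq_square mult_ac)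
    then show ?thesis using False by simp
  qed simp
  have "4 * s\<^sup>2 * (norm (?B *v q))\<^sup>2 \<le> (norm ((2 * s) *\<^sub>R (?B *v q) - 2 *\<^sub>R cross3 q (?B *v q)))\<^sup>2"
  proof -
    have "(norm (a *\<^sub>R x - b *\<^sub>R cross3 y x))\<^sup>2 = a\<^sup>2 * (norm x)\<^sup>2 + b\<^sup>2 * (norm (cross3 y x))\<^sup>2" for a b x y
      unfolding power2_norm_eq_inner
      by (simp add: inner_diff_left inner_diff_right dot_cross_self power2_eq_square inner_commute)
    then show ?thesis by (simp add: power_mult_distrib)
  qed
  moreover have "4 * s\<^sup>2 * (?l\<^sup>2 * (norm q)\<^sup>2) \<le> 4 * s\<^sup>2 * (norm (?B *v q))\<^sup>2"
    using l eig_min_pos(1)[OF M(2)] unfolding power_mult_distrib[symmetric]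
    by (intro mult_left_mono power_mono) auto
  ultimately show ?thesis
    unfolding sq(2) rot_dist_quat_rot psi_mult_quat_rot[OF M(1)] using sq(1)
    by (simp add: mult_ac eq_diff_eq[THEN iffD2, OF sq(1), symmetric])
qed

section \<open>Change of the energy over one interval of flow\<close>

lemma matrix_mult_norm_bound:
  obtains K where "K > 0" "\<And>(A :: real^3^3) (B :: real^3^3). norm (A ** B) \<le> K * norm A * norm B"
proof -
  have "\<exists>K>0. \<forall>(A :: real^3^3) (B :: real^3^3). norm (A ** B) \<le> norm A * norm B * K"
    by (rule bounded_bilinear.pos_bounded[OF bilinear_mm])
  then obtain K where K: "K > 0" "\<forall>(A :: real^3^3) (B :: real^3^3). norm (A ** B) \<le> norm A * norm B * K" by auto
  show thesis by (rule that[OF K(1)]) (use K(2)[rule_format] in \<open>simp add: mult_ac\<close>)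
qed

text \<open>The map is Lipschitz in \<open>R\<close> and vanishes at the identity because
  \<open>M\<close> is symmetric. The first bound controls \<eta> after a jump, the second the drift
  of the gradient during flow.\<close>

lemma psi_rotation_bounds:
  assumes M: "transpose M = M"
  obtains K where "K > 0" "\<And>R. rotation_matrix R \<Longrightarrow> norm (psi (M ** R)) \<le> K * rot_dist R"
    "\<And>R s w. rotation_matrix R \<Longrightarrow> norm (psi (M ** (R ** rodrigues s w)) - psi (M ** R)) \<le> K * \<bar>s\<bar> * norm w"
proof -
  obtain K0 where K0: "K0 > 0" "\<And>(A :: real^3^3) (B :: real^3^3). norm (A ** B) \<le> K0 * norm A * norm B"
    by (rule matrix_mult_norm_bound) blast
  \<comment> \<open>The 3 dominates both \<open>sqrt 8\<close>, from the distance identity, and the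
    2 in \<open>norm_rodrigues_deviation\<close>; adding 1 keeps \<open>K\<close> positive for
    \<open>M = 0\<close>.\<close>
  define K where "K = 3 * K0 * (norm M + 1)"
  have K: "K > 0" using K0 by (auto simp: K_def intro!: mult_pos_pos add_nonneg_pos)
  have lip: "norm (psi (M ** A) - psi (M ** B)) \<le> K0 * norm M * norm (A - B)" for A B :: "real^3^3"
  proof -
    have "psi (M ** A) - psi (M ** B) = psi (M ** (A - B))"
      by (simp add: vec_eq_iff forall_3 psi_nth matrix_mult_nth3 algebra_simps add_divide_distrib diff_divide_distrib)
    then show ?thesis using norm_psi_le K0(2) by (metis order_trans)
  qed
  have ge: "K0 * norm M * (3 * x) \<le> K * x" if "x \<ge> 0" for x
  proof -
    have "K * x = K0 * norm M * (3 * x) + 3 * K0 * x" by (simp add: K_def algebra_simps)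
    then show ?thesis using that K0(1) by simp
  qed
  show thesis
  proof (rule that[OF K])
    fix R :: "real^3^3" assume R: "rotation_matrix R"
    have "M$2$1 = M$1$2" "M$3$1 = M$1$3" "M$3$2 = M$2$3"
      using M by (metis (no_types) transpose_def vec_lambda_beta)+
    then have "psi (M ** mat 1) = 0" by (simp add: vec_eq_iff forall_3 psi_nth)
    then have "norm (psi (M ** R)) \<le> K0 * norm M * norm (R - mat 1)" using lip[of R "mat 1"] by simp
    also have "\<dots> = K0 * norm M * (sqrt 8 * rot_dist R)"
      using rot_dist_eq_norm[OF R] by (simp add: norm_minus_commute)
    also have "\<dots> \<le> K0 * norm M * (3 * rot_dist R)"
      using K0(1) rot_dist_nonneg[OF R] by (intro mult_left_mono mult_right_mono real_le_lsqrt) auto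
    also have "\<dots> \<le> K * rot_dist R" by (rule ge[OF rot_dist_nonneg[OF R]])
    finally show "norm (psi (M ** R)) \<le> K * rot_dist R" .
    fix s w
    have "R ** rodrigues s w - R = - (R ** (mat 1 - rodrigues s w))"
      by (simp add: vec_eq_iff forall_3 matrix_mult_nth3 algebra_simps mat_def)
    then have "norm (R ** rodrigues s w - R) = norm (mat 1 - rodrigues s w)"
      by (simp add: norm_rotation_mult[OF R])
    also have "\<dots> \<le> 3 * (\<bar>s\<bar> * norm w)"
    proof -
      have "0 \<le> \<bar>s\<bar> * norm w" by simp
      then show ?thesis using norm_rodrigues_deviation[of s w] by linarith
    qed
    finally have "K0 * norm M * norm (R ** rodrigues s w - R) \<le> K0 * norm M * (3 * (\<bar>s\<bar> * norm w))"
      using K0(1) by (intro mult_left_mono) auto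
    also have "\<dots> \<le> K * (\<bar>s\<bar> * norm w)" by (rule ge) simp
    finally show "norm (psi (M ** (R ** rodrigues s w)) - psi (M ** R)) \<le> K * \<bar>s\<bar> * norm w"
      using lip[of "R ** rodrigues s w" R] by simp
  qed
qed

lemma has_derivative_rot_energy_flow:
  "((\<lambda>s. rot_energy M (R ** rodrigues (- s) w)) has_real_derivative
     - (1/2) * (psi (M ** (R ** rodrigues (- s) w)) \<bullet> w)) (at s)"
proof -
  have lin: "linear (\<lambda>B. - trace (M ** (R ** B)) / 4)"
    by (simp add: linear_iff trace_def sum_3 matrix_mult_nth3 algebra_simps add_divide_distrib diff_divide_distrib)
  have "((\<lambda>s. trace M / 4 + - trace (M ** (R ** rodrigues (- s) w)) / 4) has_vector_derivative
     0 + - trace (M ** (R ** (- (skew w ** rodrigues (- s) w)))) / 4) (at s)"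
    by (intro has_vector_derivative_add has_vector_derivative_const
      bounded_linear.has_vector_derivative[OF linear_conv_bounded_linear[THEN iffD1, OF lin] has_vector_derivative_rodrigues_uminus])
  moreover have "rot_energy M B = trace M / 4 + - trace (M ** B) / 4" for B
    by (simp add: rot_energy_def trace_def sum_3 matrix_mult_nth3 mat_def algebra_simps add_divide_distrib diff_divide_distrib)
  moreover have "0 + - trace (M ** (R ** (- (skew w ** rodrigues (- s) w)))) / 4
    = - (1/2) * (psi (M ** (R ** rodrigues (- s) w)) \<bullet> w)"
  proof -
    have "M ** (R ** (- (skew w ** rodrigues (- s) w))) = - 1 *\<^sub>R ((M ** (R ** rodrigues (- s) w)) ** skew w)"
      unfolding rodrigues_commute by (simp add: matrix_mult_uminus matrix_mul_assoc)
    moreover have "trace (- 1 *\<^sub>R B) = - trace B" for B :: "real^3^3" by (simp add: trace_def sum_negf)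
    ultimately show ?thesis by (simp add: trace_mult_skew)
  qed
  ultimately show ?thesis unfolding has_real_derivative_iff_has_vector_derivative by simp
qed

lemma rot_energy_step:
  assumes M: "transpose M = M" and TM: "TM > 0"
  obtains kstar where "kstar > 0"
    "\<And>kR h R. 0 < kR \<Longrightarrow> kR < kstar \<Longrightarrow> 0 \<le> h \<Longrightarrow> h \<le> TM \<Longrightarrow> rotation_matrix R \<Longrightarrow>
      rot_energy M (R ** rodrigues (- h) (kR *\<^sub>R psi (M ** R)))
        \<le> rot_energy M R - kR / 4 * h * (norm (psi (M ** R)))\<^sup>2"
proof -
  obtain K where K: "K > 0" "\<And>R s w. rotation_matrix R \<Longrightarrow>
      norm (psi (M ** (R ** rodrigues s w)) - psi (M ** R)) \<le> K * \<bar>s\<bar> * norm w"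
    using psi_rotation_bounds[OF M] by metis
  show thesis
  \<comment> \<open>With this threshold the gradient drifts within time \<open>TM\<close> by at most
    half its sampled norm. Its inner product with the sample is then at least half the squared norm,
    which turns the rate \<open>kR / 2\<close> into \<open>kR / 4\<close>.\<close>
  proof (rule that[of "1 / (2 * K * TM)"])
    show "1 / (2 * K * TM) > 0" using K TM by simp
    fix kR h R
    assume kR: "0 < kR" "kR < 1 / (2 * K * TM)" and h: "0 \<le> h" "h \<le> TM" and R: "rotation_matrix (R :: real^3^3)"
    define w where "w = psi (M ** R)"
    let ?f = "\<lambda>s. rot_energy M (R ** rodrigues (- s) (kR *\<^sub>R w))"
    let ?g = "\<lambda>s. psi (M ** (R ** rodrigues (- s) (kR *\<^sub>R w)))"
    have kK: "K * TM * kR \<le> 1 / 2" using kR K TM by (simp add: field_simps)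
    have ub: "- (1/2) * (?g s \<bullet> (kR *\<^sub>R w)) \<le> - (kR / 4) * (norm w)\<^sup>2" if s: "0 \<le> s" "s \<le> h" for s
    proof -
      have "norm (?g s - w) \<le> K * s * norm (kR *\<^sub>R w)" using K(2)[OF R, of "- s" "kR *\<^sub>R w"] s by (simp add: w_def)
      also have "\<dots> = (K * s * kR) * norm w" using kR by simp
      also have "\<dots> \<le> (K * TM * kR) * norm w"
        using K kR s h by (intro mult_right_mono mult_left_mono) auto
      also have "\<dots> \<le> (1/2) * norm w" using kK by (rule mult_right_mono) simp
      finally have "norm (?g s - w) * norm w \<le> (1/2) * norm w * norm w" by (rule mult_right_mono) simp
      then have "- ((?g s - w) \<bullet> w) \<le> (1/2) * (norm w)\<^sup>2"
        using norm_cauchy_schwarz[of "- (?g s - w)" w] by (simp only: inner_minus_left norm_minus_cancel) (simp add: power2_eq_square)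
      then have "?g s \<bullet> w \<ge> (1/2) * (norm w)\<^sup>2" by (simp add: inner_diff_left power2_norm_eq_inner)
      then have "(kR / 2) * (?g s \<bullet> w) \<ge> (kR / 2) * ((1/2) * (norm w)\<^sup>2)" using kR by (intro mult_left_mono) auto
      then show ?thesis by simp
    qed
    have "?f h \<le> ?f 0 - kR / 4 * h * (norm w)\<^sup>2"
    proof (cases "h = 0")
      case False
      then have "0 < h" using h by simp
      from MVT2[OF this has_derivative_rot_energy_flow] obtain z where z: "0 < z" "z < h"
        and "?f h - ?f 0 = (h - 0) * (- (1/2) * (?g z \<bullet> (kR *\<^sub>R w)))" by blast
      then have "?f h - ?f 0 \<le> h * (- (kR / 4) * (norm w)\<^sup>2)"
        using mult_left_mono[OF ub[of z], of h] h by simp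
      then show ?thesis by (simp add: mult_ac)
    qed simp
    then show "rot_energy M (R ** rodrigues (- h) (kR *\<^sub>R psi (M ** R)))
        \<le> rot_energy M R - kR / 4 * h * (norm (psi (M ** R)))\<^sup>2"
      by (simp add: w_def)
  qed
qed

section \<open>The linear error\<close>

lemma stack_cases:
  fixes X :: vec9
  obtains a b c where "X = stack a b c"
proof (rule that)
  show "X = stack (\<chi> i. X $ (1, i)) (\<chi> i. X $ (2, i)) (\<chi> i. X $ (3, i))"
    by (simp add: vec_eq_iff split_paired_all forall_3 stack_def)
qed

lemma stack_zero: "stack 0 0 0 = 0"
  by (simp add: vec_eq_iff split_paired_all forall_3 stack_def)

lemma A_mat_cubed: "A_mat *v (A_mat *v (A_mat *v X)) = 0"
  by (cases X rule: stack_cases) (simp add: A_mat_stack stack_zero)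

text \<open>The exponential series of the nilpotent matrix \<open>A\<close> stops after the quadratic term.\<close>

lemma Phi_vector:
  "Phi \<tau> *v X = X + \<tau> *\<^sub>R (A_mat *v X) + (\<tau>\<^sup>2 / 2) *\<^sub>R (A_mat *v (A_mat *v X))"
proof -
  let ?B = "\<tau> *\<^sub>R A_mat"
  let ?t = "\<lambda>n. (1 / fact n) *\<^sub>R (((**) ?B ^^ n) (mat 1))"
  have Bv: "?B *v Y = \<tau> *\<^sub>R (A_mat *v Y)" for Y by (simp add: scaleR_matrix_vector_assoc)
  have B3: "?B ** (?B ** (?B ** Y)) = 0" for Y :: mat9
    unfolding matrix_eq by (simp add: matrix_vector_mul_assoc[symmetric] Bv matrix_vector_mult_scaleR A_mat_cubed)
  have zero: "?t n = 0" if "n \<notin> {..<3}" for n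
  proof -
    obtain m where "n = 3 + m" using \<open>n \<notin> {..<3}\<close> le_Suc_ex[of 3 n] by (auto simp: not_less)
    then have "((**) ?B ^^ n) (mat 1) = ?B ** (?B ** (?B ** (((**) ?B ^^ m) (mat 1))))"
      by (simp only: numeral_3_eq_3 add_Suc add_0 funpow.simps o_apply)
    then show ?thesis by (simp only: B3 scaleR_zero_right)
  qed
  have "Phi \<tau> = (\<Sum>n<3. ?t n)"
    unfolding Phi_def matrix_exp_def by (rule suminf_finite) (use zero in auto)
  also have "\<dots> = mat 1 + ?B + (1/2) *\<^sub>R (?B ** ?B)"
    by (simp add: numeral_3_eq_3 fact_numeral)
  finally show ?thesis
    by (simp add: matrix_vector_mult_add_rdistrib scaleR_matrix_vector_assoc[symmetric]
        matrix_vector_mul_assoc[symmetric] matrix_vector_mult_scaleR power2_eq_square)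
qed

lemma Phi_add: "Phi s *v (Phi t *v X) = Phi (s + t) *v X"
  by (simp add: Phi_vector matrix_vector_right_distrib matrix_vector_mult_scaleR A_mat_cubed
      power2_eq_square algebra_simps add_divide_distrib)

lemma Phi_0 [simp]: "Phi 0 *v X = X"
  by (simp add: Phi_vector)

lemma has_vector_derivative_Phi:
  "((\<lambda>s. Phi s *v X) has_vector_derivative A_mat *v (Phi s *v X)) (at s within S)"
proof -
  have "((\<lambda>s. s\<^sup>2 / 2) has_vector_derivative s) (at s within S)"
    unfolding has_real_derivative_iff_has_vector_derivative[symmetric]
    by (auto intro!: derivative_eq_intros)
  then show ?thesis unfolding Phi_vector
    by (auto intro!: derivative_eq_intros
      simp: matrix_vector_right_distrib matrix_vector_mult_scaleR A_mat_cubed)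
qed

lemma Phi_norm_bound:
  assumes "T \<ge> 0"
  obtains K where "K \<ge> 1" "\<And>s X. \<bar>s\<bar> \<le> T \<Longrightarrow> norm (Phi s *v X) \<le> K * norm X"
proof -
  obtain C where C: "C > 0" "\<And>X. norm (A_mat *v X) \<le> C * norm X"
    using linear_bounded_pos[OF matrix_vector_mul_linear[of A_mat]] by blast
  show thesis
  proof (rule that)
    show "1 \<le> 1 + T * C + T\<^sup>2 / 2 * (C * C)" using assms C by simp
    fix s X assume s: "\<bar>s\<bar> \<le> T"
    have "norm (A_mat *v (A_mat *v X)) \<le> C * (C * norm X)"
      using C(1) mult_left_mono[OF C(2)[of X], of C] by (intro order_trans[OF C(2)]) simp
    moreover have "s\<^sup>2 \<le> T\<^sup>2" using s assms by (simp add: abs_le_square_iff[symmetric])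
    ultimately have "norm X + \<bar>s\<bar> * norm (A_mat *v X) + s\<^sup>2 / 2 * norm (A_mat *v (A_mat *v X))
      \<le> norm X + T * (C * norm X) + T\<^sup>2 / 2 * (C * (C * norm X))"
      using s assms C by (intro add_mono mult_mono) auto
    moreover have "norm (Phi s *v X) \<le> norm X + \<bar>s\<bar> * norm (A_mat *v X) + s\<^sup>2 / 2 * norm (A_mat *v (A_mat *v X))"
      unfolding Phi_vector by (rule order_trans[OF norm_triangle_ineq] add_mono order_refl)+ simp_all
    ultimately show "norm (Phi s *v X) \<le> (1 + T * C + T\<^sup>2 / 2 * (C * C)) * norm X"
      by (simp add: algebra_simps)
  qed
qed

text \<open>The form measures the change of the \<open>P\<close>-energy under one jump followed by a
  flow of length \<tau>.\<close>

lemma Xi_form: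
  "X \<bullet> (Xi kp kv kg P \<tau> *v X) =
     (Phi \<tau> *v (Ag_mat kp kv kg *v X)) \<bullet> (P *v (Phi \<tau> *v (Ag_mat kp kv kg *v X))) - X \<bullet> (P *v X)"
  unfolding Xi_def matrix_vector_mult_diff_rdistrib inner_diff_right
  by (simp add: matrix_vector_mul_assoc[symmetric] dot_lmul_matrix inner_commute)
    (metis dot_lmul_matrix inner_commute)

lemma sampled_lyapunov_decay:
  assumes P: "positive_definite P" and Xi: "\<forall>\<tau>\<in>{Tm..TM}. negative_definite (Xi kp kv kg P \<tau>)"
    and T: "Tm \<le> TM"
  obtains r where "r > 0" "\<And>\<tau> X. \<tau> \<in> {Tm..TM} \<Longrightarrow>
    (Phi \<tau> *v (Ag_mat kp kv kg *v X)) \<bullet> (P *v (Phi \<tau> *v (Ag_mat kp kv kg *v X))) \<le> exp (- r) * (X \<bullet> (P *v X))"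
proof -
  let ?G = "Ag_mat kp kv kg"
  let ?q = "\<lambda>(\<tau>, X). X \<bullet> (Xi kp kv kg P \<tau> *v X)"
  let ?K = "{Tm..TM} \<times> sphere (0 :: vec9) 1"
  have symP: "transpose P = P" using P by (simp add: positive_definite_def)
  obtain b :: vec9 where "b \<in> Basis" using nonempty_Basis by blast
  then have ne: "?K \<noteq> {}" using T by (auto intro!: exI[of _ b])
  have comp: "compact ?K" by (intro compact_Times compact_sphere) simp
  \<comment> \<open>Joint continuity is visible once \<open>Phi\<close> is written as a quadratic
    polynomial in its argument.\<close>
  have cont: "continuous_on ?K ?q"
    unfolding case_prod_unfold Xi_form Phi_vector
    by (intro continuous_intros continuous_on_compose2[OF matrix_vector_mult_linear_continuous_on[of UNIV]]) auto
  obtain z where z: "z \<in> ?K" "\<And>y. y \<in> ?K \<Longrightarrow> ?q y \<le> ?q z"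
    using continuous_attains_sup[OF comp ne cont] by blast
  define c where "c = - ?q z"
  obtain \<tau>0 u where \<tau>0: "z = (\<tau>0, u)" "\<tau>0 \<in> {Tm..TM}" "u \<noteq> 0" using z(1) by fastforce
  then have "c > 0" using Xi unfolding c_def negative_definite_def by auto
  have q: "X \<bullet> (Xi kp kv kg P \<tau> *v X) \<le> - c * (norm X)\<^sup>2" if \<tau>: "\<tau> \<in> {Tm..TM}" for \<tau> X
  proof (cases "X = 0")
    case False
    have "?q (\<tau>, sgn X) \<le> - c" unfolding c_def using False \<tau> z(2)[of "(\<tau>, sgn X)"] by (simp add: norm_sgn)
    then show ?thesis using False
      by (simp add: sgn_div_norm matrix_vector_mult_scaleR power2_eq_square divide_simps)
  qed simp
  note l = eig_min_pos[OF P]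
  show thesis
  \<comment> \<open>The decrease \<open>c * (norm X)\<^sup>2\<close> is at least
    \<open>c / eig_max P\<close> times the \<open>P\<close>-energy. Bounding \<open>1 - r\<close> by
    \<open>exp (- r)\<close> gives the contraction factor in exponential form.\<close>
  proof (rule that[of "c / eig_max P"])
    show "c / eig_max P > 0" using \<open>c > 0\<close> l by simp
    fix \<tau> X assume \<tau>: "\<tau> \<in> {Tm..TM}"
    let ?Y = "Phi \<tau> *v (?G *v X)"
    have "c / eig_max P * (X \<bullet> (P *v X)) \<le> c / eig_max P * (eig_max P * (norm X)\<^sup>2)"
      using \<open>c > 0\<close> l eig_bounds(2)[OF symP, of X] by (intro mult_left_mono) auto
    then have "?Y \<bullet> (P *v ?Y) \<le> (1 + - (c / eig_max P)) * (X \<bullet> (P *v X))"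
      using q[OF \<tau>, of X] l unfolding Xi_form by (simp add: algebra_simps)
    also have "\<dots> \<le> exp (- (c / eig_max P)) * (X \<bullet> (P *v X))"
    proof (rule mult_right_mono[OF exp_ge_add_one_self])
      have "0 \<le> eig_min P * (norm X)\<^sup>2" using l(1) by simp
      then show "0 \<le> X \<bullet> (P *v X)" using eig_bounds(1)[OF symP, of X] by linarith
    qed
    finally show "?Y \<bullet> (P *v ?Y) \<le> exp (- (c / eig_max P)) * (X \<bullet> (P *v X))" .
  qed
qed

section \<open>The closed-form flow\<close>

lemma bounded_bilinear_matrix_vector:
  "bounded_bilinear ((*v) :: real^'n^'m \<Rightarrow> real^'n \<Rightarrow> real^'m)"
  unfolding bilinear_conv_bounded_bilinear[symmetric] bilinear_def
  by (auto intro!: linearI simp: matrix_vector_right_distrib matrix_vector_mult_scaleR matrix_vector_mult_add_rdistrib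
      scaleR_matrix_vector_assoc)

lemma Phi_matrix: "Phi s = mat 1 + s *\<^sub>R A_mat + (s\<^sup>2 / 2) *\<^sub>R (A_mat ** A_mat)"
  unfolding matrix_eq
  by (simp add: Phi_vector matrix_vector_mult_add_rdistrib scaleR_matrix_vector_assoc[symmetric] matrix_vector_mul_assoc)

lemma has_vector_derivative_Phi_matrix:
  "((\<lambda>s. Phi (c - s)) has_vector_derivative - (A_mat + (c - s) *\<^sub>R (A_mat ** A_mat))) (at s)"
proof -
  have "((\<lambda>s. (c - s)\<^sup>2 / 2) has_vector_derivative - (c - s)) (at s)"
    unfolding has_real_derivative_iff_has_vector_derivative[symmetric]
    by (auto intro!: derivative_eq_intros)
  then have "((\<lambda>s. mat 1 + (c - s) *\<^sub>R A_mat + ((c - s)\<^sup>2 / 2) *\<^sub>R (A_mat ** A_mat)) has_vector_derivative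
      0 + (- 1) *\<^sub>R A_mat + (- (c - s)) *\<^sub>R (A_mat ** A_mat)) (at s)"
    by (intro has_vector_derivative_add has_vector_derivative_const
        bounded_linear.has_vector_derivative[OF bounded_linear_scaleR_left])
      (auto intro!: derivative_eq_intros)
  then show ?thesis unfolding Phi_matrix by (simp add: algebra_simps)
qed

text \<open>Rodrigues' formula solves the attitude equation because \<open>\<eta>\<close> is constant along the flow.\<close>

definition err_sol :: "real \<Rightarrow> err_state \<Rightarrow> err_state" where
  "err_sol s = (\<lambda>(R, \<eta>, X, \<tau>). (R ** rodrigues (- s) \<eta>, \<eta>, Phi s *v X, \<tau> - s))"

lemma err_sol_0 [simp]: "err_sol 0 z = z"
  by (cases z) (simp add: err_sol_def)

lemma has_vector_derivative_err_sol:
  "((\<lambda>s. err_sol s z) has_vector_derivative err_flow (err_sol s z)) (at s)"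
proof -
  obtain R \<eta> X \<tau> where z: "z = (R, \<eta>, X, \<tau>)" by (metis prod_cases4)
  have "((\<lambda>s. R ** rodrigues (- s) \<eta>) has_vector_derivative R ** rodrigues (- s) \<eta> ** skew (- \<eta>)) (at s)"
    using bounded_linear.has_vector_derivative[OF bounded_bilinear.bounded_linear_right[OF bilinear_mm, of R]
        has_vector_derivative_rodrigues_uminus[of \<eta> s]]
    by (simp add: skew_minus matrix_mult_uminus rodrigues_commute matrix_mul_assoc)
  then show ?thesis
    unfolding err_sol_def err_flow_def z case_prod_conv
    by (intro has_vector_derivative_Pair has_vector_derivative_Phi)
      (auto intro!: derivative_eq_intros)
qed

lemma abs_continuous_err_sol: "abs_continuous_on_interval a b (\<lambda>s. err_sol (s - c) z)"
proof (rule abs_continuous_C1)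
  show d: "((\<lambda>s. err_sol (s - c) z) has_vector_derivative err_flow (err_sol (t - c) z)) (at t)" for t
    using vector_diff_chain_at[of "\<lambda>s. s - c" 1 t "\<lambda>s. err_sol s z", OF _ has_vector_derivative_err_sol]
    by (simp add: o_def has_vector_derivative_diff_const has_vector_derivative_id)
  have c: "continuous_on UNIV (\<lambda>t. err_sol (t - c) z)"
    by (intro continuous_at_imp_continuous_on ballI has_vector_derivative_continuous[OF d])
  have lin: "linear (skew)"
    by (simp add: linear_iff skew_add skew_scaleR)
  show "continuous_on UNIV (\<lambda>t. err_flow (err_sol (t - c) z))"
    unfolding err_flow_def case_prod_unfold
    by (intro continuous_intros c bounded_bilinear.continuous_on[OF bilinear_mm]
       linear_continuous_on_compose[OF _ lin]
       bounded_linear.continuous_on[OF matrix_vector_mul_bounded_linear])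
qed

text \<open>Multiplying by the inverse flow turns the equation into a vanishing derivative.\<close>

lemma err_flow_unique:
  assumes ab: "a \<le> b" and ac: "abs_continuous_on_interval a b y"
    and der: "AE t in lebesgue. t \<in> {a<..<b} \<longrightarrow> (y has_vector_derivative err_flow (y t)) (at t)"
  shows "y b = err_sol (b - a) (y a)"
proof -
  define R \<eta> X \<tau> where "R = (\<lambda>s. fst (y s))" and "\<eta> = (\<lambda>s. fst (snd (y s)))"
    and "X = (\<lambda>s. fst (snd (snd (y s))))" and "\<tau> = (\<lambda>s. snd (snd (snd (y s))))"
  have y: "y s = (R s, \<eta> s, X s, \<tau> s)" for s by (simp add: R_def \<eta>_def X_def \<tau>_def)
  note f = bounded_linear.has_vector_derivative[OF bounded_linear_fst]
  note n = bounded_linear.has_vector_derivative[OF bounded_linear_snd]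
  have dR: "(R has_vector_derivative R t ** skew (- \<eta> t)) (at t)"
    and d\<eta>: "(\<eta> has_vector_derivative 0) (at t)" and dX: "(X has_vector_derivative A_mat *v X t) (at t)"
    and d\<tau>: "(\<tau> has_vector_derivative - 1) (at t)"
    if "(y has_vector_derivative err_flow (y t)) (at t)" for t
    using f[OF that] f[OF n[OF that]] f[OF n[OF n[OF that]]] n[OF n[OF n[OF that]]]
    by (simp_all add: y err_flow_def)
  have acR: "abs_continuous_on_interval a b R" and ac\<eta>: "abs_continuous_on_interval a b \<eta>"
    and acX: "abs_continuous_on_interval a b X" and ac\<tau>: "abs_continuous_on_interval a b \<tau>"
  proof -
    have "dist (R s) (R t) \<le> dist (y s) (y t)" "dist (\<eta> s) (\<eta> t) \<le> dist (y s) (y t)"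
      "dist (X s) (X t) \<le> dist (y s) (y t)" "dist (\<tau> s) (\<tau> t) \<le> dist (y s) (y t)" for s t
      unfolding R_def \<eta>_def X_def \<tau>_def by (meson dist_fst_le dist_snd_le order_trans)+
    then have "dist (R s) (R t) \<le> 1 * (dist (y s) (y t) + (t - s))" "dist (\<eta> s) (\<eta> t) \<le> 1 * (dist (y s) (y t) + (t - s))"
      "dist (X s) (X t) \<le> 1 * (dist (y s) (y t) + (t - s))" "dist (\<tau> s) (\<tau> t) \<le> 1 * (dist (y s) (y t) + (t - s))"
      if "s \<le> t" for s t using that by (simp_all add: add_increasing2)
    then show "abs_continuous_on_interval a b R" "abs_continuous_on_interval a b \<eta>"
      "abs_continuous_on_interval a b X" "abs_continuous_on_interval a b \<tau>"
      by (auto intro: abs_continuous_dominated[OF ac zero_less_one])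
  qed
  \<comment> \<open>This comes first: with a constant axis the inverse attitude flow is an explicit
    one-parameter subgroup.\<close>
  have const\<eta>: "\<eta> t = \<eta> a" if t: "t \<in> {a..b}" for t
  proof (rule abs_continuous_zero_derivative_const)
    show "a \<le> t" using t by simp
    show "abs_continuous_on_interval a t \<eta>" by (rule abs_continuous_subinterval[OF ac\<eta>]) (use t in auto)
    show "AE s in lebesgue. s \<in> {a<..<t} \<longrightarrow> (\<eta> has_vector_derivative 0) (at s)"
      using der by (rule AE_mp) (use t d\<eta> in \<open>auto intro!: AE_I2\<close>)
  qed
  have "\<tau> b + b = \<tau> a + a"
  proof (rule abs_continuous_zero_derivative_const[OF ab, of "\<lambda>t. \<tau> t + t"])
    show "abs_continuous_on_interval a b (\<lambda>t. \<tau> t + t)"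
      by (rule abs_continuous_dominated[OF ac\<tau> zero_less_one]) (auto simp: dist_real_def)
    show "AE t in lebesgue. t \<in> {a<..<b} \<longrightarrow> ((\<lambda>t. \<tau> t + t) has_vector_derivative 0) (at t)"
      using der by (rule AE_mp) (auto intro!: AE_I2 derivative_eq_intros d\<tau>)
  qed
  moreover have "Phi (a - b) *v X b = Phi (a - a) *v X a"
  proof (rule abs_continuous_zero_derivative_const[OF ab, of "\<lambda>t. Phi (a - t) *v X t"])
    have "abs_continuous_on_interval a b (\<lambda>t. Phi (a - t))"
      by (rule abs_continuous_C1[OF has_vector_derivative_Phi_matrix]) (intro continuous_intros)
    then show "abs_continuous_on_interval a b (\<lambda>t. Phi (a - t) *v X t)"
      by (rule abs_continuous_bilinear[OF bounded_bilinear_matrix_vector _ acX])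
    have "((\<lambda>t. Phi (a - t) *v X t) has_vector_derivative 0) (at t)"
      if "(y has_vector_derivative err_flow (y t)) (at t)" for t
    proof -
      have neg: "(- B) *v v = - (B *v v)" for B :: mat9 and v by (simp add: vec_eq_iff matrix_vector_mult_def sum_negf)
      show ?thesis
        using bounded_bilinear.has_vector_derivative[OF bounded_bilinear_matrix_vector
            has_vector_derivative_Phi_matrix[of a t] dX[OF that]]
        unfolding neg matrix_vector_mult_add_rdistrib
        by (simp add: Phi_vector scaleR_matrix_vector_assoc[symmetric] matrix_vector_mul_assoc[symmetric] A_mat_cubed)
    qed
    then show "AE t in lebesgue. t \<in> {a<..<b} \<longrightarrow> ((\<lambda>t. Phi (a - t) *v X t) has_vector_derivative 0) (at t)"
      by - (rule AE_mp[OF der], rule AE_I2, blast)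
  qed
  then have "Phi (b - a) *v (Phi (a - b) *v X b) = Phi (b - a) *v X a" by simp
  then have "X b = Phi (b - a) *v X a" unfolding Phi_add by simp
  \<comment> \<open>The equation multiplies \<open>R\<close> on the right by
    \<open>skew (- \<eta>)\<close>, so the inverse flow also has to be applied on the right.\<close>
  moreover have "R b ** rodrigues (b - a) (\<eta> a) = R a ** rodrigues (a - a) (\<eta> a)"
  proof (rule abs_continuous_zero_derivative_const[OF ab, of "\<lambda>t. R t ** rodrigues (t - a) (\<eta> a)"])
    have d: "((\<lambda>t. rodrigues (t - a) w) has_vector_derivative skew w ** rodrigues (t - a) w) (at t)" for t w
      using vector_diff_chain_at[of "\<lambda>s. s - a" 1 t "\<lambda>s. rodrigues s w", OF _ has_vector_derivative_rodrigues]
      by (simp add: o_def has_vector_derivative_diff_const has_vector_derivative_id)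
    have "continuous_on UNIV (\<lambda>t. rodrigues (t - a) w)" for w
      by (intro continuous_at_imp_continuous_on ballI has_vector_derivative_continuous[OF d])
    then have "abs_continuous_on_interval a b (\<lambda>t. rodrigues (t - a) (\<eta> a))"
      by (intro abs_continuous_C1[OF d] bounded_bilinear.continuous_on[OF bilinear_mm] continuous_on_const)
    then show "abs_continuous_on_interval a b (\<lambda>t. R t ** rodrigues (t - a) (\<eta> a))"
      by (rule abs_continuous_bilinear[OF bilinear_mm acR])
    have zero: "((\<lambda>t. R t ** rodrigues (t - a) (\<eta> a)) has_vector_derivative 0) (at t)"
      if "(y has_vector_derivative err_flow (y t)) (at t)" "t \<in> {a<..<b}" for t
    proof -
      have "\<eta> t = \<eta> a" by (rule const\<eta>) (use that in auto)
      then show ?thesis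
        using bounded_bilinear.has_vector_derivative[OF bilinear_mm dR[OF that(1)] d[of "\<eta> a" t]]
        by (simp add: skew_minus matrix_mult_uminus matrix_mul_assoc)
    qed
    show "AE t in lebesgue. t \<in> {a<..<b} \<longrightarrow> ((\<lambda>t. R t ** rodrigues (t - a) (\<eta> a)) has_vector_derivative 0) (at t)"
    proof (rule AE_mp[OF der], rule AE_I2, intro impI)
      fix t assume "t \<in> {a<..<b} \<longrightarrow> (y has_vector_derivative err_flow (y t)) (at t)" "t \<in> {a<..<b}"
      then show "((\<lambda>t. R t ** rodrigues (t - a) (\<eta> a)) has_vector_derivative 0) (at t)"
        by (intro zero[OF mp])
    qed
  qed
  then have "(R b ** rodrigues (b - a) (\<eta> a)) ** rodrigues (- (b - a)) (\<eta> a) = R a ** rodrigues (- (b - a)) (\<eta> a)"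
    by simp
  then have "R b = R a ** rodrigues (- (b - a)) (\<eta> a)"
    unfolding matrix_mul_assoc[symmetric] rodrigues_cancel by simp
  ultimately show ?thesis using const\<eta>[of b] ab by (simp add: y err_sol_def)
qed

section \<open>Sampling and extending solutions\<close>

lemma hybrid_time_domain_cases:
  assumes "hybrid_time_domain E"
  obtains (inf) ts where "ts 0 = 0" "\<forall>j. ts j \<le> ts (Suc j)" "E = (\<Union>j. {ts j..ts (Suc j)} \<times> {j})"
    | (fin) ts J I where "ts 0 = 0" "\<forall>j<J. ts j \<le> ts (Suc j)"
      "(\<exists>T\<ge>ts J. I = {ts J..T}) \<or> (\<exists>T>ts J. I = {ts J..<T}) \<or> I = {ts J..}"
      "E = (\<Union>j<J. {ts j..ts (Suc j)} \<times> {j}) \<union> I \<times> {J}"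
  using assms[unfolded hybrid_time_domain_def]
proof (rule disjE, goal_cases)
  case 1
  then show ?case by (elim exE conjE) (rule that(1))
next
  case 2
  then show ?case by (elim exE conjE) (rule that(2))
qed

text \<open>Replacing the jump instant after the \<open>j\<close>-th interval by the current time
  \<open>t\<close> gives one finite description of the past, valid for all forms of hybrid time
  domain.\<close>

lemma hybrid_time_domain_chain:
  assumes E: "hybrid_time_domain E" and tj: "(t, j) \<in> E"
  obtains u where "u 0 = 0" "u (Suc j) = t"
    "\<And>i. i \<le> j \<Longrightarrow> u i \<le> u (Suc i) \<and> {u i..u (Suc i)} \<times> {i} \<subseteq> E"
proof -
  show thesis
    using E
  proof (cases rule: hybrid_time_domain_cases)
    case (inf ts)
    show ?thesis
      by (rule that[of "\<lambda>i. if i \<le> j then ts i else t"]) (use inf tj in \<open>auto simp: not_less_eq_eq dest: le_antisym\<close>)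
  next
    case (fin ts J I)
    have "j \<le> J" using tj unfolding fin(4) by auto
    show ?thesis
    proof (rule that[of "\<lambda>i. if i \<le> j then ts i else t"])
      fix i assume "i \<le> j"
      show "(if i \<le> j then ts i else t) \<le> (if Suc i \<le> j then ts (Suc i) else t) \<and>
        {if i \<le> j then ts i else t..if Suc i \<le> j then ts (Suc i) else t} \<times> {i} \<subseteq> E"
      proof (cases "i < J")
        case True
        then show ?thesis using fin(2) tj \<open>i \<le> j\<close> \<open>j \<le> J\<close> unfolding fin(4) by (auto simp: Suc_le_eq)
      next
        case False
        then have "i = j" "j = J" using \<open>i \<le> j\<close> \<open>j \<le> J\<close> by auto
        then have "t \<in> I" using tj unfolding fin(4) by auto
        then have "ts J \<le> t" "{ts J..t} \<subseteq> I" using fin(3) by auto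
        then show ?thesis using \<open>i = j\<close> \<open>j = J\<close> unfolding fin(4) by auto
      qed
    qed (use fin in auto)
  qed
qed

lemma closed_rotation_matrices: "closed {R :: real^3^3. rotation_matrix R}"
proof -
  have c: "continuous_on UNIV (\<lambda>R :: real^3^3. transpose R ** R)"
    by (intro bounded_bilinear.continuous_on[OF bilinear_mm] continuous_on_id
        bounded_linear.continuous_on[OF linear_tr])
  have d: "continuous_on UNIV (\<lambda>R :: real^3^3. det R)"
    unfolding det_3 by (intro continuous_intros)
  have "{R :: real^3^3. rotation_matrix R} = {R. transpose R ** R = mat 1} \<inter> {R. det R = 1}"
    by (auto simp: rotation_matrix_def orthogonal_matrix)
  then show ?thesis
    by (auto intro!: closed_Int closed_Collect_eq c d continuous_on_const)
qed

text \<open>The definition of a solution only places the initial state in the closure of the flow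
  set or in the jump set; closedness recovers a genuine rotation and a timer in range.\<close>

lemma closed_err_flow_set: "closed (err_flow_set TM)"
proof -
  have "err_flow_set TM = {R. rotation_matrix R} \<times> UNIV \<times> UNIV \<times> {0..TM}"
    by (auto simp: err_flow_set_def)
  then show ?thesis by (simp add: closed_Times closed_rotation_matrices)
qed

lemma err_sol_rotation: "rotation_matrix (fst z) \<Longrightarrow> rotation_matrix (fst (err_sol s z))"
  by (cases z) (simp add: err_sol_def rotation_matrix_mult rotation_matrix_rodrigues)

text \<open>Maximality is not assumed: the sampled recursion holds for every solution. Maximality
  enters in the completeness argument, which contradicts it by an extension.\<close>

locale err_solution =
  fixes M :: "real^3^3" and kR kp kv kg Tm TM :: real and E :: "(real \<times> nat) set" and x :: "real \<Rightarrow> nat \<Rightarrow> err_state"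
  assumes sol: "hybrid_solution (err_flow_set TM) err_flow err_jump_set (err_jump M kR kp kv kg Tm TM) E x"
    and Tm: "0 < Tm" "Tm \<le> TM"
begin

abbreviation "timer z \<equiv> snd (snd (snd z)) :: real"

lemma initial: "rotation_matrix (fst (x 0 0))" "timer (x 0 0) \<in> {0..TM}"
proof -
  have "x 0 0 \<in> err_flow_set TM \<union> err_jump_set"
    using sol unfolding hybrid_solution_def closure_closed[OF closed_err_flow_set] by blast
  then show "rotation_matrix (fst (x 0 0))" "timer (x 0 0) \<in> {0..TM}"
    using Tm by (auto simp: err_flow_set_def err_jump_set_def)
qed

lemma flow:
  assumes ab: "a \<le> b" and sub: "{a..b} \<times> {j} \<subseteq> E"
  shows "x b j = err_sol (b - a) (x a j)"
proof -
  have sl: "{a..b} \<subseteq> slice E j" using sub by (auto simp: slice_def)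
  then have "abs_continuous_on_interval a b (\<lambda>t. x t j)"
    using sol unfolding hybrid_solution_def locally_abs_continuous_on_def by blast
  moreover have int: "{a<..<b} \<subseteq> interior (slice E j)"
    using sl by (intro interior_maximal) auto
  have der: "AE t in lebesgue. t \<in> interior (slice E j) \<longrightarrow> ((\<lambda>s. x s j) has_vector_derivative err_flow (x t j)) (at t)"
    using sol unfolding hybrid_solution_def by blast
  have "AE t in lebesgue. t \<in> {a<..<b} \<longrightarrow> ((\<lambda>s. x s j) has_vector_derivative err_flow (x t j)) (at t)"
    by (rule AE_mp[OF der], rule AE_I2) (use int in blast)
  ultimately show ?thesis by (rule err_flow_unique[OF ab])
qed

lemma flow_duration:
  assumes ab: "a \<le> b" and sub: "{a..b} \<times> {j} \<subseteq> E" and \<tau>: "0 \<le> timer (x a j)"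
  shows "b - a \<le> timer (x a j)"
proof (rule ccontr)
  let ?\<tau> = "timer (x a j)"
  assume "\<not> ?thesis"
  then have lt: "a + ?\<tau> < b" by simp
  \<comment> \<open>Membership in the flow set is guaranteed only in the interior of the interval,
    so the contradiction uses a point strictly between the expiry of the timer and
    \<open>b\<close>.\<close>
  define t where "t = (a + ?\<tau> + b) / 2"
  have t: "a + ?\<tau> < t" "t < b" "a < t" using lt \<tau> by (auto simp: t_def)
  have "{a<..<b} \<subseteq> interior (slice E j)"
    using sub by (intro interior_maximal) (auto simp: slice_def)
  then have "x t j \<in> err_flow_set TM"
    using t sol unfolding hybrid_solution_def by auto
  moreover have "x t j = err_sol (t - a) (x a j)"
    using t sub by (intro flow) auto
  then have "timer (x t j) = ?\<tau> - (t - a)"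
    by (cases "x a j") (simp add: err_sol_def)
  ultimately show False using t(1) by (auto simp: err_flow_set_def)
qed

lemma jump:
  assumes "(t, j) \<in> E" "(t, Suc j) \<in> E"
  shows "timer (x t j) = 0" "rotation_matrix (fst (x t j))"
    "x t (Suc j) \<in> err_jump M kR kp kv kg Tm TM (x t j)"
proof -
  have "x t j \<in> err_jump_set" "x t (Suc j) \<in> err_jump M kR kp kv kg Tm TM (x t j)"
    using sol assms unfolding hybrid_solution_def by blast+
  then show "timer (x t j) = 0" "rotation_matrix (fst (x t j))"
    "x t (Suc j) \<in> err_jump M kR kp kv kg Tm TM (x t j)"
    by (auto simp: err_jump_set_def)
qed

text \<open>\<open>h i\<close> is the duration of the \<open>i\<close>-th interval of flow, truncated at the current time for \<open>i = j\<close>.\<close>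

lemma sampled:
  assumes tj: "(t, j) \<in> E"
  obtains z :: "nat \<Rightarrow> err_state" and h :: "nat \<Rightarrow> real" where
    "z 0 = x 0 0" "x t j = err_sol (h j) (z j)"
    "\<And>i. i < j \<Longrightarrow> z (Suc i) \<in> err_jump M kR kp kv kg Tm TM (err_sol (h i) (z i))"
    "\<And>i. i \<le> j \<Longrightarrow> rotation_matrix (fst (z i))"
    "\<And>i. i \<le> j \<Longrightarrow> timer (z i) \<in> {0..TM}"
    "\<And>i. i \<le> j \<Longrightarrow> h i \<in> {0..TM}" "\<And>i. 1 \<le> i \<Longrightarrow> i < j \<Longrightarrow> h i \<in> {Tm..TM}"
    "h j \<le> timer (z j)" "t \<le> real (Suc j) * TM"
proof -
  have dom: "hybrid_time_domain E" using sol by (simp add: hybrid_solution_def)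
  obtain u where u: "u 0 = 0" "u (Suc j) = t"
    "\<And>i. i \<le> j \<Longrightarrow> u i \<le> u (Suc i) \<and> {u i..u (Suc i)} \<times> {i} \<subseteq> E"
    using hybrid_time_domain_chain[OF dom tj] by metis
  define z where "z = (\<lambda>i. x (u i) i)"
  define h where "h = (\<lambda>i. u (Suc i) - u i)"
  have end_eq: "x (u (Suc i)) i = err_sol (h i) (z i)" if "i \<le> j" for i
    unfolding z_def h_def using u(3)[OF that] by (intro flow) auto
  have mem: "(u i, i) \<in> E" "(u (Suc i), i) \<in> E" if "i \<le> j" for i using u(3)[OF that] by auto
  have jmp: "timer (err_sol (h i) (z i)) = 0" "rotation_matrix (fst (err_sol (h i) (z i)))"
    "z (Suc i) \<in> err_jump M kR kp kv kg Tm TM (err_sol (h i) (z i))" if "i < j" for i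
  proof -
    have "(u (Suc i), i) \<in> E" "(u (Suc i), Suc i) \<in> E" using mem that by auto
    note j = jump[OF this, unfolded end_eq[OF less_imp_le[OF that]]]
    then show "timer (err_sol (h i) (z i)) = 0" "rotation_matrix (fst (err_sol (h i) (z i)))"
      "z (Suc i) \<in> err_jump M kR kp kv kg Tm TM (err_sol (h i) (z i))" by (simp_all add: z_def)
  qed
  \<comment> \<open>The lower bound \<open>Tm\<close> is created by a jump, hence the exception for
    index 0, where the timer is initial.\<close>
  have inv: "rotation_matrix (fst (z i)) \<and> timer (z i) \<in> {0..TM} \<and> (i \<noteq> 0 \<longrightarrow> Tm \<le> timer (z i))" if "i \<le> j" for i
  proof (cases i)
    case 0
    then show ?thesis using initial u(1) by (simp add: z_def)
  next
    case (Suc l)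
    then have "l < j" using that by simp
    obtain R \<eta> X \<tau> where e: "err_sol (h l) (z l) = (R, \<eta>, X, \<tau>)" by (metis prod_cases4)
    from jmp(2,3)[OF \<open>l < j\<close>] show ?thesis using Tm by (auto simp: Suc e err_jump_def)
  qed
  have dur: "0 \<le> h i" "h i \<le> timer (z i)" if "i \<le> j" for i
    unfolding z_def h_def using u(3)[OF that] inv[OF that] by (auto intro!: flow_duration simp: z_def)
  \<comment> \<open>An interval that ends in a jump runs the timer down to exactly 0, so its length
    inherits the bounds of the timer at its start.\<close>
  have hz: "h i = timer (z i)" if "i < j" for i
    using jmp(1)[OF that] by (cases "z i") (simp add: err_sol_def)
  have "u i \<le> real i * TM" if "i \<le> Suc j" for i
    using that
  proof (induction i)
    case (Suc i)
    have "h i \<le> TM" using dur(2)[of i] inv[of i] Suc.prems by auto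
    then have "u (Suc i) \<le> u i + TM" by (simp add: h_def)
    then show ?case using Suc by (simp add: distrib_right)
  qed (simp add: u)
  from this[of "Suc j"] have "t \<le> real (Suc j) * TM" using u(2) by simp
  then show thesis
  proof (intro that[of z h])
    show "z 0 = x 0 0" by (simp add: z_def u)
    show "x t j = err_sol (h j) (z j)" using end_eq[of j] u(2) by simp
    show "h i \<in> {0..TM}" if "i \<le> j" for i using dur[OF that] inv[OF that] by auto
    show "h i \<in> {Tm..TM}" if "1 \<le> i" "i < j" for i using hz[OF that(2)] inv[of i] that by auto
  qed (use jmp inv dur in auto)
qed

end

section \<open>Extension of solutions and completeness\<close>

context err_solution
begin

lemma flow_from_start:
  assumes E: "(t0, j) \<in> E" and sub: "{t0..t} \<times> {j} \<subseteq> E" and t: "t0 \<le> t"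
  shows "x t j = err_sol (t - t0) (x t0 j)" "t \<le> t0 + timer (x t0 j)"
    "rotation_matrix (fst (x t0 j))" "timer (x t0 j) \<in> {0..TM}"
proof -
  show "x t j = err_sol (t - t0) (x t0 j)" using flow[OF t sub] .
  obtain z :: "nat \<Rightarrow> err_state" and h :: "nat \<Rightarrow> real" where z: "x t0 j = err_sol (h j) (z j)"
    "\<And>i. i \<le> j \<Longrightarrow> rotation_matrix (fst (z i))" "\<And>i. i \<le> j \<Longrightarrow> timer (z i) \<in> {0..TM}"
    "\<And>i. i \<le> j \<Longrightarrow> h i \<in> {0..TM}" "h j \<le> timer (z j)"
    using sampled[OF E] by metis
  show "rotation_matrix (fst (x t0 j))" unfolding z(1) by (intro err_sol_rotation z(2)) simp
  show tm: "timer (x t0 j) \<in> {0..TM}"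
    using z(3)[of j] z(4)[of j] z(5) by (cases "z j") (auto simp: z(1) err_sol_def)
  show "t \<le> t0 + timer (x t0 j)" using flow_duration[OF t sub] tm by simp
qed

text \<open>A solution whose last interval of flow is bounded can be extended: let it flow until the
  timer vanishes and jump once.\<close>

lemma not_maximal_if_bounded:
  assumes ts: "ts 0 = 0" "\<forall>j<J. ts j \<le> ts (Suc j)" and I: "(\<exists>T\<ge>ts J. I = {ts J..T}) \<or> (\<exists>T>ts J. I = {ts J..<T})"
    and Eeq: "E = (\<Union>j<J. {ts j..ts (Suc j)} \<times> {j}) \<union> I \<times> {J}"
  obtains E' x' where "hybrid_solution (err_flow_set TM) err_flow err_jump_set (err_jump M kR kp kv kg Tm TM) E' x'"
    "E \<subseteq> E'" "\<forall>(t, j)\<in>E. x' t j = x t j" "E' \<noteq> E"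
proof -
  define y where "y = x (ts J) J"
  define s where "s = ts J + timer y"
  obtain R \<eta> X \<tau> where y: "y = (R, \<eta>, X, \<tau>)" by (metis prod_cases4)
  \<comment> \<open>The state after the added jump; among the admissible new timer values
    \<open>TM\<close> is picked.\<close>
  define Y :: err_state where "Y = (R ** rodrigues (- \<tau>) \<eta>, kR *\<^sub>R psi (M ** (R ** rodrigues (- \<tau>) \<eta>)),
    Ag_mat kp kv kg *v (Phi \<tau> *v X), TM)"
  have I0: "ts J \<in> I" using I by auto
  then have start: "(ts J, J) \<in> E" unfolding Eeq by auto
  have subI: "{ts J..t} \<times> {J} \<subseteq> E" "ts J \<le> t" if "t \<in> I" for t
    using that I unfolding Eeq by auto
  have fl: "x t J = err_sol (t - ts J) y" "t \<le> s" if "t \<in> I" for t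
    using flow_from_start(1,2)[OF start subI(1)[OF that] subI(2)[OF that]] by (simp_all add: y_def s_def)
  have rot: "rotation_matrix R" and tim: "0 \<le> \<tau>" "\<tau> \<le> TM"
    using flow_from_start(3,4)[OF start subI(1)[OF I0]] by (auto simp: y y_def[symmetric])
  have s: "s = ts J + \<tau>" by (simp add: s_def y)
  define ts' where "ts' = (\<lambda>i. if i \<le> J then ts i else s)"
  \<comment> \<open>The single point after the jump is enough for a proper extension, even if the
    old domain already reached \<open>s\<close>. Its slice has empty interior, so it carries no flow
    condition.\<close>
  define E' where "E' = (\<Union>j<Suc J. {ts' j..ts' (Suc j)} \<times> {j}) \<union> {s..s} \<times> {Suc J}"
  define x' where "x' = (\<lambda>t i. if i < J then x t i else if i = J then err_sol (t - ts J) y else Y)"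
  have mono: "ts' j \<le> ts' (Suc j)" if "j < Suc J" for j
    using ts(2) that tim by (auto simp: ts'_def s less_Suc_eq)
  have slE': "slice E' j = (if j < J then {ts j..ts (Suc j)} else if j = J then {ts J..s} else if j = Suc J then {s} else {})" for j
    unfolding slice_def E'_def ts'_def by auto
  have slE: "slice E j = {ts j..ts (Suc j)}" if "j < J" for j
    using that unfolding slice_def Eeq by auto
  have memE': "(t, j) \<in> E' \<longleftrightarrow> t \<in> slice E' j" for t j by (simp add: slice_def)
  have sE: "\<And>j. locally_abs_continuous_on (slice E j) (\<lambda>t. x t j)"
    "\<And>j t. t \<in> interior (slice E j) \<Longrightarrow> x t j \<in> err_flow_set TM"
    "\<And>j. AE t in lebesgue. t \<in> interior (slice E j) \<longrightarrow> ((\<lambda>s. x s j) has_vector_derivative err_flow (x t j)) (at t)"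
    "\<And>t j. (t, j) \<in> E \<Longrightarrow> (t, Suc j) \<in> E \<Longrightarrow> x t j \<in> err_jump_set \<and> x t (Suc j) \<in> err_jump M kR kp kv kg Tm TM (x t j)"
    using sol unfolding hybrid_solution_def by blast+
  have x00: "x' 0 0 = x 0 0"
    using ts(1) by (auto simp: x'_def y_def)
  have "hybrid_solution (err_flow_set TM) err_flow err_jump_set (err_jump M kR kp kv kg Tm TM) E' x'"
    unfolding hybrid_solution_def
  proof (intro conjI allI ballI)
    show "hybrid_time_domain E'"
      unfolding hybrid_time_domain_def
    proof (rule disjI2, rule exI[of _ ts'], rule exI[of _ "Suc J"], rule exI[of _ "{s..s}"], intro conjI)
      show "ts' 0 = 0" using ts(1) by (simp add: ts'_def)
      show "\<forall>j<Suc J. ts' j \<le> ts' (Suc j)" using mono by blast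
      show "(\<exists>T\<ge>ts' (Suc J). {s..s} = {ts' (Suc J)..T}) \<or> (\<exists>T>ts' (Suc J). {s..s} = {ts' (Suc J)..<T}) \<or> {s..s} = {ts' (Suc J)..}"
        by (rule disjI1) (auto simp: ts'_def)
    qed (simp add: E'_def)
    show "x' 0 0 \<in> closure (err_flow_set TM) \<union> err_jump_set"
      using sol unfolding x00 hybrid_solution_def by blast
  next
    fix j
    show "locally_abs_continuous_on (slice E' j) (\<lambda>t. x' t j)"
    proof (cases "j < J")
      case True
      then show ?thesis using sE(1)[of j] by (simp add: slE slE' x'_def)
    next
      case False
      show ?thesis unfolding locally_abs_continuous_on_def
      proof (intro allI impI)
        fix a b
        have "abs_continuous_on_interval a b (\<lambda>t. Y)"
          by (rule abs_continuous_lipschitz[where K = 0]) simp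
        then show "abs_continuous_on_interval a b (\<lambda>t. x' t j)"
          using False abs_continuous_err_sol[of a b "ts J" y] by (cases "j = J") (simp_all add: x'_def)
      qed
    qed
    show "x' t j \<in> err_flow_set TM" if "t \<in> interior (slice E' j)" for t
    proof -
      consider "j < J" | "j = J" | "j > J" by linarith
      then show ?thesis
      proof cases
        case 1
        then show ?thesis using sE(2)[of t j] that by (simp add: slE slE' x'_def)
      next
        case 2
        then have "t \<in> {ts J<..<s}" using that by (simp add: slE')
        then have "0 \<le> \<tau> - (t - ts J)" "\<tau> - (t - ts J) \<le> TM" using tim s by auto
        then show ?thesis using 2 rot
          by (simp add: x'_def err_sol_def y err_flow_set_def rotation_matrix_mult rotation_matrix_rodrigues)
      next
        case 3
        then show ?thesis using that by (simp add: slE' split: if_splits)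
      qed
    qed
    show "AE t in lebesgue. t \<in> interior (slice E' j) \<longrightarrow> ((\<lambda>s. x' s j) has_vector_derivative err_flow (x' t j)) (at t)"
    proof -
      consider "j < J" | "j = J" | "j > J" by linarith
      then show ?thesis
      proof cases
        case 1
        then show ?thesis using sE(3)[of j] by (simp add: slE slE' x'_def)
      next
        case 2
        have "((\<lambda>t. err_sol (t - ts J) y) has_vector_derivative err_flow (err_sol (t - ts J) y)) (at t)" for t
          using vector_diff_chain_at[of "\<lambda>t. t - ts J" 1 t "\<lambda>s. err_sol s y", OF _ has_vector_derivative_err_sol]
          by (simp add: o_def has_vector_derivative_diff_const has_vector_derivative_id)
        then show ?thesis using 2 by (simp add: x'_def)
      next
        case 3
        then show ?thesis by (simp add: slE')
      qed
    qed
  next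
    fix t j
    have "x' t j \<in> err_jump_set \<and> x' t (Suc j) \<in> err_jump M kR kp kv kg Tm TM (x' t j)"
      if "(t, j) \<in> E'" "(t, Suc j) \<in> E'"
    proof -
      have jJ: "j \<le> J" using that(2) by (auto simp: memE' slE' split: if_splits)
      consider "Suc j < J" | "Suc j = J" | "j = J" using jJ by linarith
      then show ?thesis
      proof cases
        case 1
        then have "(t, j) \<in> E" "(t, Suc j) \<in> E" using that unfolding memE' Eeq by (auto simp: slE')
        then show ?thesis using sE(4) 1 by (simp add: x'_def)
      next
        case 2
        then have t: "t = ts J" using that unfolding memE' by (auto simp: slE')
        have "(t, j) \<in> E" using that 2 unfolding memE' Eeq by (auto simp: slE')
        moreover have "(t, Suc j) \<in> E" using start t 2 by simp
        ultimately show ?thesis using sE(4) 2 t by (auto simp: x'_def y_def)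
      next
        case 3
        then have "t = s" using that unfolding memE' by (auto simp: slE')
        then show ?thesis using 3 rot Tm
          by (simp add: x'_def s y err_sol_def Y_def err_jump_set_def err_jump_def rotation_matrix_mult rotation_matrix_rodrigues)
      qed
    qed
    then show "(t, j) \<in> E' \<and> (t, Suc j) \<in> E' \<longrightarrow>
        x' t j \<in> err_jump_set \<and> x' t (Suc j) \<in> err_jump M kR kp kv kg Tm TM (x' t j)" by blast
  qed
  moreover have "E \<subseteq> E'"
  proof
    fix w assume "w \<in> E"
    then obtain t j where w: "w = (t, j)" "j < J \<and> t \<in> {ts j..ts (Suc j)} \<or> j = J \<and> t \<in> I"
      unfolding Eeq by auto
    then show "w \<in> E'" using fl(2) subI(2) by (auto simp: memE' slE')
  qed
  moreover have "\<forall>(t, j)\<in>E. x' t j = x t j"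
    using fl(1) unfolding Eeq by (auto simp: x'_def)
  moreover have "(s, Suc J) \<in> E'" "(s, Suc J) \<notin> E"
    by (auto simp: memE' slE' Eeq)
  ultimately show thesis by (intro that) auto
qed

text \<open>A bounded domain has neither infinitely many jumps nor an unbounded last interval. Both
  remaining shapes of the last interval, closed and half-open, admit an extension.\<close>

lemma maximal_imp_complete:
  assumes max: "maximal_hybrid_solution (err_flow_set TM) err_flow err_jump_set (err_jump M kR kp kv kg Tm TM) E x"
  shows "complete_domain E"
  unfolding complete_domain_def
proof
  assume "bounded ((\<lambda>(t, j). (t, real j)) ` E)"
  then obtain B where "\<forall>w \<in> (\<lambda>(t, j). (t, real j)) ` E. norm w \<le> B" unfolding bounded_iff by blast
  then have nB: "norm (t, real j) \<le> B" if "(t, j) \<in> E" for t j using that by force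
  have B: "t \<le> B" "real j \<le> B" if "(t, j) \<in> E" for t j
    using nB[OF that] norm_fst_le[of t "real j"] norm_snd_le[of "real j" t] by auto
  have "hybrid_time_domain E" using sol by (simp add: hybrid_solution_def)
  then show False
  proof (cases rule: hybrid_time_domain_cases)
    case (inf ts)
    obtain j where "B < real j" using reals_Archimedean2 by blast
    moreover have "(ts j, j) \<in> E" using inf(2) unfolding inf(3) by auto
    ultimately show False using B(2) by fastforce
  next
    case (fin ts J I)
    have "(\<exists>T\<ge>ts J. I = {ts J..T}) \<or> (\<exists>T>ts J. I = {ts J..<T})"
    proof (rule ccontr)
      assume "\<not> ?thesis"
      then have "I = {ts J..}" using fin(3) by blast
      then have "(max (ts J) (B + 1), J) \<in> E" unfolding fin(4) by auto
      then show False using B(1) by fastforce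
    qed
    then show False
    proof (rule not_maximal_if_bounded[OF fin(1,2) _ fin(4)])
      fix E' x'
      assume "hybrid_solution (err_flow_set TM) err_flow err_jump_set (err_jump M kR kp kv kg Tm TM) E' x'"
        "E \<subseteq> E'" "\<forall>(t, j)\<in>E. x' t j = x t j"
      then have "E' = E"
        using max[unfolded maximal_hybrid_solution_def, THEN conjunct2, THEN spec, THEN spec, THEN mp] by blast
      moreover assume "E' \<noteq> E"
      ultimately show False by simp
    qed
  qed
qed

end

section \<open>Decay at the sampling instants\<close>

text \<open>The energy level forces \<open>rot_dist R \<le> d\<close>, which bounds the factor
  \<open>1 - (rot_dist R)\<^sup>2\<close> of \<open>norm_psi_lower\<close> away from 0; the upper
  energy bound then replaces the distance by the energy.\<close>

lemma rot_energy_contraction: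
  assumes M: "transpose M = M" "positive_definite (bar_matrix M)" and R: "rotation_matrix R"
    and d: "0 \<le> d" "d < 1" and e: "rot_energy M R \<le> eig_min (bar_matrix M) * d\<^sup>2"
  shows "4 * (1 - d\<^sup>2) * (eig_min (bar_matrix M))\<^sup>2 / eig_max (bar_matrix M) * rot_energy M R \<le> (norm (psi (M ** R)))\<^sup>2"
proof -
  let ?l = "eig_min (bar_matrix M)" and ?L = "eig_max (bar_matrix M)"
  note l = eig_min_pos[OF M(2)]
  note b = rot_energy_bounds[OF M R]
  have "?l * (rot_dist R)\<^sup>2 \<le> ?l * d\<^sup>2" using b(1) e by linarith
  then have r: "(rot_dist R)\<^sup>2 \<le> d\<^sup>2" using l(1) by simp
  have d1: "d\<^sup>2 < 1" using d by (simp add: power_less_one_iff)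
  have "4 * (1 - d\<^sup>2) * ?l\<^sup>2 / ?L * rot_energy M R \<le> 4 * (1 - d\<^sup>2) * ?l\<^sup>2 / ?L * (?L * (rot_dist R)\<^sup>2)"
    using b(2) d1 l by (intro mult_left_mono) auto
  also have "\<dots> = 4 * (1 - d\<^sup>2) * ?l\<^sup>2 * (rot_dist R)\<^sup>2" using l by simp
  also have "\<dots> \<le> 4 * (1 - (rot_dist R)\<^sup>2) * ?l\<^sup>2 * (rot_dist R)\<^sup>2"
    using r by (intro mult_right_mono mult_left_mono) auto
  also have "\<dots> \<le> (norm (psi (M ** R)))\<^sup>2" by (rule norm_psi_lower[OF M R])
  finally show ?thesis .
qed

text \<open>The initial interval of flow uses the arbitrary value \<open>\<eta>(0)\<close>; the bound on \<open>\<eta>(0)\<close> keeps the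
  attitude error inside a sublevel set of \<open>rot_energy\<close> without half turns.  From the first
  jump on, \<open>\<eta>\<close> is the scaled gradient and each interval contracts \<open>rot_energy\<close>.\<close>

lemma attitude_decay:
  assumes M: "transpose M = M" "positive_definite (bar_matrix M)"
    and T: "0 < Tm" "Tm \<le> TM" and \<epsilon>: "0 < \<epsilon>" "\<epsilon> < 1"
  obtains etastar kstar where "etastar > 0" "kstar > 0"
    "\<And>kR. 0 < kR \<Longrightarrow> kR < kstar \<Longrightarrow> \<exists>K>0. \<exists>r>0. \<forall>n R e h.
      rotation_matrix (R 0) \<longrightarrow> rot_dist (R 0) \<le> \<epsilon> * sqrt (varsigma M) \<longrightarrow> norm (e 0) \<le> etastar \<longrightarrow>
      (\<forall>i<n. R (Suc i) = R i ** rodrigues (- h i) (e i)) \<longrightarrow>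
      (\<forall>i<n. e (Suc i) = kR *\<^sub>R psi (M ** R (Suc i))) \<longrightarrow>
      (\<forall>i\<le>n. h i \<in> {0..TM}) \<longrightarrow> (\<forall>i<n. 1 \<le> i \<longrightarrow> h i \<in> {Tm..TM}) \<longrightarrow>
      (rot_dist (R n ** rodrigues (- h n) (e n)))\<^sup>2 + (norm (e n))\<^sup>2
        \<le> K * exp (- r * real n) * ((rot_dist (R 0))\<^sup>2 + (norm (e 0))\<^sup>2)"
proof -
  let ?l = "eig_min (bar_matrix M)" and ?L = "eig_max (bar_matrix M)"
  note l = eig_min_pos[OF M(2)]
  define \<sigma> where "\<sigma> = sqrt (varsigma M)"
  have \<sigma>: "\<sigma> > 0" "\<sigma>\<^sup>2 = ?l / ?L" using l by (auto simp: \<sigma>_def varsigma_def)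
  \<comment> \<open>The midpoint leaves room on both sides: below for the first interval of flow,
    above to stay away from half turns.\<close>
  define d where "d = (1 + \<epsilon>) / 2"
  have d: "0 < d" "d < 1" "\<epsilon> < d" "d - \<epsilon> = (1 - \<epsilon>) / 2" using \<epsilon> by (auto simp: d_def field_simps)
  have d1: "d\<^sup>2 < 1" using d by (simp add: power_less_one_iff)
  have TM: "TM > 0" using T by simp
  \<comment> \<open>Within time \<open>TM\<close> the distance grows by at most
    \<open>TM * etastar\<close>, exactly the gap between \<open>\<epsilon> * \<sigma>\<close> and
    \<open>d * \<sigma>\<close>.\<close>
  define etastar where "etastar = (d - \<epsilon>) * \<sigma> / TM"
  have eta: "etastar > 0" "TM * etastar = (d - \<epsilon>) * \<sigma>" using d \<sigma> TM by (auto simp: etastar_def)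
  obtain Kp where Kp: "Kp > 0" "\<And>R. rotation_matrix R \<Longrightarrow> norm (psi (M ** R)) \<le> Kp * rot_dist R"
    by (rule psi_rotation_bounds[OF M(1)]) blast
  obtain kstar where k: "kstar > 0" and step: "\<And>kR h R. 0 < kR \<Longrightarrow> kR < kstar \<Longrightarrow> 0 \<le> h \<Longrightarrow> h \<le> TM \<Longrightarrow> rotation_matrix R \<Longrightarrow>
      rot_energy M (R ** rodrigues (- h) (kR *\<^sub>R psi (M ** R)))
        \<le> rot_energy M R - kR / 4 * h * (norm (psi (M ** R)))\<^sup>2"
    by (rule rot_energy_step[OF M(1) TM]) blast
  show thesis
  proof (rule that[OF eta(1) k])
    fix kR assume kR: "0 < kR" "kR < kstar"
    \<comment> \<open>The relative energy loss over one full interval: \<open>kR / 4\<close> times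
      the shortest length \<open>Tm\<close> times the factor from
      \<open>rot_energy_contraction\<close>.\<close>
    define c where "c = kR * Tm * (1 - d\<^sup>2) * ?l\<^sup>2 / ?L"
    have c: "c > 0" using kR T d1 l by (simp add: c_def)
    define S where "S = 2 * (1 + TM\<^sup>2)"
    \<comment> \<open>\<open>S + 1\<close> serves before the first jump. In the other term
      \<open>S\<close> bounds the first interval, \<open>?L / ?l\<close> converts energy back to
      distance, \<open>exp c\<close> repairs the index shift by one, and the last factor accounts
      for \<eta>.\<close>
    define K where "K = (S + 1) + exp c * (?L / ?l) * S * (1 + kR\<^sup>2 * Kp\<^sup>2)"
    have S: "S \<ge> 0" by (simp add: S_def)
    have LS: "0 \<le> exp c * (?L / ?l) * S * (1 + kR\<^sup>2 * Kp\<^sup>2)" using l S by (intro mult_nonneg_nonneg) auto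
    then have K: "K > 0" using S by (simp add: K_def)
    show "\<exists>K>0. \<exists>r>0. \<forall>n R e h.
      rotation_matrix (R 0) \<longrightarrow> rot_dist (R 0) \<le> \<epsilon> * sqrt (varsigma M) \<longrightarrow> norm (e 0) \<le> etastar \<longrightarrow>
      (\<forall>i<n. R (Suc i) = R i ** rodrigues (- h i) (e i)) \<longrightarrow>
      (\<forall>i<n. e (Suc i) = kR *\<^sub>R psi (M ** R (Suc i))) \<longrightarrow>
      (\<forall>i\<le>n. h i \<in> {0..TM}) \<longrightarrow> (\<forall>i<n. 1 \<le> i \<longrightarrow> h i \<in> {Tm..TM}) \<longrightarrow>
      (rot_dist (R n ** rodrigues (- h n) (e n)))\<^sup>2 + (norm (e n))\<^sup>2
        \<le> K * exp (- r * real n) * ((rot_dist (R 0))\<^sup>2 + (norm (e 0))\<^sup>2)"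
    proof (rule exI[of _ K], rule conjI[OF K], rule exI[of _ c], rule conjI[OF c], intro allI impI)
      fix n :: nat and R :: "nat \<Rightarrow> real^3^3" and e :: "nat \<Rightarrow> real^3" and h :: "nat \<Rightarrow> real"
      assume R0: "rotation_matrix (R 0)" and r0: "rot_dist (R 0) \<le> \<epsilon> * sqrt (varsigma M)" and e0: "norm (e 0) \<le> etastar"
        and RS: "\<forall>i<n. R (Suc i) = R i ** rodrigues (- h i) (e i)"
        and eS: "\<forall>i<n. e (Suc i) = kR *\<^sub>R psi (M ** R (Suc i))"
        and h: "\<forall>i\<le>n. h i \<in> {0..TM}" and h1: "\<forall>i<n. 1 \<le> i \<longrightarrow> h i \<in> {Tm..TM}"
      define Q where "Q = (rot_dist (R 0))\<^sup>2 + (norm (e 0))\<^sup>2"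
      define R1 where "R1 = R 0 ** rodrigues (- h 0) (e 0)"
      define Rf where "Rf = R n ** rodrigues (- h n) (e n)"
      have Q: "Q \<ge> 0" by (simp add: Q_def)
      have rot: "rotation_matrix (R i)" if "i \<le> n" for i
        using that by (induction i) (use R0 RS in \<open>auto simp: Suc_le_eq intro: rotation_matrix_mult rotation_matrix_rodrigues\<close>)
      have rotf: "rotation_matrix Rf" unfolding Rf_def using rot by (intro rotation_matrix_mult rotation_matrix_rodrigues) auto
      have rot1: "rotation_matrix R1" unfolding R1_def using R0 by (intro rotation_matrix_mult rotation_matrix_rodrigues)
      have h0: "\<bar>- h 0\<bar> \<le> TM" using h by auto
      have "rot_dist R1 \<le> rot_dist (R 0) + \<bar>- h 0\<bar> * norm (e 0)"
        unfolding R1_def by (rule rot_dist_mult_rodrigues[OF R0])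
      also have "\<dots> \<le> rot_dist (R 0) + TM * norm (e 0)" using h0 by (intro add_left_mono mult_right_mono) auto
      finally have r1: "rot_dist R1 \<le> rot_dist (R 0) + TM * norm (e 0)" .
      have "(rot_dist R1)\<^sup>2 \<le> (rot_dist (R 0) + TM * norm (e 0))\<^sup>2"
        using r1 rot_dist_nonneg[OF rot1] by (rule power_mono)
      also have "\<dots> \<le> 2 * (rot_dist (R 0))\<^sup>2 + 2 * (TM * norm (e 0))\<^sup>2"
        using sum_squares_bound[of "rot_dist (R 0)" "TM * norm (e 0)"] by (simp add: power2_sum)
      also have "\<dots> \<le> S * Q"
      proof -
        have "S * Q = 2 * (rot_dist (R 0))\<^sup>2 + 2 * (TM * norm (e 0))\<^sup>2 + 2 * (norm (e 0))\<^sup>2 + 2 * TM\<^sup>2 * (rot_dist (R 0))\<^sup>2"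
          by (simp add: S_def Q_def algebra_simps power_mult_distrib)
        then show ?thesis by simp
      qed
      finally have r1S: "(rot_dist R1)\<^sup>2 \<le> S * Q" .
      have "rot_dist R1 \<le> \<epsilon> * \<sigma> + TM * etastar"
        using r1 r0 mult_left_mono[OF e0 less_imp_le[OF TM]] unfolding \<sigma>_def by linarith
      also have "\<dots> = d * \<sigma>" unfolding eta(2) by (simp add: algebra_simps)
      finally have "(rot_dist R1)\<^sup>2 \<le> (d * \<sigma>)\<^sup>2" using rot_dist_nonneg[OF rot1] by (rule power_mono)
      then have "?L * (rot_dist R1)\<^sup>2 \<le> ?L * (d * \<sigma>)\<^sup>2" using l by simp
      also have "\<dots> = ?l * d\<^sup>2" unfolding power_mult_distrib \<sigma>(2) using l by simp
      finally have V1: "rot_energy M R1 \<le> ?l * d\<^sup>2" using rot_energy_bounds(2)[OF M rot1] by linarith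
      have V1S: "rot_energy M R1 \<le> ?L * (S * Q)"
        using rot_energy_bounds(2)[OF M rot1] mult_left_mono[OF r1S, of ?L] l by linarith
      have Vnn: "0 \<le> rot_energy M B" if "rotation_matrix B" for B
        using rot_energy_bounds(1)[OF M that] l by (meson less_imp_le mult_nonneg_nonneg order_trans zero_le_power2)
      \<comment> \<open>The exponent lags by one because the first interval does not contract. The
        induction hypothesis also keeps the energy below its value at \<open>R1\<close>, so the
        contraction estimate stays applicable.\<close>
      have main: "rot_energy M (R (Suc i)) \<le> exp (- c * real i) * rot_energy M R1" if "Suc i \<le> n" for i
        using that
      proof (induction i)
        case 0
        then show ?case using RS by (simp add: R1_def)
      next
        case (Suc i)
        let ?R = "R (Suc i)"
        have rr: "rotation_matrix ?R" using rot Suc.prems by simp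
        have IH: "rot_energy M ?R \<le> exp (- c * real i) * rot_energy M R1" using Suc by simp
        have "exp (- c * real i) \<le> 1" using c by simp
        then have "rot_energy M ?R \<le> rot_energy M R1"
          using IH Vnn[OF rot1] by (meson mult_left_le_one_le exp_ge_zero order_trans)
        then have con: "4 * (1 - d\<^sup>2) * ?l\<^sup>2 / ?L * rot_energy M ?R \<le> (norm (psi (M ** ?R)))\<^sup>2"
          using V1 d by (intro rot_energy_contraction[OF M rr]) auto
        have hh: "Tm \<le> h (Suc i)" "0 \<le> h (Suc i)" "h (Suc i) \<le> TM" using h1 h Suc.prems by (auto simp: Suc_le_eq)
        have "R (Suc (Suc i)) = ?R ** rodrigues (- h (Suc i)) (kR *\<^sub>R psi (M ** ?R))"
          using RS eS Suc.prems by (simp add: Suc_le_eq)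
        then have "rot_energy M (R (Suc (Suc i))) \<le> rot_energy M ?R - kR / 4 * h (Suc i) * (norm (psi (M ** ?R)))\<^sup>2"
          using step[OF kR hh(2,3) rr] by simp
        also have "kR / 4 * Tm * (4 * (1 - d\<^sup>2) * ?l\<^sup>2 / ?L * rot_energy M ?R) \<le> kR / 4 * h (Suc i) * (norm (psi (M ** ?R)))\<^sup>2"
          using hh kR T con Vnn[OF rr] d1 l by (intro mult_mono) auto
        then have "rot_energy M ?R - kR / 4 * h (Suc i) * (norm (psi (M ** ?R)))\<^sup>2 \<le> (1 + - c) * rot_energy M ?R"
          by (simp add: c_def algebra_simps)
        also have "\<dots> \<le> exp (- c) * rot_energy M ?R"
          by (rule mult_right_mono[OF exp_ge_add_one_self Vnn[OF rr]])
        also have "\<dots> \<le> exp (- c) * (exp (- c * real i) * rot_energy M R1)"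
          using IH by (rule mult_left_mono) simp
        also have "\<dots> = exp (- c * real (Suc i)) * rot_energy M R1"
          by (simp add: exp_add[symmetric] algebra_simps)
        finally show ?case .
      qed
      show "(rot_dist (R n ** rodrigues (- h n) (e n)))\<^sup>2 + (norm (e n))\<^sup>2
        \<le> K * exp (- c * real n) * ((rot_dist (R 0))\<^sup>2 + (norm (e 0))\<^sup>2)"
      proof (cases n)
        case 0
        have "(norm (e 0))\<^sup>2 \<le> Q" by (simp add: Q_def)
        then have "(rot_dist R1)\<^sup>2 + (norm (e 0))\<^sup>2 \<le> (S + 1) * Q" using r1S by (simp add: distrib_right)
        also have "\<dots> \<le> K * Q" using LS Q by (intro mult_right_mono) (auto simp: K_def)
        finally show ?thesis using 0 by (simp add: R1_def Q_def)
      next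
        case (Suc m)
        let ?R = "R n"
        have rr: "rotation_matrix ?R" by (rule rot) simp
        have en: "e n = kR *\<^sub>R psi (M ** ?R)" using eS Suc by simp
        have ex: "exp (- c * real m) = exp c * exp (- c * real n)"
          by (simp add: Suc exp_add[symmetric] algebra_simps)
        have Vn: "rot_energy M ?R \<le> ?l * (exp c * (?L / ?l) * S * exp (- c * real n) * Q)"
        proof -
          have "rot_energy M ?R \<le> exp (- c * real m) * rot_energy M R1" using main[of m] Suc by simp
          also have "\<dots> \<le> exp (- c * real m) * (?L * (S * Q))" using V1S by (rule mult_left_mono) simp
          also have "\<dots> = ?l * (exp c * (?L / ?l) * S * exp (- c * real n) * Q)" unfolding ex using l by simp
          finally show ?thesis .
        qed
        \<comment> \<open>The current interval may be arbitrarily short, so only monotonicity of the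
          energy is used on it.\<close>
        have hn: "0 \<le> h n" "h n \<le> TM" using h by auto
        have "rot_energy M Rf \<le> rot_energy M ?R"
        proof -
          have "0 \<le> kR / 4 * h n * (norm (psi (M ** ?R)))\<^sup>2" using kR hn by simp
          then show ?thesis using step[OF kR hn rr] unfolding Rf_def en by linarith
        qed
        then have "?l * (rot_dist Rf)\<^sup>2 \<le> ?l * (exp c * (?L / ?l) * S * exp (- c * real n) * Q)"
          using rot_energy_bounds(1)[OF M rotf] Vn by linarith
        then have f: "(rot_dist Rf)\<^sup>2 \<le> exp c * (?L / ?l) * S * exp (- c * real n) * Q" using l(1) by (simp only: mult_le_cancel_left_pos)
        have "?l * (rot_dist ?R)\<^sup>2 \<le> ?l * (exp c * (?L / ?l) * S * exp (- c * real n) * Q)"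
          using rot_energy_bounds(1)[OF M rr] Vn by linarith
        then have g: "(rot_dist ?R)\<^sup>2 \<le> exp c * (?L / ?l) * S * exp (- c * real n) * Q" using l(1) by (simp only: mult_le_cancel_left_pos)
        have "norm (e n) \<le> kR * (Kp * rot_dist ?R)" unfolding en using Kp(2)[OF rr] kR by simp
        then have "(norm (e n))\<^sup>2 \<le> (kR * (Kp * rot_dist ?R))\<^sup>2" by (rule power_mono) simp
        also have "\<dots> = kR\<^sup>2 * Kp\<^sup>2 * (rot_dist ?R)\<^sup>2" by (simp add: power_mult_distrib)
        also have "\<dots> \<le> kR\<^sup>2 * Kp\<^sup>2 * (exp c * (?L / ?l) * S * exp (- c * real n) * Q)" using g by (rule mult_left_mono) simp
        finally have "(rot_dist Rf)\<^sup>2 + (norm (e n))\<^sup>2 \<le> (exp c * (?L / ?l) * S * (1 + kR\<^sup>2 * Kp\<^sup>2)) * (exp (- c * real n) * Q)"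
          using f by (simp add: algebra_simps)
        also have "\<dots> \<le> K * (exp (- c * real n) * Q)"
          using S Q by (intro mult_right_mono) (auto simp: K_def)
        finally show ?thesis by (simp add: Rf_def Q_def mult.assoc)
      qed
    qed
  qed
qed

lemma linear_decay:
  assumes P: "positive_definite P" and Xi: "\<forall>\<tau>\<in>{Tm..TM}. negative_definite (Xi kp kv kg P \<tau>)"
    and T: "0 < Tm" "Tm \<le> TM"
  obtains K r where "K > 0" "r > 0"
    "\<And>n X h. (\<And>i. i < n \<Longrightarrow> X (Suc i) = Ag_mat kp kv kg *v (Phi (h i) *v X i)) \<Longrightarrow>
      (\<And>i. i \<le> n \<Longrightarrow> h i \<in> {0..TM}) \<Longrightarrow> (\<And>i. 1 \<le> i \<Longrightarrow> i < n \<Longrightarrow> h i \<in> {Tm..TM}) \<Longrightarrow>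
      (norm (Phi (h n) *v X n))\<^sup>2 \<le> K * exp (- r * real n) * (norm (X 0))\<^sup>2"
proof -
  let ?G = "Ag_mat kp kv kg"
  let ?W = "\<lambda>X. X \<bullet> (P *v X)"
  let ?l = "eig_min P" and ?L = "eig_max P"
  have symP: "transpose P = P" using P by (simp add: positive_definite_def)
  note l = eig_min_pos[OF P]
  obtain r where r: "r > 0" "\<And>\<tau> X. \<tau> \<in> {Tm..TM} \<Longrightarrow> ?W (Phi \<tau> *v (?G *v X)) \<le> exp (- r) * ?W X"
    by (rule sampled_lyapunov_decay[OF P Xi T(2)]) blast
  have "0 \<le> TM" using T by simp
  then obtain F where F: "F \<ge> 1" "\<And>s X. \<bar>s\<bar> \<le> TM \<Longrightarrow> norm (Phi s *v X) \<le> F * norm X"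
    by (rule Phi_norm_bound) blast
  obtain C where C: "C > 0" "\<And>X. norm (?G *v X) \<le> C * norm X"
    using linear_bounded_pos[OF matrix_vector_mul_linear[of ?G]] by blast
  \<comment> \<open>The first summand covers the time before any jump. In the second, the two powers
    of \<open>F\<close> bound the first and the current flow, \<open>C\<close> the last jump,
    \<open>?L / ?l\<close> the change of norm, and \<open>exp r\<close> the index shift.\<close>
  define K where "K = F\<^sup>2 + F\<^sup>2 * C\<^sup>2 * exp r * (?L / ?l) * F\<^sup>2"
  have "0 \<le> F\<^sup>2 * C\<^sup>2 * exp r * (?L / ?l) * F\<^sup>2" using l by (intro mult_nonneg_nonneg) auto
  moreover have "F\<^sup>2 > 0" using F(1) by (intro zero_less_power) simp
  ultimately have K: "K > 0" "F\<^sup>2 \<le> K" unfolding K_def by linarith+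
  show thesis
  proof (rule that[OF K(1) r(1)])
    fix n :: nat and X :: "nat \<Rightarrow> vec9" and h :: "nat \<Rightarrow> real"
    assume XS: "\<And>i. i < n \<Longrightarrow> X (Suc i) = ?G *v (Phi (h i) *v X i)"
      and h: "\<And>i. i \<le> n \<Longrightarrow> h i \<in> {0..TM}" and h1: "\<And>i. 1 \<le> i \<Longrightarrow> i < n \<Longrightarrow> h i \<in> {Tm..TM}"
    \<comment> \<open>States at the ends of the intervals of flow: from one to the next there is a
      jump and then a flow, the order for which the matrix inequality is stated.\<close>
    define Y where "Y = (\<lambda>i. Phi (h i) *v X i)"
    have Fh: "norm (Phi (h i) *v Z) \<le> F * norm Z" if "i \<le> n" for i Z
      using h[OF that] by (intro F(2)) auto
    have W: "?W (Y i) \<le> exp (- r * real i) * ?W (Y 0)" if "i < n" for i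
      using that
    proof (induction i)
      case (Suc i)
      have "?W (Y (Suc i)) \<le> exp (- r) * ?W (Y i)"
        unfolding Y_def[THEN fun_cong, of "Suc i"] using XS[of i] Suc.prems h1[of "Suc i"] r(2) by (simp add: Y_def)
      also have "\<dots> \<le> exp (- r) * (exp (- r * real i) * ?W (Y 0))" using Suc by (intro mult_left_mono) auto
      also have "\<dots> = exp (- r * real (Suc i)) * ?W (Y 0)" by (simp add: exp_add[symmetric] algebra_simps)
      finally show ?case .
    qed simp
    have Y0: "(norm (Y 0))\<^sup>2 \<le> F\<^sup>2 * (norm (X 0))\<^sup>2"
      unfolding power_mult_distrib[symmetric] Y_def by (intro power_mono Fh) auto
    have "(norm (Y n))\<^sup>2 \<le> K * exp (- r * real n) * (norm (X 0))\<^sup>2"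
    proof (cases n)
      case 0
      have "F\<^sup>2 * (norm (X 0))\<^sup>2 \<le> K * (norm (X 0))\<^sup>2" using K(2) by (rule mult_right_mono) simp
      then show ?thesis using Y0 0 by simp
    next
      case (Suc m)
      have ex: "exp (- r * real m) = exp r * exp (- r * real n)"
        by (simp add: Suc exp_add[symmetric] algebra_simps)
      have "?l * (norm (Y m))\<^sup>2 \<le> ?W (Y m)" by (rule eig_bounds(1)[OF symP])
      also have "\<dots> \<le> exp (- r * real m) * ?W (Y 0)" using W Suc by simp
      also have "\<dots> \<le> exp (- r * real m) * (?L * (norm (Y 0))\<^sup>2)"
        by (intro mult_left_mono eig_bounds(2)[OF symP]) simp
      also have "\<dots> \<le> exp (- r * real m) * (?L * (F\<^sup>2 * (norm (X 0))\<^sup>2))"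
        using Y0 l by (intro mult_left_mono) auto
      also have "\<dots> = ?l * (exp r * (?L / ?l) * F\<^sup>2 * (exp (- r * real n) * (norm (X 0))\<^sup>2))"
        unfolding ex using l by simp
      finally have Ym: "(norm (Y m))\<^sup>2 \<le> exp r * (?L / ?l) * F\<^sup>2 * (exp (- r * real n) * (norm (X 0))\<^sup>2)"
        using l(1) by (simp only: mult_le_cancel_left_pos)
      have "Y n = Phi (h n) *v (?G *v Y m)" using XS[of m] Suc by (simp add: Y_def)
      then have "norm (Y n) \<le> F * norm (?G *v Y m)" using Fh[of n] by simp
      also have "\<dots> \<le> F * (C * norm (Y m))" using C(2)[of "Y m"] F(1) by (intro mult_left_mono) auto
      finally have "(norm (Y n))\<^sup>2 \<le> (F * (C * norm (Y m)))\<^sup>2" by (rule power_mono) simp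
      also have "\<dots> = F\<^sup>2 * C\<^sup>2 * (norm (Y m))\<^sup>2" by (simp add: power_mult_distrib)
      also have "\<dots> \<le> F\<^sup>2 * C\<^sup>2 * (exp r * (?L / ?l) * F\<^sup>2 * (exp (- r * real n) * (norm (X 0))\<^sup>2))"
        using Ym by (rule mult_left_mono) simp
      also have "\<dots> = (F\<^sup>2 * C\<^sup>2 * exp r * (?L / ?l) * F\<^sup>2) * (exp (- r * real n) * (norm (X 0))\<^sup>2)"
        by (simp add: mult_ac)
      also have "\<dots> \<le> K * (exp (- r * real n) * (norm (X 0))\<^sup>2)"
        by (rule mult_right_mono) (auto simp: K_def)
      finally show ?thesis by (simp add: mult.assoc)
    qed
    then show "(norm (Phi (h n) *v X n))\<^sup>2 \<le> K * exp (- r * real n) * (norm (X 0))\<^sup>2" by (simp add: Y_def)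
  qed
qed

section \<open>Combination of the attitude and linear estimates\<close>

theorem theorem6:
  fixes N :: nat and p :: "nat \<Rightarrow> real^3" and k :: "nat \<Rightarrow> real"
    and Tm TM kp kv kg :: real
  assumes "N \<ge> 3"
    and "\<exists>i\<in>{1..N}. \<exists>j\<in>{1..N}. \<exists>l\<in>{1..N}. \<not> collinear {p i, p j, p l}"
    and "\<forall>i\<in>{1..N}. k i > 0" and "(\<Sum>i=1..N. k i) = 1"
    and "0 < Tm" and "Tm \<le> TM"
    and "kp > 0" and "kv > 0" and "kg > 0"
    and "\<exists>P. positive_definite P \<and> (\<forall>\<tau>\<in>{Tm..TM}. negative_definite (Xi kp kv kg P \<tau>))"
  shows "\<forall>\<epsilon>. 0 < \<epsilon> \<and> \<epsilon> < 1 \<longrightarrow>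
    (\<exists>\<eta>star>0. \<exists>kRstar>0. \<forall>kR. 0 < kR \<and> kR < kRstar \<longrightarrow>
      (\<exists>\<kappa>>0. \<exists>\<mu>>0. \<forall>E x R0 \<eta>0 X0 \<tau>0.
        maximal_hybrid_solution (err_flow_set TM) err_flow err_jump_set
          (err_jump (landmark_matrix N k p) kR kp kv kg Tm TM) E x \<and>
        x 0 0 = (R0, \<eta>0, X0, \<tau>0) \<and>
        rot_dist R0 \<le> \<epsilon> * sqrt (varsigma (landmark_matrix N k p)) \<and> norm \<eta>0 \<le> \<eta>star
        \<longrightarrow> complete_domain E \<and>
            (\<forall>(t, j) \<in> E. target_dist (x t j)
               \<le> \<kappa> * exp (- \<mu> * (t + real j)) * target_dist (x 0 0))))"
proof (intro allI impI, goal_cases)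
  case (1 \<epsilon>)
  note \<epsilon> = this
  define M where "M = landmark_matrix N k p"
  have M: "transpose M = M" "positive_definite (bar_matrix M)"
    unfolding M_def by (rule transpose_landmark_matrix, rule bar_landmark_positive_definite[OF assms(2,3)])
  obtain P where P: "positive_definite P" "\<forall>\<tau>\<in>{Tm..TM}. negative_definite (Xi kp kv kg P \<tau>)"
    using assms(10) by blast
  obtain K1 r1 where lin: "K1 > 0" "r1 > 0"
    "\<And>n X h. (\<And>i. i < n \<Longrightarrow> X (Suc i) = Ag_mat kp kv kg *v (Phi (h i) *v X i)) \<Longrightarrow>
      (\<And>i. i \<le> n \<Longrightarrow> h i \<in> {0..TM}) \<Longrightarrow> (\<And>i. 1 \<le> i \<Longrightarrow> i < n \<Longrightarrow> h i \<in> {Tm..TM}) \<Longrightarrow>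
      (norm (Phi (h n) *v X n))\<^sup>2 \<le> K1 * exp (- r1 * real n) * (norm (X 0))\<^sup>2"
    by (rule linear_decay[OF P assms(5,6)]) blast
  show ?case
  proof (rule attitude_decay[OF M assms(5,6) conjunct1[OF \<epsilon>] conjunct2[OF \<epsilon>]])
    fix etastar kstar :: real
    assume etastar: "0 < etastar" and kstar: "0 < kstar"
    assume attitude: "\<And>kR. 0 < kR \<Longrightarrow> kR < kstar \<Longrightarrow> \<exists>K>0. \<exists>r>0. \<forall>n R e h.
      rotation_matrix (R 0) \<longrightarrow> rot_dist (R 0) \<le> \<epsilon> * sqrt (varsigma M) \<longrightarrow> norm (e 0) \<le> etastar \<longrightarrow>
      (\<forall>i<n. R (Suc i) = R i ** rodrigues (- h i) (e i)) \<longrightarrow>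
      (\<forall>i<n. e (Suc i) = kR *\<^sub>R psi (M ** R (Suc i))) \<longrightarrow>
      (\<forall>i\<le>n. h i \<in> {0..TM}) \<longrightarrow> (\<forall>i<n. 1 \<le> i \<longrightarrow> h i \<in> {Tm..TM}) \<longrightarrow>
      (rot_dist (R n ** rodrigues (- h n) (e n)))\<^sup>2 + (norm (e n))\<^sup>2
        \<le> K * exp (- r * real n) * ((rot_dist (R 0))\<^sup>2 + (norm (e 0))\<^sup>2)"
    show ?thesis
    proof (rule exI[of _ etastar], rule conjI[OF etastar], rule exI[of _ kstar], rule conjI[OF kstar],
        intro allI impI, elim conjE)
      fix kR :: real
      assume "0 < kR" "kR < kstar"
      from attitude[OF \<open>0 < kR\<close> \<open>kR < kstar\<close>] obtain K2 r2 where K2: "K2 > 0" and r2: "r2 > 0" and att: "\<forall>n R e h.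
        rotation_matrix (R 0) \<longrightarrow> rot_dist (R 0) \<le> \<epsilon> * sqrt (varsigma M) \<longrightarrow> norm (e 0) \<le> etastar \<longrightarrow>
        (\<forall>i<n. R (Suc i) = R i ** rodrigues (- h i) (e i)) \<longrightarrow>
        (\<forall>i<n. e (Suc i) = kR *\<^sub>R psi (M ** R (Suc i))) \<longrightarrow>
        (\<forall>i\<le>n. h i \<in> {0..TM}) \<longrightarrow> (\<forall>i<n. 1 \<le> i \<longrightarrow> h i \<in> {Tm..TM}) \<longrightarrow>
        (rot_dist (R n ** rodrigues (- h n) (e n)))\<^sup>2 + (norm (e n))\<^sup>2
          \<le> K2 * exp (- r2 * real n) * ((rot_dist (R 0))\<^sup>2 + (norm (e 0))\<^sup>2)"
        by (elim exE conjE)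
      \<comment> \<open>Both estimates concern squares, hence the halved rate. Since
        \<open>t \<le> (j + 1) * TM\<close>, the sum \<open>t + j\<close> is at most
        \<open>(j + 1) * (TM + 1)\<close>: this gives the denominator of \<mu>, and the extra 1
        gives \<open>exp (r / 2)\<close> in \<kappa>.\<close>
      define r where "r = min r1 r2"
      define \<mu> where "\<mu> = r / (2 * (TM + 1))"
      define \<kappa> where "\<kappa> = sqrt (K1 + K2) * exp (r / 2)"
      have TM: "TM > 0" using assms(5,6) by simp
      have r: "r > 0" "r \<le> r1" "r \<le> r2" using lin(2) r2 by (auto simp: r_def)
      have "\<mu> > 0" using r TM by (simp add: \<mu>_def)
      have "\<kappa> > 0" using lin(1) K2 by (simp add: \<kappa>_def)
      show "\<exists>\<kappa>>0. \<exists>\<mu>>0. \<forall>E x R0 \<eta>0 X0 \<tau>0.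
          maximal_hybrid_solution (err_flow_set TM) err_flow err_jump_set
            (err_jump (landmark_matrix N k p) kR kp kv kg Tm TM) E x \<and>
          x 0 0 = (R0, \<eta>0, X0, \<tau>0) \<and>
          rot_dist R0 \<le> \<epsilon> * sqrt (varsigma (landmark_matrix N k p)) \<and> norm \<eta>0 \<le> etastar
          \<longrightarrow> complete_domain E \<and>
              (\<forall>(t, j) \<in> E. target_dist (x t j)
                 \<le> \<kappa> * exp (- \<mu> * (t + real j)) * target_dist (x 0 0))"
        unfolding M_def[symmetric]
      proof (rule exI[of _ \<kappa>], rule conjI[OF \<open>\<kappa> > 0\<close>], rule exI[of _ \<mu>], rule conjI[OF \<open>\<mu> > 0\<close>],
          intro allI impI, elim conjE)
        fix E x R0 \<eta>0 X0 \<tau>0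
        assume max: "maximal_hybrid_solution (err_flow_set TM) err_flow err_jump_set (err_jump M kR kp kv kg Tm TM) E x"
          and x0: "x 0 0 = (R0, \<eta>0, X0, \<tau>0)"
          and R0: "rot_dist R0 \<le> \<epsilon> * sqrt (varsigma M)" and \<eta>0: "norm \<eta>0 \<le> etastar"
        interpret err_solution M kR kp kv kg Tm TM E x
          using max assms(5,6) by unfold_locales (simp_all add: maximal_hybrid_solution_def)
        have "target_dist (x t j) \<le> \<kappa> * exp (- \<mu> * (t + real j)) * target_dist (x 0 0)" if tj: "(t, j) \<in> E" for t j
        proof (rule sampled[OF tj])
          fix z :: "nat \<Rightarrow> err_state" and h :: "nat \<Rightarrow> real"
          assume z0: "z 0 = x 0 0" and xt: "x t j = err_sol (h j) (z j)"
            and zS: "\<And>i. i < j \<Longrightarrow> z (Suc i) \<in> err_jump M kR kp kv kg Tm TM (err_sol (h i) (z i))"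
            and h: "\<And>i. i \<le> j \<Longrightarrow> h i \<in> {0..TM}" "\<And>i. 1 \<le> i \<Longrightarrow> i < j \<Longrightarrow> h i \<in> {Tm..TM}"
            and t: "t \<le> real (Suc j) * TM"
          define R e X where "R = (\<lambda>i. fst (z i))" and "e = (\<lambda>i. fst (snd (z i)))" and "X = (\<lambda>i. fst (snd (snd (z i))))"
          have z: "err_sol (h i) (z i) = (R i ** rodrigues (- h i) (e i), e i, Phi (h i) *v X i, timer (z i) - h i)" for i
            by (cases "z i") (simp add: err_sol_def R_def e_def X_def)
          have init: "R 0 = R0" "e 0 = \<eta>0" "X 0 = X0" by (simp_all add: R_def e_def X_def z0 x0)
          have rec: "R (Suc i) = R i ** rodrigues (- h i) (e i)" "e (Suc i) = kR *\<^sub>R psi (M ** R (Suc i))"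
            "X (Suc i) = Ag_mat kp kv kg *v (Phi (h i) *v X i)" if "i < j" for i
            using zS[OF that] unfolding z by (auto simp: err_jump_def R_def e_def X_def)
          define A where "A = (rot_dist R0)\<^sup>2 + (norm \<eta>0)\<^sup>2"
          have A: "A \<ge> 0" by (simp add: A_def)
          have D: "(target_dist (R', e', X', \<tau>'))\<^sup>2 = (rot_dist R')\<^sup>2 + (norm e')\<^sup>2 + (norm X')\<^sup>2" for R' e' X' \<tau>'
            by (simp add: target_dist_def)
          have D0: "(target_dist (x 0 0))\<^sup>2 = A + (norm X0)\<^sup>2" unfolding x0 D A_def ..
          have "(rot_dist (R j ** rodrigues (- h j) (e j)))\<^sup>2 + (norm (e j))\<^sup>2 \<le> K2 * exp (- r2 * real j) * A"
            unfolding A_def init[symmetric]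
            by (rule att[rule_format]) (use rec initial(1) h R0 \<eta>0 in \<open>auto simp: init x0\<close>)
          also have "\<dots> \<le> K2 * exp (- r * real j) * A"
            using K2 A r by (intro mult_right_mono mult_left_mono) (auto intro: mult_right_mono)
          finally have a: "(rot_dist (R j ** rodrigues (- h j) (e j)))\<^sup>2 + (norm (e j))\<^sup>2 \<le> K2 * exp (- r * real j) * A" .
          have "(norm (Phi (h j) *v X j))\<^sup>2 \<le> K1 * exp (- r1 * real j) * (norm (X 0))\<^sup>2"
            by (rule lin(3)) (use rec h in auto)
          also have "\<dots> \<le> K1 * exp (- r * real j) * (norm X0)\<^sup>2"
            unfolding init using lin(1) r by (intro mult_right_mono mult_left_mono) (auto intro: mult_right_mono)
          finally have b: "(norm (Phi (h j) *v X j))\<^sup>2 \<le> K1 * exp (- r * real j) * (norm X0)\<^sup>2" .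
          \<comment> \<open>These are the cross terms that complete the sum of the two estimates to
            a multiple of the squared initial distance.\<close>
          have nn: "0 \<le> K1 * (exp (- r * real j) * A)" "0 \<le> K2 * (exp (- r * real j) * (norm X0)\<^sup>2)"
            using lin(1) K2 A by auto
          have "(target_dist (x t j))\<^sup>2 = (rot_dist (R j ** rodrigues (- h j) (e j)))\<^sup>2 + (norm (e j))\<^sup>2 + (norm (Phi (h j) *v X j))\<^sup>2"
            unfolding xt z D ..
          also have "\<dots> \<le> (K1 + K2) * (exp (- r * real j) * (A + (norm X0)\<^sup>2))"
            using add_mono[OF a b] nn by (simp add: algebra_simps)
          also have "\<dots> = (sqrt (K1 + K2) * exp (- r * real j / 2) * target_dist (x 0 0))\<^sup>2"
            using lin(1) K2 exp_double[of "- r * real j / 2"] unfolding power_mult_distrib D0 by simp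
          finally have "target_dist (x t j) \<le> sqrt (K1 + K2) * exp (- r * real j / 2) * target_dist (x 0 0)"
            by (rule power2_le_imp_le) (use lin(1) K2 in \<open>simp add: x0 target_dist_def\<close>)
          also have "\<dots> \<le> \<kappa> * exp (- \<mu> * (t + real j)) * target_dist (x 0 0)"
          proof (rule mult_right_mono)
            have "\<mu> * (t + real j) \<le> \<mu> * (real (Suc j) * (TM + 1))"
              using t \<open>\<mu> > 0\<close> by (intro mult_left_mono) (auto simp: algebra_simps)
            also have "\<dots> = r / 2 + r * real j / 2" using TM by (simp add: \<mu>_def field_simps)
            finally have "exp (- r * real j / 2) \<le> exp (r / 2 + - \<mu> * (t + real j))" by simp
            then have "sqrt (K1 + K2) * exp (- r * real j / 2) \<le> sqrt (K1 + K2) * exp (r / 2 + - \<mu> * (t + real j))"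
              using lin(1) K2 by (intro mult_left_mono) auto
            then show "sqrt (K1 + K2) * exp (- r * real j / 2) \<le> \<kappa> * exp (- \<mu> * (t + real j))"
              unfolding \<kappa>_def exp_add by (simp add: mult.assoc)
            show "0 \<le> target_dist (x 0 0)" by (simp add: x0 target_dist_def)
          qed
          finally show ?thesis .
        qed
        then show "complete_domain E \<and> (\<forall>(t, j)\<in>E. target_dist (x t j)
            \<le> \<kappa> * exp (- \<mu> * (t + real j)) * target_dist (x 0 0))"
          using maximal_imp_complete[OF max] by auto
      qed
    qed
  qed
qed

end
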